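(* Let $d\ge 1$ be an integer and let $0<\beta<+\infty$. For a real exponent $q>0$ set $$M_{\beta,q}=\sup\big\{\lambda_\beta(\Omega)\,T_\beta(\Omega)^q\ :\ \Omega\subset\mathbb{R}^d \text{ bounded open set with Lipschitz boundary},\ |\Omega|=1\big\}.$$ Then: \begin{itemize} \item for every $0<q<1$ we have $M_{\beta,q}=+\infty$; \item for $q=1$ we have $M_{\beta,1}=1$; \item for every $q>1$ we have $M_{\beta,q}<+\infty$. \end{itemize}
   Context: $|\Omega|$ denotes the Lebesgue measure of $\Omega$ and $\mathcal{H}^{d-1}$ the $(d-1)$-dimensional Hausdorff measure. Admissible sets $\Omega$ are bounded open subsets of $\mathbb{R}^d$ with Lipschitz boundary; they are not required to be connected (for $d=1$: finite unions of bounded open intervals with disjoint closures). For $u\in H^1(\Omega)$, the values of $u$ on $\partial\Omega$ are understood in the sense of traces. For $0<\beta<+\infty$, the first Robin eigenvalue of $\Omega$ is $$\lambda_\beta(\Omega)=\min\left\{\frac{\int_\Omega|\nabla u|^2\,dx+\beta\int_{\partial\Omega}u^2\,d\mathcal{H}^{d-1}}{\int_\Omega u^2\,dx}\ :\ u\in H^1(\Omega)\setminus\{0\}\right\},$$ i.e. the smallest $\lambda$ for which $-\Delta u=\lambda u$ in $\Omega$, $\partial_\nu u+\beta u=0$ on $\partial\Omega$ ($\nu$ the outward unit normal) has a nontrivial solution. The Robin torsional rigidity of $\Omega$ is $T_\beta(\Omega)=\int_\Omega w_\beta\,dx$, where $w_\beta\in H^1(\Omega)$ is the unique weak solution of $-\Delta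 w=1$ in $\Omega$, $\partial_\nu w+\beta w=0$ on $\partial\Omega$; equivalently $$T_\beta(\Omega)=\max\left\{\frac{\big(\int_\Omega u\,dx\big)^2}{\int_\Omega|\nabla u|^2\,dx+\beta\int_{\partial\Omega}u^2\,d\mathcal{H}^{d-1}}\ :\ u\in H^1(\Omega)\setminus\{0\}\right\}.$$ *)

theory Defs
  imports "HOL-Analysis.Analysis"
begin

section \<open>Hausdorff measure\<close>

text \<open>
  The normalising factor makes the \<open>k\<close>-dimensional measure agree with Lebesgue measure on
  \<open>k\<close>-dimensional affine subspaces. Since \<open>0 ^ 0 = 1\<close>, for \<open>k = 0\<close> every nonempty set has weight
  \<open>1\<close> and one obtains the counting measure; the empty set has to be treated separately.
\<close>

definition hausdorff_weight :: "nat \<Rightarrow> 'a::metric_space set \<Rightarrow> ennreal" where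
  "hausdorff_weight k U =
     (if U = {} then 0 else ennreal (unit_ball_vol (real k) * (diameter U / 2) ^ k))"

definition hausdorff_content :: "nat \<Rightarrow> real \<Rightarrow> 'a::metric_space set \<Rightarrow> ennreal" where
  "hausdorff_content k \<delta> A =
     (INF U\<in>{U :: nat \<Rightarrow> 'a set. A \<subseteq> (\<Union>i. U i) \<and> (\<forall>i. bounded (U i) \<and> diameter (U i) \<le> \<delta>)}.
        \<Sum>i. hausdorff_weight k (U i))"

definition hausdorff_outer :: "nat \<Rightarrow> 'a::metric_space set \<Rightarrow> ennreal" where
  "hausdorff_outer k A = (SUP \<delta>\<in>{0<..}. hausdorff_content k \<delta> A)"

text \<open>
  \<open>hausdorff_outer k\<close> is a metric outer measure, so it is countably additive on the Borel sets and
  coincides there with the measure defined next.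
\<close>

definition hausdorff_measure :: "nat \<Rightarrow> 'a::metric_space measure" where
  "hausdorff_measure k = measure_of UNIV (sets borel) (hausdorff_outer k)"

definition surface_measure :: "'a::euclidean_space set \<Rightarrow> 'a measure" where
  "surface_measure \<Omega> = restrict_space (hausdorff_measure (DIM('a) - 1)) (frontier \<Omega>)"


section \<open>Bounded open sets with Lipschitz boundary\<close>

text \<open>
  Near each boundary point the set is, in the direction of some unit vector \<open>e\<close>, the part lying
  strictly above the graph of a Lipschitz function on the hyperplane orthogonal to \<open>e\<close>. In
  dimension one the hyperplane is \<open>{0}\<close>, and the bounded sets of this kind are the finite unions of
  bounded open intervals with disjoint closures.
\<close>

definition lipschitz_boundary :: "'a::euclidean_space set \<Rightarrow> bool" where
  "lipschitz_boundary \<Omega> \<longleftrightarrow>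
     (\<forall>p\<in>frontier \<Omega>. \<exists>r>0. \<exists>e L. \<exists>\<gamma> :: 'a \<Rightarrow> real.
        norm e = 1 \<and> L-lipschitz_on {y. y \<bullet> e = 0} \<gamma> \<and>
        \<Omega> \<inter> ball p r = {x \<in> ball p r. \<gamma> (x - (x \<bullet> e) *\<^sub>R e) < x \<bullet> e})"

definition unit_volume_domains :: "'a::euclidean_space set set" where
  "unit_volume_domains =
     {\<Omega>. open \<Omega> \<and> bounded \<Omega> \<and> lipschitz_boundary \<Omega> \<and> measure lebesgue \<Omega> = 1}"


section \<open>Sobolev functions and traces\<close>

primrec iterated_deriv :: "'a::real_normed_vector list \<Rightarrow> ('a \<Rightarrow> real) \<Rightarrow> 'a \<Rightarrow> real" where
  "iterated_deriv [] f = f"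
| "iterated_deriv (v # vs) f = (\<lambda>x. frechet_derivative (iterated_deriv vs f) (at x) v)"

definition smooth :: "('a::real_normed_vector \<Rightarrow> real) \<Rightarrow> bool" where
  "smooth f \<longleftrightarrow> (\<forall>vs. iterated_deriv vs f differentiable_on UNIV)"

definition gradient :: "('a::euclidean_space \<Rightarrow> real) \<Rightarrow> 'a \<Rightarrow> 'a" where
  "gradient f x = (\<Sum>b\<in>Basis. frechet_derivative f (at x) b *\<^sub>R b)"

definition test_function :: "'a::euclidean_space set \<Rightarrow> ('a \<Rightarrow> real) \<Rightarrow> bool" where
  "test_function \<Omega> \<phi> \<longleftrightarrow>
     smooth \<phi> \<and> compact (closure {x. \<phi> x \<noteq> 0}) \<and> closure {x. \<phi> x \<noteq> 0} \<subseteq> \<Omega>"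

definition L2 :: "'a measure \<Rightarrow> ('a \<Rightarrow> 'b::euclidean_space) \<Rightarrow> bool" where
  "L2 M f \<longleftrightarrow> f \<in> borel_measurable M \<and> integrable M (\<lambda>x. (norm (f x))\<^sup>2)"

text \<open>
  \<open>H1 \<Omega> u g\<close>: the function \<open>u\<close> represents an element of \<open>H\<^sup>1(\<Omega>)\<close> and \<open>g\<close> represents its weak
  gradient, which is determined by \<open>u\<close> up to a null set.
\<close>

definition H1 :: "'a::euclidean_space set \<Rightarrow> ('a \<Rightarrow> real) \<Rightarrow> ('a \<Rightarrow> 'a) \<Rightarrow> bool" where
  "H1 \<Omega> u g \<longleftrightarrow>
     L2 (lebesgue_on \<Omega>) u \<and> L2 (lebesgue_on \<Omega>) g \<and>
     (\<forall>\<phi>. test_function \<Omega> \<phi> \<longrightarrow>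
        (LINT x|lebesgue_on \<Omega>. u x *\<^sub>R gradient \<phi> x) = - (LINT x|lebesgue_on \<Omega>. \<phi> x *\<^sub>R g x))"

text \<open>
  \<open>H1_trace \<Omega> u g t\<close>: moreover \<open>t\<close> represents the trace of \<open>u\<close>. For a bounded open set with Lipschitz
  boundary the trace operator is the unique continuous linear map from \<open>H\<^sup>1(\<Omega>)\<close> to \<open>L\<^sup>2(\<partial>\<Omega>)\<close>
  extending the restriction to the boundary of functions that are smooth up to the boundary. As
  these functions are dense in \<open>H\<^sup>1(\<Omega>)\<close>, the relation below is the graph of that operator: every
  element of \<open>H\<^sup>1(\<Omega>)\<close> has exactly one trace up to a null set of the surface measure.
\<close>

definition H1_trace ::
  "'a::euclidean_space set \<Rightarrow> ('a \<Rightarrow> real) \<Rightarrow> ('a \<Rightarrow> 'a) \<Rightarrow> ('a \<Rightarrow> real) \<Rightarrow> bool" where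
  "H1_trace \<Omega> u g t \<longleftrightarrow>
     H1 \<Omega> u g \<and> L2 (surface_measure \<Omega>) t \<and>
     (\<exists>\<phi>. (\<forall>n::nat. smooth (\<phi> n)) \<and>
        (\<lambda>n. \<integral>\<^sup>+x. ennreal ((\<phi> n x - u x)\<^sup>2) \<partial>lebesgue_on \<Omega>) \<longlonglongrightarrow> 0 \<and>
        (\<lambda>n. \<integral>\<^sup>+x. ennreal ((norm (gradient (\<phi> n) x - g x))\<^sup>2) \<partial>lebesgue_on \<Omega>) \<longlonglongrightarrow> 0 \<and>
        (\<lambda>n. \<integral>\<^sup>+x. ennreal ((\<phi> n x - t x)\<^sup>2) \<partial>surface_measure \<Omega>) \<longlonglongrightarrow> 0)"


section \<open>Robin eigenvalue and Robin torsional rigidity\<close>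

text \<open>
  The quotient does not depend on the representatives of the gradient and of the trace. On a bounded
  Lipschitz set the infimum is a minimum.
\<close>

definition robin_eigenvalue :: "real \<Rightarrow> 'a::euclidean_space set \<Rightarrow> real" where
  "robin_eigenvalue \<beta> \<Omega> =
     Inf {((LINT x|lebesgue_on \<Omega>. (norm (g x))\<^sup>2) + \<beta> * (LINT x|surface_measure \<Omega>. (t x)\<^sup>2))
            / (LINT x|lebesgue_on \<Omega>. (u x)\<^sup>2) | u g t.
          H1_trace \<Omega> u g t \<and> \<not> (AE x in lebesgue_on \<Omega>. u x = 0)}"

text \<open>
  The weak form of \<open>-\<Delta>w = 1\<close> in \<open>\<Omega>\<close>, \<open>\<partial>\<^sub>\<nu>w + \<beta> w = 0\<close> on \<open>\<partial>\<Omega>\<close>. Representatives of the solution are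
  unique only almost everywhere, so the description operator below is applied to the value of the
  integral rather than to \<open>w\<close>.
\<close>

definition robin_torsion_function :: "real \<Rightarrow> 'a::euclidean_space set \<Rightarrow> ('a \<Rightarrow> real) \<Rightarrow> bool" where
  "robin_torsion_function \<beta> \<Omega> w \<longleftrightarrow>
     (\<exists>g t. H1_trace \<Omega> w g t \<and>
        (\<forall>v h s. H1_trace \<Omega> v h s \<longrightarrow>
           (LINT x|lebesgue_on \<Omega>. g x \<bullet> h x) + \<beta> * (LINT x|surface_measure \<Omega>. t x * s x)
             = (LINT x|lebesgue_on \<Omega>. v x)))"

definition robin_torsion :: "real \<Rightarrow> 'a::euclidean_space set \<Rightarrow> real" where
  "robin_torsion \<beta> \<Omega> =
     (THE T. \<exists>w. robin_torsion_function \<beta> \<Omega> w \<and> T = (LINT x|lebesgue_on \<Omega>. w x))"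

text \<open>
  The space is an arbitrary Euclidean space, whose dimension \<open>DIM('a)\<close> is a positive integer. The
  supremum is taken in the extended reals.
\<close>

definition robin_sup :: "'a::euclidean_space itself \<Rightarrow> real \<Rightarrow> real \<Rightarrow> ereal" where
  "robin_sup _ \<beta> q =
     (SUP \<Omega>\<in>(unit_volume_domains :: 'a set set).
        ereal (robin_eigenvalue \<beta> \<Omega> * robin_torsion \<beta> \<Omega> powr q))"

end

theory Submission
  imports Defs
begin

text \<open>
  Testing the Rayleigh quotient with the torsion function \<open>w\<close>, whose energy equals \<open>\<integral> w\<close>, gives
  \<open>\<lambda> * T \<le> |\<Omega>| = 1\<close>. Moreover \<open>T\<close> is bounded: averaging over translations \<open>h\<close> in a ball of volume at
  least \<open>2\<close>, at least half of which move a given point out of \<open>\<Omega>\<close>, bounds \<open>\<integral> u\<^sup>2\<close> by the Robin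
  energy of \<open>u\<close>. Hence \<open>\<lambda> * T powr q = (\<lambda> * T) * T powr (q - 1)\<close> is bounded for \<open>q > 1\<close>.

  For the lower bounds take \<open>N\<close> separated cubes of side \<open>r = N powr (- 1/d)\<close>. Their total surface is
  \<open>S / r\<close> for a constant \<open>S\<close>, so the test function \<open>1\<close> gives \<open>T \<ge> r / (\<beta> * S)\<close>, while comparing the values
  in a cube with those on its faces gives \<open>\<lambda> \<ge> (S * \<beta> / r) * (1 - r * S * \<beta>)\<close>. The product is at least
  \<open>(S * \<beta> / r) powr (1 - q) * (1 - r * S * \<beta>)\<close>, and \<open>r\<close> tends to \<open>0\<close>. The value of \<open>S\<close> is irrelevant, so the
  Hausdorff measure need not be compared with Lebesgue measure on hyperplanes beyond proportionality.
\<close>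

section \<open>Hausdorff measure\<close>

text \<open>The boundary enters only through coverings, not through a parametrisation or a
  divergence theorem. Volume and surface are linked by shadows: a segment that leaves the set
  crosses its frontier, and the points whose segment crosses a given piece fill tubes of volume at
  most a constant times the Hausdorff measure of the piece. For cubes the same \<open>S\<close> must
  govern perimeter and trace estimate, since otherwise the product would not tend to
  \<open>1\<close> for \<open>q = 1\<close>; uniqueness of translation invariant measures provides
  it, one coordinate direction at a time.

  Inequalities are proved for \<open>(\<phi> x)\<^sup>2\<close> with \<open>\<phi>\<close> smooth,
  and the product of \<open>2 * \<phi> x\<close> with the gradient is split by the
  arithmetic-geometric mean inequality with a weight \<open>\<epsilon>\<close>. On rows of cubes
  \<open>\<epsilon> = S * \<beta>\<close> makes the right-hand side a multiple of the Robin energy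
  and produces the factor \<open>1 - r * S * \<beta>\<close>. As \<open>H1_trace\<close> is a
  closure of smooth functions, such inequalities pass to the limit, and the torsion function is the
  limit of an energy-minimizing sequence of smooth functions, by completeness of L2.\<close>

lemma hausdorff_weight_empty [simp]: "hausdorff_weight k {} = 0"
  by (simp add: hausdorff_weight_def)

lemma hausdorff_content_mono:
  assumes "A \<subseteq> B" "\<delta>' \<le> \<delta>"
  shows "hausdorff_content k \<delta> A \<le> hausdorff_content k \<delta>' B"
  unfolding hausdorff_content_def
proof (rule INF_superset_mono)
  show "{U. B \<subseteq> (\<Union>i. U i) \<and> (\<forall>i. bounded (U i) \<and> diameter (U i) \<le> \<delta>')} \<subseteq> {U. A \<subseteq> (\<Union>i. U i) \<and> (\<forall>i. bounded (U i) \<and> diameter (U i) \<le> \<delta>)}"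
    using assms by (auto intro: order_trans)
qed simp

lemma hausdorff_content_le_cover:
  assumes "A \<subseteq> (\<Union>i. U i)" "\<And>i::nat. bounded (U i)" "\<And>i. diameter (U i) \<le> \<delta>"
  shows "hausdorff_content k \<delta> A \<le> (\<Sum>i. hausdorff_weight k (U i))"
  unfolding hausdorff_content_def using assms by (intro INF_lower) auto

lemma hausdorff_content_empty:
  assumes "0 \<le> \<delta>"
  shows "hausdorff_content k \<delta> {} = 0"
  using hausdorff_content_le_cover[of "{}" "\<lambda>_. {}" \<delta> k] assms by simp

lemma hausdorff_content_exists_cover:
  assumes "hausdorff_content k \<delta> A < c"
  obtains U where "A \<subseteq> (\<Union>i. U i)" "\<And>i::nat. bounded (U i)" "\<And>i. diameter (U i) \<le> \<delta>"
    "(\<Sum>i. hausdorff_weight k (U i)) < c"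
  using assms unfolding hausdorff_content_def INF_less_iff by blast

lemma hausdorff_content_greatest:
  assumes "\<And>U. A \<subseteq> (\<Union>i. U i) \<Longrightarrow> (\<And>i::nat. bounded (U i)) \<Longrightarrow> (\<And>i. diameter (U i) \<le> \<delta>)
     \<Longrightarrow> c \<le> (\<Sum>i. hausdorff_weight k (U i))"
  shows "c \<le> hausdorff_content k \<delta> A"
  unfolding hausdorff_content_def using assms by (intro INF_greatest) auto

text \<open>The errors \<open>e * (1/2) ^ Suc n\<close> allowed to near-optimal covers of the
  \<open>A n\<close> sum to \<open>e\<close>, and \<open>prod_decode\<close> arranges the countably
  many covers into one sequence.\<close>

lemma hausdorff_content_UN:
  "hausdorff_content k \<delta> (\<Union>n::nat. A n) \<le> (\<Sum>n. hausdorff_content k \<delta> (A n))"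
proof (rule ennreal_le_epsilon)
  fix e :: real
  assume fin: "(\<Sum>n. hausdorff_content k \<delta> (A n)) < top" and e: "0 < e"
  have lt: "hausdorff_content k \<delta> (A n) < hausdorff_content k \<delta> (A n) + ennreal (e * (1/2) ^ Suc n)" for n
  proof -
    have "hausdorff_content k \<delta> (A n) \<noteq> top"
      using ennreal_suminf_lessD[OF fin, of n] by simp
    moreover have "0 < ennreal (e * (1/2) ^ Suc n)"
      using e by simp
    ultimately show ?thesis
      using ennreal_add_left_cancel_less[of "hausdorff_content k \<delta> (A n)" 0] by (metis add.right_neutral infinity_ennreal_def)
  qed
  have "\<forall>n. \<exists>U. A n \<subseteq> (\<Union>i. U i) \<and> (\<forall>i::nat. bounded (U i)) \<and> (\<forall>i. diameter (U i) \<le> \<delta>)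
    \<and> (\<Sum>i. hausdorff_weight k (U i)) < hausdorff_content k \<delta> (A n) + ennreal (e * (1/2) ^ Suc n)"
    proof
    fix n show "\<exists>U. A n \<subseteq> (\<Union>i. U i) \<and> (\<forall>i::nat. bounded (U i)) \<and> (\<forall>i. diameter (U i) \<le> \<delta>)
      \<and> (\<Sum>i. hausdorff_weight k (U i)) < hausdorff_content k \<delta> (A n) + ennreal (e * (1/2) ^ Suc n)"
      by (rule hausdorff_content_exists_cover[OF lt[of n]]) blast
  qed
  then obtain U where U: "\<And>n. A n \<subseteq> (\<Union>i. U n i)" "\<And>n i::nat. bounded (U n i)" "\<And>n i. diameter (U n i) \<le> \<delta>"
    "\<And>n. (\<Sum>i. hausdorff_weight k (U n i)) < hausdorff_content k \<delta> (A n) + ennreal (e * (1/2) ^ Suc n)"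
    by metis
  define V where "V m = (case prod_decode m of (n, i) \<Rightarrow> U n i)" for m
  have "hausdorff_content k \<delta> (\<Union>n. A n) \<le> (\<Sum>m. hausdorff_weight k (V m))"
  proof (rule hausdorff_content_le_cover)
    show "(\<Union>n. A n) \<subseteq> (\<Union>m. V m)"
    proof
      fix x assume "x \<in> (\<Union>n. A n)"
      then obtain n i where "x \<in> U n i" using U(1) by blast
      then have "x \<in> V (prod_encode (n, i))" by (simp add: V_def)
      then show "x \<in> (\<Union>m. V m)" by blast
    qed
  qed (auto simp: V_def U split: prod.split)
  also have "\<dots> = (\<Sum>m. (\<lambda>(n, i). hausdorff_weight k (U n i)) (prod_decode m))"
    by (intro suminf_cong) (simp add: V_def split: prod.split)
  also have "\<dots> = (\<Sum>n. \<Sum>i. hausdorff_weight k (U n i))"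
    by (subst suminf_ennreal_2dimen[where g="\<lambda>n. \<Sum>i. hausdorff_weight k (U n i)" and f="\<lambda>(n, i). hausdorff_weight k (U n i)", symmetric]) (simp_all add: o_def)
  also have "\<dots> \<le> (\<Sum>n. hausdorff_content k \<delta> (A n) + ennreal (e * (1/2) ^ Suc n))"
    using U(4) by (intro suminf_le) (auto intro: less_imp_le)
  also have "\<dots> = (\<Sum>n. hausdorff_content k \<delta> (A n)) + (\<Sum>n. ennreal (e * (1/2) ^ Suc n))"
    by (rule suminf_add[symmetric]) auto
  also have "(\<Sum>n. ennreal (e * (1/2) ^ Suc n)) = ennreal e"
  proof -
    have "(\<lambda>n. e * (1/2) ^ Suc n) sums (e * 1)"
      by (intro sums_mult power_half_series)
    then show ?thesis using e by (intro suminf_ennreal_eq) auto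
  qed
  finally show "hausdorff_content k \<delta> (\<Union>n. A n) \<le> (\<Sum>n. hausdorff_content k \<delta> (A n)) + ennreal e" .
qed

text \<open>A covering set of diameter at most \<open>\<delta>\<close> cannot meet both
  \<open>A\<close> and \<open>B\<close>, so every cover of the union splits into a cover of
  \<open>A\<close> and one of \<open>B\<close>.\<close>

lemma hausdorff_content_separated:
  assumes sep: "\<And>a b. a \<in> A \<Longrightarrow> b \<in> B \<Longrightarrow> \<delta> < dist a b" and "0 \<le> \<delta>"
  shows "hausdorff_content k \<delta> A + hausdorff_content k \<delta> B \<le> hausdorff_content k \<delta> (A \<union> B)"
proof (rule hausdorff_content_greatest)
  fix U :: "nat \<Rightarrow> 'a set"
  assume U: "A \<union> B \<subseteq> (\<Union>i. U i)" "\<And>i. bounded (U i)" "\<And>i. diameter (U i) \<le> \<delta>"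
  \<comment> \<open>A set that misses \<open>C\<close> is replaced by the empty set, which weighs
    \<open>0\<close> even for \<open>k = 0\<close>.\<close>
  define V where "V C i = (if U i \<inter> C \<noteq> {} then U i else {})" for C :: "'a set" and i
  have V: "hausdorff_content k \<delta> C \<le> (\<Sum>i. hausdorff_weight k (V C i))" if "C \<subseteq> A \<union> B" for C
  proof (rule hausdorff_content_le_cover)
    show "C \<subseteq> (\<Union>i. V C i)" using that U(1) unfolding V_def by fastforce
  qed (use U \<open>0 \<le> \<delta>\<close> in \<open>auto simp: V_def\<close>)
  have one: "V A i = {} \<or> V B i = {}" for i
  proof (rule ccontr)
    assume "\<not> ?thesis"
    then obtain a b where ab: "a \<in> U i" "a \<in> A" "b \<in> U i" "b \<in> B"
      unfolding V_def by (auto split: if_splits)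
    have "dist a b \<le> \<delta>"
      using diameter_bounded_bound[OF U(2) ab(1,3)] U(3)[of i] by linarith
    with sep[OF ab(2,4)] show False by simp
  qed
  have "hausdorff_content k \<delta> A + hausdorff_content k \<delta> B
      \<le> (\<Sum>i. hausdorff_weight k (V A i)) + (\<Sum>i. hausdorff_weight k (V B i))"
    by (intro add_mono V) auto
  also have "\<dots> = (\<Sum>i. hausdorff_weight k (V A i) + hausdorff_weight k (V B i))"
    by (rule suminf_add) auto
  also have "\<dots> \<le> (\<Sum>i. hausdorff_weight k (U i))"
  proof (rule suminf_le)
    fix i show "hausdorff_weight k (V A i) + hausdorff_weight k (V B i) \<le> hausdorff_weight k (U i)"
    proof -
      have "V A i = {} \<or> V A i = U i" "V B i = {} \<or> V B i = U i" by (simp_all add: V_def)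
      with one[of i] show ?thesis by (elim disjE) simp_all
    qed
  qed auto
  finally show "hausdorff_content k \<delta> A + hausdorff_content k \<delta> B \<le> (\<Sum>i. hausdorff_weight k (U i))" .
qed

section \<open>From contents at a fixed scale to the outer measure\<close>

lemma hausdorff_content_le_outer:
  assumes "0 < \<delta>"
  shows "hausdorff_content k \<delta> A \<le> hausdorff_outer k A"
  unfolding hausdorff_outer_def using assms by (intro SUP_upper) auto

lemma incseq_hausdorff_content: "incseq (\<lambda>n. hausdorff_content k (1 / Suc n) A)"
  by (rule incseq_SucI, rule hausdorff_content_mono) (auto simp: field_simps)

text \<open>Along an increasing sequence the sum of two suprema is the supremum of the sums, which
  is how separated sets are handled below.\<close>

lemma hausdorff_outer_eq_SUP: "hausdorff_outer k A = (SUP n. hausdorff_content k (1 / Suc n) A)"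
proof (rule antisym)
  show "hausdorff_outer k A \<le> (SUP n. hausdorff_content k (1 / Suc n) A)"
    unfolding hausdorff_outer_def
  proof (rule SUP_least)
    fix \<delta> :: real assume "\<delta> \<in> {0<..}"
    then have "0 < \<delta>" by simp
    then obtain n where "1 / Suc n < \<delta>" by (rule nat_approx_posE)
    then have "hausdorff_content k \<delta> A \<le> hausdorff_content k (1 / Suc n) A"
      by (intro hausdorff_content_mono) auto
    then show "hausdorff_content k \<delta> A \<le> (SUP n. hausdorff_content k (1 / Suc n) A)"
      by (rule order_trans) (rule SUP_upper, simp)
  qed
  show "(SUP n. hausdorff_content k (1 / Suc n) A) \<le> hausdorff_outer k A"
    by (intro SUP_least hausdorff_content_le_outer) auto
qed

lemma hausdorff_outer_empty: "hausdorff_outer k {} = 0"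
  by (simp add: hausdorff_outer_eq_SUP hausdorff_content_empty)

lemma hausdorff_outer_mono: "A \<subseteq> B \<Longrightarrow> hausdorff_outer k A \<le> hausdorff_outer k B"
  unfolding hausdorff_outer_def by (intro SUP_mono') (auto intro: hausdorff_content_mono)

lemma hausdorff_outer_UN:
  "hausdorff_outer k (\<Union>n::nat. A n) \<le> (\<Sum>n. hausdorff_outer k (A n))"
  unfolding hausdorff_outer_def[of _ "\<Union>n. A n"]
proof (rule SUP_least)
  fix \<delta> :: real assume "\<delta> \<in> {0<..}"
  then have "hausdorff_content k \<delta> (A n) \<le> hausdorff_outer k (A n)" for n
    by (intro hausdorff_content_le_outer) auto
  then show "hausdorff_content k \<delta> (\<Union>n. A n) \<le> (\<Sum>n. hausdorff_outer k (A n))"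
    by (intro order_trans[OF hausdorff_content_UN] suminf_le) auto
qed

lemma outer_measure_space_hausdorff: "outer_measure_space (Pow UNIV) (hausdorff_outer k)"
  unfolding outer_measure_space_def positive_def increasing_def countably_subadditive_def
  by (auto simp: hausdorff_outer_empty hausdorff_outer_mono hausdorff_outer_UN)

lemma hausdorff_outer_Un: "hausdorff_outer k (A \<union> B) \<le> hausdorff_outer k A + hausdorff_outer k B"
  using hausdorff_outer_UN[of k "binaryset A B"] suminf_binaryset_eq[of "hausdorff_outer k" A B]
  by (simp add: UN_binaryset_eq hausdorff_outer_empty)

lemma hausdorff_outer_separated:
  assumes sep: "\<And>a b. a \<in> A \<Longrightarrow> b \<in> B \<Longrightarrow> \<epsilon> \<le> dist a b" and "0 < \<epsilon>"
  shows "hausdorff_outer k A + hausdorff_outer k B = hausdorff_outer k (A \<union> B)"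
proof (rule antisym)
  obtain m where m: "1 / Suc m < \<epsilon>" by (rule nat_approx_posE[OF \<open>0 < \<epsilon>\<close>])
  have "hausdorff_outer k A + hausdorff_outer k B
      = (SUP n. hausdorff_content k (1 / Suc n) A + hausdorff_content k (1 / Suc n) B)"
    unfolding hausdorff_outer_eq_SUP
    by (rule ennreal_SUP_add[OF incseq_hausdorff_content incseq_hausdorff_content, symmetric])
  also have "\<dots> \<le> hausdorff_outer k (A \<union> B)"
  proof (rule SUP_least)
    fix n
    \<comment> \<open>A scale at least as fine as the given one and below the separation
      \<open>\<epsilon>\<close>.\<close>
    define \<delta> where "\<delta> = 1 / Suc (max n m)"
    have \<delta>: "0 < \<delta>" "\<delta> \<le> 1 / Suc n" "\<delta> \<le> 1 / Suc m"
      unfolding \<delta>_def by (auto simp: field_simps)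
    have "hausdorff_content k (1 / Suc n) A + hausdorff_content k (1 / Suc n) B
        \<le> hausdorff_content k \<delta> A + hausdorff_content k \<delta> B"
      using \<delta> by (intro add_mono hausdorff_content_mono) auto
    also have "\<dots> \<le> hausdorff_content k \<delta> (A \<union> B)"
    proof (rule hausdorff_content_separated)
      fix a b assume "a \<in> A" "b \<in> B"
      from sep[OF this] m \<delta> show "\<delta> < dist a b" by linarith
    qed (use \<delta> in auto)
    also have "\<dots> \<le> hausdorff_outer k (A \<union> B)" using \<delta> by (intro hausdorff_content_le_outer)
    finally show "hausdorff_content k (1 / Suc n) A + hausdorff_content k (1 / Suc n) B
        \<le> hausdorff_outer k (A \<union> B)" .
  qed
  finally show "hausdorff_outer k A + hausdorff_outer k B \<le> hausdorff_outer k (A \<union> B)" .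
qed (rule hausdorff_outer_Un)

section \<open>Caratheodory's criterion for closed sets\<close>

definition away_from :: "'a::metric_space set \<Rightarrow> nat \<Rightarrow> 'a set" where
  "away_from F n = {x. \<forall>y\<in>F. 1 / Suc n \<le> dist x y}"

lemma away_from_mono: "m \<le> n \<Longrightarrow> away_from F m \<subseteq> away_from F n"
proof
  fix x assume "m \<le> n" "x \<in> away_from F m"
  moreover have "1 / Suc n \<le> 1 / Suc m" using \<open>m \<le> n\<close> by (simp add: field_simps)
  ultimately show "x \<in> away_from F n" unfolding away_from_def by fastforce
qed

text \<open>Some point of \<open>F\<close> is closer than \<open>1 / Suc n\<close> to
  \<open>y\<close>, while \<open>x\<close> has distance at least \<open>1 / Suc m\<close> from it.
  The bound is of use for \<open>m < n\<close>, where it is positive.\<close>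

lemma away_from_separated:
  assumes "x \<in> away_from F m" "y \<notin> away_from F n"
  shows "1 / Suc m - 1 / Suc n \<le> dist x y"
proof -
  obtain z where z: "z \<in> F" "dist y z < 1 / Suc n" using assms(2) by (auto simp: away_from_def not_le)
  moreover have "1 / Suc m \<le> dist x z" using assms(1) z(1) by (auto simp: away_from_def)
  moreover have "dist x z \<le> dist x y + dist y z" by (rule dist_triangle)
  ultimately show ?thesis by linarith
qed

lemma UN_away_from:
  assumes "closed F"
  shows "(\<Union>n. away_from F n) = - F"
proof (intro equalityI subsetI)
  fix x assume "x \<in> - F"
  then obtain e where e: "e > 0" "ball x e \<subseteq> - F"
    using assms by (metis open_Compl openE)
  obtain n where "1 / Suc n < e" by (rule nat_approx_posE[OF e(1)])
  then have "x \<in> away_from F n" using e(2) unfolding away_from_def by (force simp: subset_iff)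
  then show "x \<in> (\<Union>n. away_from F n)" by blast
next
  fix x assume "x \<in> (\<Union>n. away_from F n)"
  then show "x \<in> - F" by (force simp: away_from_def)
qed

lemma sum_hausdorff_outer_annuli:
  fixes A F :: "'a::metric_space set" and c :: nat
  defines "R \<equiv> \<lambda>j. A \<inter> (away_from F (Suc j) - away_from F j)"
  shows "(\<Sum>i<n. hausdorff_outer k (R (2 * i + c))) = hausdorff_outer k (\<Union>i<n. R (2 * i + c))"
proof (induction n)
  case 0 then show ?case by (simp add: hausdorff_outer_empty)
next
  case (Suc n)
  show ?case
  proof (cases n)
    case 0 then show ?thesis by (simp add: lessThan_Suc hausdorff_outer_empty)
  next
    case (Suc m)
    \<comment> \<open>The earlier annuli stop at level \<open>2 * m + c + 1\<close>, the next one
      avoids level \<open>2 * n + c = 2 * m + c + 2\<close>. The skipped index creates the positive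
      gap.\<close>
    have sub: "(\<Union>i<n. R (2 * i + c)) \<subseteq> away_from F (2 * m + c + 1)"
    proof
      fix x assume "x \<in> (\<Union>i<n. R (2 * i + c))"
      then obtain i where "i < n" "x \<in> away_from F (Suc (2 * i + c))" unfolding R_def by blast
      moreover then have "Suc (2 * i + c) \<le> 2 * m + c + 1" using Suc by simp
      ultimately show "x \<in> away_from F (2 * m + c + 1)" using away_from_mono by blast
    qed
    have "hausdorff_outer k (\<Union>i<n. R (2 * i + c)) + hausdorff_outer k (R (2 * n + c))
       = hausdorff_outer k ((\<Union>i<n. R (2 * i + c)) \<union> R (2 * n + c))"
    proof (rule hausdorff_outer_separated)
      fix a b assume "a \<in> (\<Union>i<n. R (2 * i + c))" "b \<in> R (2 * n + c)"
      then have "a \<in> away_from F (2 * m + c + 1)" "b \<notin> away_from F (2 * n + c)"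
        using sub by (auto simp: R_def)
      then show "1 / Suc (2 * m + c + 1) - 1 / Suc (2 * n + c) \<le> dist a b" by (rule away_from_separated)
    next
      show "0 < 1 / real (Suc (2 * m + c + 1)) - 1 / real (Suc (2 * n + c))"
        using Suc by (simp add: divide_strict_left_mono)
    qed
    then show ?thesis using Suc.IH by (simp add: lessThan_Suc Un_commute add.commute)
  qed
qed

text \<open>The factor \<open>2\<close> pays for the even and the odd annuli, each family
  contributing at most the measure of \<open>A\<close>.\<close>

lemma suminf_hausdorff_outer_annuli:
  fixes A F :: "'a::metric_space set"
  shows "(\<Sum>j. hausdorff_outer k (A \<inter> (away_from F (Suc j) - away_from F j))) \<le> 2 * hausdorff_outer k A"
proof (rule suminf_le_const)
  fix n
  let ?r = "\<lambda>j. hausdorff_outer k (A \<inter> (away_from F (Suc j) - away_from F j))"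
  have "sum ?r {..<n} \<le> sum ?r {..<2 * n}"
    by (intro sum_mono2) auto
  also have "\<dots> = (\<Sum>i<n. ?r (2 * i + 0)) + (\<Sum>i<n. ?r (2 * i + 1))"
    by (induction n) (simp_all add: algebra_simps)
  also have "\<dots> \<le> hausdorff_outer k A + hausdorff_outer k A"
    unfolding sum_hausdorff_outer_annuli by (intro add_mono hausdorff_outer_mono) auto
  finally show "sum ?r {..<n} \<le> 2 * hausdorff_outer k A" by (simp add: mult_2)
qed simp

text \<open>The annuli \<open>away_from F (Suc j) - away_from F j\<close> of equal parity are mutually separated, so the
  measures of the pieces of \<open>A\<close> in them are summable and the part of \<open>A\<close> close to \<open>F\<close> is negligible.\<close>

lemma closed_caratheodory_hausdorff_outer:
  assumes "closed F"
  shows "hausdorff_outer k (A \<inter> F) + hausdorff_outer k (A - F) \<le> hausdorff_outer k A"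
proof (rule ennreal_le_epsilon)
  fix e :: real
  assume fin: "hausdorff_outer k A < top" and e: "0 < e"
  define R where "R j = A \<inter> (away_from F (Suc j) - away_from F j)" for j
  define s where "s j = enn2real (hausdorff_outer k (R j))" for j
  have le: "hausdorff_outer k (R j) \<le> hausdorff_outer k A" for j
    unfolding R_def by (intro hausdorff_outer_mono) auto
  have s: "hausdorff_outer k (R j) = ennreal (s j)" "0 \<le> s j" for j
    unfolding s_def using le[of j] fin by (auto simp: ennreal_enn2real_if top_unique)
  have "(\<Sum>j. ennreal (s j)) \<le> 2 * hausdorff_outer k A"
    unfolding s(1)[symmetric] R_def by (rule suminf_hausdorff_outer_annuli)
  moreover have "2 * hausdorff_outer k A < top"
    using fin by (simp add: ennreal_mult_less_top)
  ultimately have "summable s"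
    using s(2) by (intro summable_suminf_not_top) (auto simp: top_unique)
  then obtain N where N: "norm (\<Sum>i. s (i + N)) < e"
    using suminf_exist_split[OF e] by blast
  have sumN: "summable (\<lambda>i. s (i + N))" using \<open>summable s\<close> by (rule summable_ignore_initial_segment)
  \<comment> \<open>A point that enters only at a level \<open>n > N\<close> lies in the annulus
    with index \<open>n - 1\<close>, hence in the tail that \<open>N\<close> was chosen to make
    small.\<close>
  have "A - F \<subseteq> (A \<inter> away_from F N) \<union> (\<Union>i. R (i + N))"
  proof
    fix x assume x: "x \<in> A - F"
    then have ex: "\<exists>n. x \<in> away_from F n" using UN_away_from[OF assms] by blast
    define n where "n = (LEAST n. x \<in> away_from F n)"
    have n: "x \<in> away_from F n" unfolding n_def using ex by (rule LeastI_ex)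
    show "x \<in> (A \<inter> away_from F N) \<union> (\<Union>i. R (i + N))"
    proof (cases "n \<le> N")
      case True then show ?thesis using n x away_from_mono by blast
    next
      case False
      then have "x \<notin> away_from F (n - 1)" unfolding n_def by (intro not_less_Least) auto
      then have "x \<in> R (n - 1)" using n x False unfolding R_def by auto
      then have "x \<in> R ((n - 1 - N) + N)" using False by simp
      then show ?thesis by blast
    qed
  qed
  then have "hausdorff_outer k (A - F) \<le> hausdorff_outer k (A \<inter> away_from F N) + (\<Sum>i. hausdorff_outer k (R (i + N)))"
    by (rule order_trans[OF hausdorff_outer_mono order_trans[OF hausdorff_outer_Un add_left_mono[OF hausdorff_outer_UN]]])
  also have "(\<Sum>i. hausdorff_outer k (R (i + N))) = ennreal (\<Sum>i. s (i + N))"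
    unfolding s(1) using s(2) sumN by (intro suminf_ennreal2) auto
  also have "\<dots> \<le> ennreal e" using N by (intro ennreal_leI) auto
  finally have *: "hausdorff_outer k (A - F) \<le> hausdorff_outer k (A \<inter> away_from F N) + ennreal e"
    by (simp add: add_left_mono)
  have "hausdorff_outer k (A \<inter> F) + hausdorff_outer k (A \<inter> away_from F N)
      = hausdorff_outer k ((A \<inter> F) \<union> (A \<inter> away_from F N))"
    by (rule hausdorff_outer_separated[where \<epsilon> = "1 / Suc N"]) (auto simp: away_from_def dist_commute)
  also have "\<dots> \<le> hausdorff_outer k A" by (rule hausdorff_outer_mono) auto
  finally have "hausdorff_outer k (A \<inter> F) + hausdorff_outer k (A \<inter> away_from F N) + ennreal e \<le> hausdorff_outer k A + ennreal e"
    by (rule add_right_mono)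
  moreover have "hausdorff_outer k (A \<inter> F) + hausdorff_outer k (A - F)
     \<le> hausdorff_outer k (A \<inter> F) + hausdorff_outer k (A \<inter> away_from F N) + ennreal e"
    using add_left_mono[OF *, of "hausdorff_outer k (A \<inter> F)"] by (simp add: add.assoc)
  ultimately show "hausdorff_outer k (A \<inter> F) + hausdorff_outer k (A - F) \<le> hausdorff_outer k A + ennreal e"
    by (rule order_trans[rotated])
qed

text \<open>The sets that split every set additively form a sigma algebra on which the outer measure
  is a measure; it contains the closed sets, hence the Borel sets.\<close>

lemma measure_space_hausdorff: "measure_space UNIV (sets borel) (hausdorff_outer k)"
proof -
  interpret P: sigma_algebra UNIV "Pow UNIV :: 'a set set" by (rule sigma_algebra_Pow)
  let ?L = "lambda_system UNIV (Pow UNIV) (hausdorff_outer k :: 'a set \<Rightarrow> ennreal)"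
  have ms: "measure_space UNIV ?L (hausdorff_outer k)"
    by (rule P.caratheodory_lemma[OF outer_measure_space_hausdorff])
  then interpret L: sigma_algebra UNIV ?L by (simp add: measure_space_def)
  have "F \<in> ?L" if "closed F" for F
    unfolding P.lambda_system_eq
  proof (clarsimp, rule antisym)
    fix x :: "'a set"
    show "hausdorff_outer k (x \<inter> F) + hausdorff_outer k (x - F) \<le> hausdorff_outer k x"
      by (rule closed_caratheodory_hausdorff_outer[OF that])
    show "hausdorff_outer k x \<le> hausdorff_outer k (x \<inter> F) + hausdorff_outer k (x - F)"
      by (rule order_trans[OF hausdorff_outer_mono hausdorff_outer_Un]) auto
  qed
  then have "sigma_sets UNIV {F :: 'a set. closed F} \<subseteq> ?L"
    by (intro L.sigma_sets_subset) auto
  then have "sets borel \<subseteq> ?L" by (simp add: borel_eq_closed)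
  moreover have "sigma_algebra UNIV (sets borel)" by (metis sets.sigma_algebra_axioms space_borel)
  ultimately show ?thesis by (intro measure_down[OF ms])
qed

lemma space_hausdorff_measure [simp]: "space (hausdorff_measure k) = UNIV"
  by (simp add: hausdorff_measure_def space_measure_of_conv)

lemma sets_hausdorff_measure [simp, measurable_cong]: "sets (hausdorff_measure k) = sets borel"
  unfolding hausdorff_measure_def
  by (metis sets.sigma_sets_eq sets_measure_of sets.space_closed space_borel)

lemma emeasure_hausdorff_measure:
  assumes "A \<in> sets borel"
  shows "emeasure (hausdorff_measure k) A = hausdorff_outer k A"
  using measure_space_hausdorff[of k] assms
  unfolding hausdorff_measure_def measure_space_def
  by (intro emeasure_measure_of_sigma) auto

section \<open>Translation invariance of the Hausdorff measure\<close>

lemma diameter_translation: "diameter ((+) (v::'a::euclidean_space) ` U) = diameter U"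
proof -
  have "(\<lambda>(x,y). dist x y) ` ((+) v ` U \<times> (+) v ` U) = (\<lambda>(x,y). dist x y) ` (U \<times> U)"
    by (auto simp: image_iff) blast+
  then show ?thesis unfolding diameter_def by auto
qed

lemma hausdorff_weight_translation: "hausdorff_weight k ((+) (v::'a::euclidean_space) ` U) = hausdorff_weight k U"
  by (simp add: hausdorff_weight_def diameter_translation)

lemma hausdorff_outer_translation_le:
  "hausdorff_outer k ((+) (v::'a::euclidean_space) ` A) \<le> hausdorff_outer k A"
  unfolding hausdorff_outer_def
proof (rule SUP_mono', rule hausdorff_content_greatest)
  fix \<delta> :: real and U :: "nat \<Rightarrow> 'a set"
  assume U: "A \<subseteq> (\<Union>i. U i)" "\<And>i. bounded (U i)" "\<And>i. diameter (U i) \<le> \<delta>"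
  have "hausdorff_content k \<delta> ((+) v ` A) \<le> (\<Sum>i. hausdorff_weight k ((+) v ` U i))"
  proof (rule hausdorff_content_le_cover)
    show "(+) v ` A \<subseteq> (\<Union>i. (+) v ` U i)" using U(1) by fastforce
  qed (use U in \<open>auto simp: diameter_translation intro: bounded_translation\<close>)
  then show "hausdorff_content k \<delta> ((+) v ` A) \<le> (\<Sum>i. hausdorff_weight k (U i))"
    by (simp add: hausdorff_weight_translation)
qed

lemma hausdorff_outer_translation:
  "hausdorff_outer k ((+) (v::'a::euclidean_space) ` A) = hausdorff_outer k A"
proof (rule antisym[OF hausdorff_outer_translation_le])
  have "A = (+) (- v) ` (+) v ` A" by (auto simp: image_image)
  then show "hausdorff_outer k A \<le> hausdorff_outer k ((+) v ` A)"
    by (metis hausdorff_outer_translation_le)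
qed

lemma distr_hausdorff_measure_translation:
  "distr (hausdorff_measure k) borel ((+) (v::'a::euclidean_space)) = hausdorff_measure k"
proof (rule measure_eqI)
  fix A assume "A \<in> sets (distr (hausdorff_measure k) borel ((+) v))"
  then have A: "A \<in> sets borel" by simp
  have eq: "(+) v -` A = (+) (- v) ` A"
    by (auto simp: image_iff intro!: bexI[where x = "v + _"])
  have "(+) v -` A \<in> sets borel"
    using measurable_sets[of "(+) v" borel borel A] A by simp
  then show "emeasure (distr (hausdorff_measure k) borel ((+) v)) A = emeasure (hausdorff_measure k) A"
    using A hausdorff_outer_translation[of k "- v" A] by (simp add: emeasure_distr emeasure_hausdorff_measure eq)
qed simp

lemma nn_integral_hausdorff_translation:
  fixes v :: "'a::euclidean_space"
  assumes [measurable]: "f \<in> borel_measurable borel"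
  shows "(\<integral>\<^sup>+x. f (v + x) \<partial>hausdorff_measure k) = (\<integral>\<^sup>+x. f x \<partial>hausdorff_measure k)"
  by (subst (2) distr_hausdorff_measure_translation[of k v, symmetric])
     (simp add: nn_integral_distr measurable_cong_sets[OF sets_hausdorff_measure refl])

section \<open>Shadows of boundary pieces\<close>

text \<open>The points of an open set that the translation by \<open>h\<close> moves out of it lie
  in the shadow of its frontier; in this way the surface measure bounds volumes.\<close>

definition shadow :: "'a::real_vector \<Rightarrow> 'a set \<Rightarrow> 'a set" where
  "shadow h A = {x. \<exists>t\<in>{0..1}. x + t *\<^sub>R h \<in> A}"

lemma shadow_mono: "A \<subseteq> B \<Longrightarrow> shadow h A \<subseteq> shadow h B"
  by (auto simp: shadow_def)

lemma shadow_UN: "shadow h (\<Union>i. A i) = (\<Union>i. shadow h (A i))"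
  by (auto simp: shadow_def)

lemma compact_shadow:
  fixes A :: "'a::euclidean_space set"
  assumes "compact A" shows "compact (shadow h A)"
proof -
  have "shadow h A = (\<lambda>(t, y). y - t *\<^sub>R h) ` ({0..1} \<times> A)"
  proof (intro equalityI subsetI)
    fix x assume "x \<in> shadow h A"
    then obtain t where "t \<in> {0..1}" "x + t *\<^sub>R h \<in> A" by (auto simp: shadow_def)
    then show "x \<in> (\<lambda>(t, y). y - t *\<^sub>R h) ` ({0..1} \<times> A)"
      by (intro image_eqI[of _ _ "(t, x + t *\<^sub>R h)"]) auto
  next
    fix x assume "x \<in> (\<lambda>(t, y). y - t *\<^sub>R h) ` ({0..1} \<times> A)"
    then obtain t y where "t \<in> {0..1}" "y \<in> A" "x = y - t *\<^sub>R h" by auto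
    then show "x \<in> shadow h A" unfolding shadow_def by (auto intro!: bexI[of _ t])
  qed
  then show ?thesis
    using assms by (auto simp: case_prod_unfold intro!: compact_continuous_image compact_Times continuous_intros)
qed

text \<open>A set of diameter below \<open>\<rho>\<close> sweeps a tube along a segment of length at
  most \<open>R\<close>. The tube is covered by \<open>m\<close>, roughly \<open>R / \<rho>\<close>,
  balls of radius \<open>2 * \<rho>\<close> with centres on the segment. Since
  \<open>m * \<rho> \<le> R + \<rho> \<le> R + 2\<close>, one power of \<open>\<rho>\<close> is used
  up by the number of balls.\<close>

lemma emeasure_shadow_le:
  fixes A :: "'a::euclidean_space set"
  assumes A: "compact A" "A \<noteq> {}" and h: "norm h \<le> R" and \<rho>: "diameter A < \<rho>" "\<rho> \<le> 2"
  shows "emeasure lborel (shadow h A)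
     \<le> ennreal (unit_ball_vol DIM('a) * 2 ^ DIM('a) * (R + 2) * \<rho> ^ (DIM('a) - 1))"
proof -
  have R: "0 \<le> R" using h norm_ge_zero order_trans by blast
  have \<rho>0: "0 < \<rho>" using diameter_ge_0[OF compact_imp_bounded[OF A(1)]] \<rho>(1) by simp
  obtain u where u: "u \<in> A" using A(2) by blast
  define m where "m = Suc (nat \<lfloor>R / \<rho>\<rfloor>)"
  have m: "R / \<rho> \<le> real m" "real m \<le> R / \<rho> + 1" "0 < m"
    using R \<rho>0 unfolding m_def by (auto simp: of_nat_nat) linarith+
  have "shadow h A \<subseteq> (\<Union>j<m. cball (u - (real j / m) *\<^sub>R h) (2 * \<rho>))"
  proof
    fix x assume "x \<in> shadow h A"
    then obtain t where t: "0 \<le> t" "t \<le> 1" and xt: "x + t *\<^sub>R h \<in> A" by (auto simp: shadow_def)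
    have d1: "dist (x + t *\<^sub>R h) u \<le> \<rho>"
      using diameter_bounded_bound[OF compact_imp_bounded[OF A(1)] xt u] \<rho>(1) by linarith
    \<comment> \<open>The minimum matters only for \<open>t = 1\<close>, where the floor would give
      the excluded index \<open>m\<close>.\<close>
    define j where "j = min (nat \<lfloor>t * m\<rfloor>) (m - 1)"
    have jm: "j < m" using m(3) by (auto simp: j_def)
    have "\<bar>t * m - j\<bar> \<le> 1"
    proof (cases "nat \<lfloor>t * m\<rfloor> \<le> m - 1")
      case True then show ?thesis using t unfolding j_def by (simp add: of_nat_nat) linarith
    next
      case False
      then have "real m \<le> t * m" by linarith
      moreover have "t * m \<le> m" using t m(3) by (simp add: mult_le_cancel_right1)
      ultimately show ?thesis using False m(3) unfolding j_def by (auto simp: of_nat_diff)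
    qed
    then have "\<bar>t - j / m\<bar> \<le> 1 / m"
    proof -
      have "t - j / m = (t * m - j) / m" using m(3) by (simp add: field_simps)
      then show ?thesis using \<open>\<bar>t * m - j\<bar> \<le> 1\<close> by (simp add: divide_right_mono)
    qed
    then have "norm ((t - j / m) *\<^sub>R h) \<le> 1 / m * R"
      unfolding norm_scaleR using h R by (intro mult_mono) auto
    also have "\<dots> \<le> \<rho>" using m \<rho>0 by (simp add: field_simps)
    finally have d2: "norm ((t - j / m) *\<^sub>R h) \<le> \<rho>" .
    have "u - (real j / m) *\<^sub>R h - x = (u - (x + t *\<^sub>R h)) + (t - j / m) *\<^sub>R h"
      by (simp add: algebra_simps)
    then have "dist (u - (real j / m) *\<^sub>R h) x \<le> norm (u - (x + t *\<^sub>R h)) + norm ((t - j / m) *\<^sub>R h)"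
      unfolding dist_norm by (metis norm_triangle_ineq)
    then have "dist (u - (real j / m) *\<^sub>R h) x \<le> 2 * \<rho>" using d1 d2 by (simp add: dist_norm norm_minus_commute)
    then show "x \<in> (\<Union>j<m. cball (u - (real j / m) *\<^sub>R h) (2 * \<rho>))" using jm by auto
  qed
  then have "emeasure lborel (shadow h A) \<le> emeasure lborel (\<Union>j<m. cball (u - (real j / m) *\<^sub>R h) (2 * \<rho>))"
    by (intro emeasure_mono) auto
  also have "\<dots> \<le> (\<Sum>j<m. emeasure lborel (cball (u - (real j / m) *\<^sub>R h) (2 * \<rho>)))"
    by (intro emeasure_subadditive_finite) auto
  also have "\<dots> = (\<Sum>j<m. ennreal (unit_ball_vol DIM('a) * (2 * \<rho>) ^ DIM('a)))"
    using \<rho>0 by (intro sum.cong refl) (subst emeasure_cball, auto)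
  also have "\<dots> = ennreal (real m * (unit_ball_vol DIM('a) * (2 * \<rho>) ^ DIM('a)))"
    using \<rho>0 by (simp add: ennreal_mult ennreal_of_nat_eq_real_of_nat)
  also have "\<dots> \<le> ennreal (unit_ball_vol DIM('a) * 2 ^ DIM('a) * (R + 2) * \<rho> ^ (DIM('a) - 1))"
  proof (rule ennreal_leI)
    have "real m * \<rho> \<le> R + 2" using m(2) \<rho>0 \<rho>(2) by (simp add: field_simps)
    then have "unit_ball_vol DIM('a) * 2 ^ DIM('a) * \<rho> ^ (DIM('a) - 1) * (real m * \<rho>)
       \<le> unit_ball_vol DIM('a) * 2 ^ DIM('a) * \<rho> ^ (DIM('a) - 1) * (R + 2)"
      using \<rho>0 by (intro mult_left_mono) auto
    moreover have "(2 * \<rho>) ^ DIM('a) = 2 ^ DIM('a) * (\<rho> ^ (DIM('a) - 1) * \<rho>)"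
      by (metis DIM_positive power_minus_mult power_mult_distrib)
    ultimately show "real m * (unit_ball_vol DIM('a) * (2 * \<rho>) ^ DIM('a))
        \<le> unit_ball_vol DIM('a) * 2 ^ DIM('a) * (R + 2) * \<rho> ^ (DIM('a) - 1)"
      by (simp add: mult_ac)
  qed
  finally show ?thesis .
qed

text \<open>The last two factors convert \<open>\<rho> ^ (DIM('a) - 1)\<close> into the
  normalisation of \<open>hausdorff_weight\<close>, which uses half the diameter and the volume of
  the unit ball.\<close>

definition shadow_const :: "'a::euclidean_space itself \<Rightarrow> real \<Rightarrow> real" where
  "shadow_const _ R = unit_ball_vol DIM('a) * 2 ^ DIM('a) * (R + 2) * 2 ^ (DIM('a) - 1) / unit_ball_vol (real (DIM('a) - 1))"

lemma shadow_const_nonneg: "0 \<le> R \<Longrightarrow> 0 \<le> shadow_const TYPE('a::euclidean_space) R"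
  by (simp add: shadow_const_def)

text \<open>A set of diameter \<open>0\<close> still has a shadow, of positive measure if \<open>DIM('a) = 1\<close>: hence the passage to
  the limit from diameters greater than that of \<open>U\<close>.\<close>

lemma emeasure_shadow_le_weight:
  fixes U :: "'a::euclidean_space set"
  assumes U: "bounded U" "diameter U \<le> 1" and h: "norm h \<le> R"
  shows "emeasure lborel (shadow h (closure U))
     \<le> ennreal (shadow_const TYPE('a) R) * hausdorff_weight (DIM('a) - 1) U"
proof (cases "U = {}")
  case True then show ?thesis by (simp add: shadow_def)
next
  case False
  have R: "0 \<le> R" using h norm_ge_zero order_trans by blast
  have cl: "compact (closure U)" "closure U \<noteq> {}" "diameter (closure U) = diameter U"
    using U False by (auto simp: diameter_closure)
  let ?c = "unit_ball_vol DIM('a) * 2 ^ DIM('a) * (R + 2)"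
  have d0: "0 \<le> diameter U" using U(1) by (rule diameter_ge_0)
  have "emeasure lborel (shadow h (closure U)) \<le> ennreal (?c * diameter U ^ (DIM('a) - 1))"
  proof (rule tendsto_lowerbound)
    show "((\<lambda>\<rho>. ennreal (?c * \<rho> ^ (DIM('a) - 1))) \<longlongrightarrow> ennreal (?c * diameter U ^ (DIM('a) - 1))) (at_right (diameter U))"
      by (intro tendsto_ennrealI tendsto_intros)
    have "eventually (\<lambda>\<rho>. \<rho> \<in> {diameter U<..<2}) (at_right (diameter U))"
      using U(2) by (intro eventually_at_right_real) auto
    then show "\<forall>\<^sub>F \<rho> in at_right (diameter U). emeasure lborel (shadow h (closure U)) \<le> ennreal (?c * \<rho> ^ (DIM('a) - 1))"
      by eventually_elim (intro emeasure_shadow_le, use cl h in auto)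
  qed simp
  also have "?c * diameter U ^ (DIM('a) - 1)
    = shadow_const TYPE('a) R * (unit_ball_vol (real (DIM('a) - 1)) * (diameter U / 2) ^ (DIM('a) - 1))"
  proof -
    have "c * \<rho> ^ k = (c * 2 ^ k / w) * (w * (\<rho> / 2) ^ k)" if "0 < w" for c \<rho> w :: real and k
      using that by (simp add: power_divide)
    from this[OF unit_ball_vol_pos[OF of_nat_0_le_iff]] show ?thesis unfolding shadow_const_def .
  qed
  also have "ennreal \<dots> = ennreal (shadow_const TYPE('a) R)
      * ennreal (unit_ball_vol (real (DIM('a) - 1)) * (diameter U / 2) ^ (DIM('a) - 1))"
    using R d0 by (intro ennreal_mult shadow_const_nonneg mult_nonneg_nonneg unit_ball_vol_nonneg) auto
  finally show ?thesis using False by (simp only: hausdorff_weight_def if_False)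
qed

text \<open>The shadow of a general set need not be measurable, hence the Borel hull
  \<open>W\<close>. It is built from near-optimal covers of \<open>A\<close> by sets of diameter at
  most \<open>1\<close>, whose closures are compact and have compact shadows.\<close>

lemma shadow_cover:
  fixes A :: "'a::euclidean_space set"
  assumes h: "norm h \<le> R"
  obtains W where "W \<in> sets borel" "shadow h A \<subseteq> W"
    "emeasure lborel W \<le> ennreal (shadow_const TYPE('a) R) * hausdorff_outer (DIM('a) - 1) A"
proof (cases "hausdorff_outer (DIM('a) - 1) A = top")
  \<comment> \<open>Positivity of \<open>shadow_const\<close> makes the bound infinite here, so the
    whole space serves as \<open>W\<close>.\<close>
  case True
  have "0 \<le> R" using h norm_ge_zero order_trans by blast
  then have "0 < shadow_const TYPE('a) R" by (simp add: shadow_const_def)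
  then show ?thesis using that[of UNIV] True by (simp add: ennreal_mult_top)
next
  case False
  let ?C = "ennreal (shadow_const TYPE('a) R)" and ?H = "hausdorff_outer (DIM('a) - 1) A"
  have "\<exists>W. W \<in> sets borel \<and> shadow h A \<subseteq> W \<and> emeasure lborel W \<le> ?C * (?H + ennreal (1 / Suc n))" for n
  proof -
    have "hausdorff_content (DIM('a) - 1) 1 A \<le> ?H" by (rule hausdorff_content_le_outer) simp
    also have "\<dots> < ?H + ennreal (1 / Suc n)"
      using ennreal_add_left_cancel_less[of ?H 0 "ennreal (1 / Suc n)"] False by simp
    finally obtain U where U: "A \<subseteq> (\<Union>i. U i)" "\<And>i::nat. bounded (U i)" "\<And>i. diameter (U i) \<le> 1"
       "(\<Sum>i. hausdorff_weight (DIM('a) - 1) (U i)) < ?H + ennreal (1 / Suc n)"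
      by (rule hausdorff_content_exists_cover) blast
    define W where "W = (\<Union>i. shadow h (closure (U i)))"
    have meas: "shadow h (closure (U i)) \<in> sets borel" for i
      using U(2) by (intro borel_closed compact_imp_closed compact_shadow) simp
    have "A \<subseteq> (\<Union>i. closure (U i))" using U(1) closure_subset by blast
    then have "shadow h A \<subseteq> W" unfolding W_def shadow_UN[symmetric] by (rule shadow_mono)
    moreover have "emeasure lborel W \<le> (\<Sum>i. emeasure lborel (shadow h (closure (U i))))"
      unfolding W_def using meas by (intro emeasure_subadditive_countably) auto
    moreover have "\<dots> \<le> (\<Sum>i. ?C * hausdorff_weight (DIM('a) - 1) (U i))"
      using U h by (intro suminf_le emeasure_shadow_le_weight) auto
    moreover have "\<dots> = ?C * (\<Sum>i. hausdorff_weight (DIM('a) - 1) (U i))" by simp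
    moreover have "\<dots> \<le> ?C * (?H + ennreal (1 / Suc n))" using U(4) by (intro mult_left_mono) auto
    moreover have "W \<in> sets borel" unfolding W_def using meas by auto
    ultimately show ?thesis by (metis order_trans)
  qed
  then obtain W where W: "\<And>n. W n \<in> sets borel" "\<And>n. shadow h A \<subseteq> W n"
    "\<And>n. emeasure lborel (W n) \<le> ?C * (?H + ennreal (1 / Suc n))" by metis
  show ?thesis
  \<comment> \<open>The intersection gets rid of the error \<open>1 / Suc n\<close> that each single
    hull carries.\<close>
  proof (rule that[of "\<Inter>n. W n"])
    show "emeasure lborel (\<Inter>n. W n) \<le> ?C * ?H"
    proof (rule tendsto_lowerbound)
      have "(\<lambda>n. ?C * (?H + ennreal (1 / Suc n))) \<longlonglongrightarrow> ?C * (?H + ennreal 0)"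
        by (intro ennreal_tendsto_cmult tendsto_add tendsto_const tendsto_ennrealI LIMSEQ_Suc[OF lim_1_over_n]) auto
      then show "(\<lambda>n. ?C * (?H + ennreal (1 / Suc n))) \<longlonglongrightarrow> ?C * ?H" by simp
      show "\<forall>\<^sub>F n in sequentially. emeasure lborel (\<Inter>n. W n) \<le> ?C * (?H + ennreal (1 / Suc n))"
      proof (intro always_eventually allI)
        fix n
        have "emeasure lborel (\<Inter>n. W n) \<le> emeasure lborel (W n)" using W(1) by (intro emeasure_mono) auto
        with W(3)[of n] show "emeasure lborel (\<Inter>n. W n) \<le> ?C * (?H + ennreal (1 / Suc n))" by (rule order_trans[rotated])
      qed
    qed simp
  qed (use W in auto)
qed

section \<open>Square integrable functions\<close>

text \<open>For \<open>c > 0\<close> the minimum over \<open>s\<close> is attained at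
  \<open>- b / c\<close>; for \<open>c = 0\<close> an affine function that is nonnegative everywhere
  must be constant. Both the Cauchy--Schwarz inequality and the Euler--Lagrange defect of a
  minimizing sequence are read off from this.\<close>

lemma discriminant_le:
  fixes a b c :: real
  assumes "\<And>s. 0 \<le> a + 2 * s * b + s\<^sup>2 * c" and "0 \<le> c"
  shows "b\<^sup>2 \<le> a * c"
proof (cases "c = 0")
  case True
  have "b = 0"
  proof (rule ccontr)
    assume "b \<noteq> 0"
    then have "2 * (- (a + 1) / (2 * b)) * b = - (a + 1)" by simp
    with assms(1)[of "- (a + 1) / (2 * b)"] True show False by simp
  qed
  then show ?thesis using True by simp
next
  case False
  then have "c > 0" using assms(2) by simp
  have eq: "a + 2 * (- b / c) * b + (- b / c)\<^sup>2 * c = a - b\<^sup>2 / c"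
    using False by (simp add: field_simps power2_eq_square)
  have "b\<^sup>2 / c \<le> a" using assms(1)[of "- b / c"] unfolding eq by simp
  then show ?thesis using \<open>c > 0\<close> by (simp add: pos_divide_le_eq)
qed

section \<open>Integrability of products and the Cauchy--Schwarz inequality\<close>

lemma L2_measurable: "L2 M f \<Longrightarrow> f \<in> borel_measurable M"
  and L2_integrable: "L2 M f \<Longrightarrow> integrable M (\<lambda>x. (norm (f x))\<^sup>2)"
  by (auto simp: L2_def)

lemma L2_bound:
  fixes f :: "'a \<Rightarrow> 'b::euclidean_space" and g :: "'a \<Rightarrow> real"
  assumes "f \<in> borel_measurable M" "integrable M g" "\<And>x. x \<in> space M \<Longrightarrow> (norm (f x))\<^sup>2 \<le> g x"
  shows "L2 M f"
  unfolding L2_def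
proof
  show "integrable M (\<lambda>x. (norm (f x))\<^sup>2)"
    by (rule Bochner_Integration.integrable_bound[OF assms(2)])
       (use assms in \<open>auto intro!: AE_I2 intro: order_trans[OF _ abs_ge_self]\<close>)
qed (rule assms(1))

lemma norm_add_scaleR_sq_le: "(norm (x + c *\<^sub>R y))\<^sup>2 \<le> 2 * (norm x)\<^sup>2 + 2 * c\<^sup>2 * (norm (y::'b::euclidean_space))\<^sup>2"
proof -
  have "(norm (x + c *\<^sub>R y))\<^sup>2 \<le> (norm x + norm (c *\<^sub>R y))\<^sup>2"
    by (intro power_mono norm_triangle_ineq) auto
  also have "\<dots> \<le> 2 * (norm x)\<^sup>2 + 2 * (norm (c *\<^sub>R y))\<^sup>2"
    using sum_squares_bound[of "norm x" "norm (c *\<^sub>R y)"] by (simp add: power2_sum)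
  also have "(norm (c *\<^sub>R y))\<^sup>2 = c\<^sup>2 * (norm y)\<^sup>2" by (simp add: power_mult_distrib)
  finally show ?thesis by simp
qed

lemma L2_add_scaleR:
  assumes "L2 M f" "L2 M g"
  shows "L2 M (\<lambda>x. f x + c *\<^sub>R g x)"
proof (rule L2_bound)
  show "integrable M (\<lambda>x. 2 * (norm (f x))\<^sup>2 + 2 * c\<^sup>2 * (norm (g x))\<^sup>2)"
    by (intro Bochner_Integration.integrable_add integrable_mult_right L2_integrable assms)
  show "(\<lambda>x. f x + c *\<^sub>R g x) \<in> borel_measurable M"
    using assms[THEN L2_measurable] by simp
qed (rule norm_add_scaleR_sq_le)

lemma L2_diff: "L2 M f \<Longrightarrow> L2 M g \<Longrightarrow> L2 M (\<lambda>x. f x - g x)"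
  using L2_add_scaleR[of M f g "-1"] by simp

lemma L2_add: "L2 M f \<Longrightarrow> L2 M g \<Longrightarrow> L2 M (\<lambda>x. f x + g x)"
  using L2_add_scaleR[of M f g 1] by simp

lemma L2_add_mult: "L2 M f \<Longrightarrow> L2 M g \<Longrightarrow> L2 M (\<lambda>x. f x + c * g x :: real)"
  using L2_add_scaleR[of M f g c] by simp

lemma L2_integrable_scaleR:
  assumes "L2 M f" "L2 M g"
  shows "integrable M (\<lambda>x. (f x :: real) *\<^sub>R g x)"
proof (rule Bochner_Integration.integrable_bound)
  show "integrable M (\<lambda>x. (norm (f x))\<^sup>2 + (norm (g x))\<^sup>2)"
    by (intro Bochner_Integration.integrable_add L2_integrable assms)
  show "(\<lambda>x. f x *\<^sub>R g x) \<in> borel_measurable M"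
    using assms[THEN L2_measurable] by simp
  have "\<bar>f x\<bar> * norm (g x) \<le> (f x)\<^sup>2 + (norm (g x))\<^sup>2" for x
  proof -
    have "0 \<le> \<bar>f x\<bar> * norm (g x)" by simp
    moreover have "2 * (\<bar>f x\<bar> * norm (g x)) \<le> (f x)\<^sup>2 + (norm (g x))\<^sup>2"
      using sum_squares_bound[of "\<bar>f x\<bar>" "norm (g x)"] by (simp add: mult.assoc)
    ultimately show ?thesis by linarith
  qed
  then show "AE x in M. norm (f x *\<^sub>R g x) \<le> norm ((norm (f x))\<^sup>2 + (norm (g x))\<^sup>2)" by simp
qed

lemma L2_integrable_mult: "L2 M f \<Longrightarrow> L2 M g \<Longrightarrow> integrable M (\<lambda>x. f x * g x :: real)"
  using L2_integrable_scaleR[of M f g] by simp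

lemma L2_integrable_inner:
  assumes "L2 M f" "L2 M g"
  shows "integrable M (\<lambda>x. f x \<bullet> g x)"
proof (rule Bochner_Integration.integrable_bound)
  show "integrable M (\<lambda>x. (norm (f x))\<^sup>2 + (norm (g x))\<^sup>2)"
    by (intro Bochner_Integration.integrable_add L2_integrable assms)
  show "(\<lambda>x. f x \<bullet> g x) \<in> borel_measurable M"
    using assms[THEN L2_measurable] by simp
  have "\<bar>f x \<bullet> g x\<bar> \<le> (norm (f x))\<^sup>2 + (norm (g x))\<^sup>2" for x
  proof -
    have "0 \<le> norm (f x) * norm (g x)" by simp
    moreover have "2 * (norm (f x) * norm (g x)) \<le> (norm (f x))\<^sup>2 + (norm (g x))\<^sup>2"
      using sum_squares_bound[of "norm (f x)" "norm (g x)"] by (simp add: mult.assoc)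
    ultimately show ?thesis using Cauchy_Schwarz_ineq2[of "f x" "g x"] by linarith
  qed
  then show "AE x in M. norm (f x \<bullet> g x) \<le> norm ((norm (f x))\<^sup>2 + (norm (g x))\<^sup>2)" by simp
qed

lemma LINT_norm_sq_add_scaleR:
  assumes "L2 M f" "L2 M g"
  shows "(LINT x|M. (norm (f x + c *\<^sub>R g x))\<^sup>2)
    = (LINT x|M. (norm (f x))\<^sup>2) + 2 * c * (LINT x|M. f x \<bullet> g x) + c\<^sup>2 * (LINT x|M. (norm (g x))\<^sup>2)"
proof -
  have "(norm (f x + c *\<^sub>R g x))\<^sup>2 = (norm (f x))\<^sup>2 + 2 * c * (f x \<bullet> g x) + c\<^sup>2 * (norm (g x))\<^sup>2" for x
    unfolding power2_norm_eq_inner by (simp add: inner_simps inner_commute power2_eq_square algebra_simps)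
  then show ?thesis
    using L2_integrable_inner[OF assms] assms[THEN L2_integrable] by simp
qed

lemma L2_Cauchy_Schwarz:
  assumes "L2 M f" "L2 M g"
  shows "(LINT x|M. f x \<bullet> g x)\<^sup>2 \<le> (LINT x|M. (norm (f x))\<^sup>2) * (LINT x|M. (norm (g x))\<^sup>2)"
proof (rule discriminant_le)
  fix s
  have "0 \<le> (LINT x|M. (norm (f x + s *\<^sub>R g x))\<^sup>2)" by simp
  then show "0 \<le> (LINT x|M. (norm (f x))\<^sup>2) + 2 * s * (LINT x|M. f x \<bullet> g x) + s\<^sup>2 * (LINT x|M. (norm (g x))\<^sup>2)"
    by (simp add: LINT_norm_sq_add_scaleR[OF assms])
qed simp

lemma L2_nn_integral:
  assumes "L2 M f"
  shows "(\<integral>\<^sup>+x. ennreal ((norm (f x))\<^sup>2) \<partial>M) = ennreal (LINT x|M. (norm (f x))\<^sup>2)"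
  by (rule nn_integral_eq_integral) (use L2_integrable[OF assms] in auto)

lemma L2_nn_integralI:
  assumes "f \<in> borel_measurable M" "(\<integral>\<^sup>+x. ennreal ((norm (f x))\<^sup>2) \<partial>M) < top"
  shows "L2 M f"
  unfolding L2_def using assms by (auto simp: integrable_iff_bounded)

text \<open>Membership of all terms and of the limit is part of the notion: the Bochner integral of
  a non-integrable function is \<open>0\<close>, so the limit by itself could hold
  vacuously.\<close>

definition L2_tendsto :: "'a measure \<Rightarrow> (nat \<Rightarrow> 'a \<Rightarrow> 'b::euclidean_space) \<Rightarrow> ('a \<Rightarrow> 'b) \<Rightarrow> bool" where
  "L2_tendsto M f l \<longleftrightarrow> (\<forall>n. L2 M (f n)) \<and> L2 M l \<and> (\<lambda>n. LINT x|M. (norm (f n x - l x))\<^sup>2) \<longlonglongrightarrow> 0"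

lemma L2_tendsto_const: "L2 M f \<Longrightarrow> L2_tendsto M (\<lambda>_. f) f"
  by (simp add: L2_tendsto_def)

text \<open>The difference of the inner products splits into three terms, each containing at least
  one of \<open>f n - l\<close> and \<open>g n - h\<close>, and each tends to \<open>0\<close> by
  Cauchy--Schwarz.\<close>

lemma L2_tendsto_inner:
  assumes f: "L2_tendsto M f l" and g: "L2_tendsto M g h"
  shows "(\<lambda>n. LINT x|M. f n x \<bullet> g n x) \<longlonglongrightarrow> (LINT x|M. l x \<bullet> h x)"
proof -
  have L: "L2 M (f n)" "L2 M (g n)" "L2 M l" "L2 M h" for n
    using f g by (auto simp: L2_tendsto_def)
  note D = L2_diff[OF L(1,3)] L2_diff[OF L(2,4)]
  let ?F = "\<lambda>n. LINT x|M. (norm (f n x - l x))\<^sup>2" and ?G = "\<lambda>n. LINT x|M. (norm (g n x - h x))\<^sup>2"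
  have F: "?F \<longlonglongrightarrow> 0" and G: "?G \<longlonglongrightarrow> 0" using f g by (auto simp: L2_tendsto_def)
  have zero: "X \<longlonglongrightarrow> 0" if "\<And>n. (X n)\<^sup>2 \<le> Y n" "Y \<longlonglongrightarrow> 0" for X Y :: "nat \<Rightarrow> real"
  proof -
    have "(\<lambda>n. (X n)\<^sup>2) \<longlonglongrightarrow> 0"
      by (rule tendsto_sandwich[OF _ _ tendsto_const that(2)]) (use that(1) in auto)
    from tendsto_real_sqrt[OF this] show ?thesis by (simp add: tendsto_rabs_zero_iff)
  qed
  have "(\<lambda>n. LINT x|M. (f n x - l x) \<bullet> (g n x - h x)) \<longlonglongrightarrow> 0"
    by (rule zero[OF L2_Cauchy_Schwarz[OF D]]) (use tendsto_mult[OF F G] in simp)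
  moreover have "(\<lambda>n. LINT x|M. (f n x - l x) \<bullet> h x) \<longlonglongrightarrow> 0"
    by (rule zero[OF L2_Cauchy_Schwarz[OF D(1) L(4)]]) (use tendsto_mult[OF F tendsto_const] in simp)
  moreover have "(\<lambda>n. LINT x|M. l x \<bullet> (g n x - h x)) \<longlonglongrightarrow> 0"
    by (rule zero[OF L2_Cauchy_Schwarz[OF L(3) D(2)]]) (use tendsto_mult[OF tendsto_const G] in simp)
  moreover have "(LINT x|M. f n x \<bullet> g n x) = (LINT x|M. (f n x - l x) \<bullet> (g n x - h x))
      + (LINT x|M. (f n x - l x) \<bullet> h x) + (LINT x|M. l x \<bullet> (g n x - h x)) + (LINT x|M. l x \<bullet> h x)" for n
    by (subst Bochner_Integration.integral_add[symmetric], (intro L2_integrable_inner D L Bochner_Integration.integrable_add)+)+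
       (rule Bochner_Integration.integral_cong, auto simp: inner_simps)
  ultimately show ?thesis
    by (simp only:) (rule tendsto_eq_intros refl | assumption | simp)+
qed

lemma L2_tendsto_norm_sq:
  assumes "L2_tendsto M f l"
  shows "(\<lambda>n. LINT x|M. (norm (f n x))\<^sup>2) \<longlonglongrightarrow> (LINT x|M. (norm (l x))\<^sup>2)"
  using L2_tendsto_inner[OF assms assms] by (simp add: power2_norm_eq_inner)

text \<open>The rate \<open>1/8\<close> leaves a summable \<open>(1/2) ^ k\<close> after
  multiplication with the weight \<open>4 ^ k\<close> in \<open>L2_complete\<close>.\<close>

lemma exists_fast_subseq:
  fixes d :: "nat \<Rightarrow> nat \<Rightarrow> real"
  assumes "\<And>e. 0 < e \<Longrightarrow> \<exists>N. \<forall>m\<ge>N. \<forall>n\<ge>N. d m n < e"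
  obtains r :: "nat \<Rightarrow> nat" where "strict_mono r" "\<And>k. d (r (Suc k)) (r k) < (1/8) ^ k"
proof -
  obtain N where N: "\<And>k m n. N k \<le> m \<Longrightarrow> N k \<le> n \<Longrightarrow> d m n < (1/8) ^ k"
    using assms[of "(1/8) ^ _"] by (metis zero_less_power zero_less_divide_1_iff zero_less_numeral)
  define r where "r = rec_nat (N 0) (\<lambda>k y. max (N (Suc k)) (Suc y))"
  have r: "r 0 = N 0" "r (Suc k) = max (N (Suc k)) (Suc (r k))" for k by (auto simp: r_def)
  have N_le: "N k \<le> r k" for k by (cases k) (auto simp: r)
  have sm: "strict_mono r" by (rule strict_monoI_Suc) (simp add: r)
  moreover have "d (r (Suc k)) (r k) < (1/8) ^ k" for k
    using N_le[of k] sm by (intro N) (auto simp: r)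
  ultimately show ?thesis using that by blast
qed

text \<open>The Riesz--Fischer theorem. Squared increments of a fast subsequence, weighted by
  \<open>4 ^ k\<close>, have an almost everywhere finite sum; this forces geometric decay of the
  increments and pointwise convergence. Fatou's lemma then transfers the Cauchy estimate to the
  pointwise limit.\<close>

lemma L2_complete:
  fixes f :: "nat \<Rightarrow> 'a \<Rightarrow> 'b::euclidean_space"
  assumes f: "\<And>n. L2 M (f n)"
    and Cauchy: "\<And>e. 0 < e \<Longrightarrow> \<exists>N. \<forall>m\<ge>N. \<forall>n\<ge>N. (LINT x|M. (norm (f m x - f n x))\<^sup>2) < e"
  shows "\<exists>l. L2_tendsto M f l"
proof -
  obtain r :: "nat \<Rightarrow> nat" where r: "strict_mono r"
    "\<And>k. (LINT x|M. (norm (f (r (Suc k)) x - f (r k) x))\<^sup>2) < (1/8) ^ k"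
    using exists_fast_subseq[of "\<lambda>m n. LINT x|M. (norm (f m x - f n x))\<^sup>2", OF Cauchy] by metis
  have meas [measurable]: "f n \<in> borel_measurable M" for n using f by (rule L2_measurable)
  define g where "g k x = (norm (f (r (Suc k)) x - f (r k) x))\<^sup>2" for k x
  have [measurable]: "g k \<in> borel_measurable M" for k unfolding g_def by measurable
  have gk: "(\<integral>\<^sup>+x. ennreal (4 ^ k * g k x) \<partial>M) \<le> ennreal ((1/2) ^ k)" for k
  proof -
    have "(\<integral>\<^sup>+x. ennreal (4 ^ k * g k x) \<partial>M) = ennreal (4 ^ k) * (\<integral>\<^sup>+x. ennreal (g k x) \<partial>M)"
      by (subst nn_integral_cmult[symmetric]) (auto simp: ennreal_mult g_def)
    also have "(\<integral>\<^sup>+x. ennreal (g k x) \<partial>M) \<le> ennreal ((1/8) ^ k)"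
      unfolding g_def using L2_nn_integral[OF L2_diff[OF f f]] r(2)[of k] by (simp add: ennreal_leI less_imp_le)
    finally have "(\<integral>\<^sup>+x. ennreal (4 ^ k * g k x) \<partial>M) \<le> ennreal (4 ^ k) * ennreal ((1/8) ^ k)"
      by (simp add: mult_left_mono)
    also have "\<dots> = ennreal ((1/2) ^ k)" by (simp add: ennreal_mult[symmetric] power_mult_distrib[symmetric])
    finally show ?thesis .
  qed
  have "(\<integral>\<^sup>+x. (\<Sum>k. ennreal (4 ^ k * g k x)) \<partial>M) = (\<Sum>k. \<integral>\<^sup>+x. ennreal (4 ^ k * g k x) \<partial>M)"
    by (rule nn_integral_suminf) simp
  also have "\<dots> \<le> (\<Sum>k. ennreal ((1/2) ^ k))" by (intro suminf_le gk) auto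
  also have "\<dots> = ennreal (\<Sum>k. (1/2) ^ k)" by (intro suminf_ennreal2) auto
  finally have "(\<integral>\<^sup>+x. (\<Sum>k. ennreal (4 ^ k * g k x)) \<partial>M) \<noteq> \<infinity>"
    by (auto simp: top_unique)
  then have AE: "AE x in M. (\<Sum>k. ennreal (4 ^ k * g k x)) \<noteq> \<infinity>"
    by (intro nn_integral_PInf_AE) auto
  define l where "l x = lim (\<lambda>k. f (r k) x)" for x
  have [measurable]: "l \<in> borel_measurable M" unfolding l_def by (rule borel_measurable_lim_metric) simp
  have conv: "AE x in M. (\<lambda>k. f (r k) x) \<longlonglongrightarrow> l x"
    using AE
  proof eventually_elim
    fix x assume fin: "(\<Sum>k. ennreal (4 ^ k * g k x)) \<noteq> \<infinity>"
    then obtain C where C: "(\<Sum>k. ennreal (4 ^ k * g k x)) = ennreal C" "0 \<le> C"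
      by (metis ennreal_cases infinity_ennreal_def)
    have "norm (f (r (Suc k)) x - f (r k) x) \<le> sqrt C * (1/2) ^ k" for k
    proof -
      have "ennreal (4 ^ k * g k x) \<le> ennreal C"
        unfolding C(1)[symmetric] using sum_le_suminf[of "\<lambda>k. ennreal (4 ^ k * g k x)" "{k}"] by simp
      then have "4 ^ k * g k x \<le> C" using C(2) by (simp add: ennreal_le_iff)
      then have "(2 ^ k * norm (f (r (Suc k)) x - f (r k) x))\<^sup>2 \<le> C"
        by (simp add: g_def power_mult_distrib power_mult[symmetric] mult.commute[of k] power_mult)
      then have "2 ^ k * norm (f (r (Suc k)) x - f (r k) x) \<le> sqrt C" by (rule real_le_rsqrt)
      then show ?thesis by (simp add: field_simps power_divide)
    qed
    then have "summable (\<lambda>k. f (r (Suc k)) x - f (r k) x)"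
      by (intro summable_comparison_test'[OF summable_mult[OF summable_geometric, where c = "sqrt C"]]) auto
    then have "convergent (\<lambda>n. \<Sum>k<n. f (r (Suc k)) x - f (r k) x)" by (simp add: summable_iff_convergent)
    then have "convergent (\<lambda>n. f (r n) x - f (r 0) x)" by (simp add: sum_lessThan_telescope[of "\<lambda>k. f (r k) x"])
    then have "convergent (\<lambda>n. (f (r n) x - f (r 0) x) + f (r 0) x)" by (intro convergent_add convergent_const)
    then show "(\<lambda>k. f (r k) x) \<longlonglongrightarrow> l x" unfolding l_def by (simp add: convergent_LIMSEQ_iff)
  qed
  \<comment> \<open>Fatou's lemma along \<open>r k\<close> with \<open>n\<close> fixed, while the
    Cauchy condition bounds every integral with index \<open>r k \<ge> N\<close>.\<close>
  have est: "\<exists>N. \<forall>n\<ge>N. (\<integral>\<^sup>+x. ennreal ((norm (f n x - l x))\<^sup>2) \<partial>M) \<le> ennreal e" if e: "0 < e" for e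
  proof -
    obtain N where N: "\<And>m n. m \<ge> N \<Longrightarrow> n \<ge> N \<Longrightarrow> (LINT x|M. (norm (f m x - f n x))\<^sup>2) < e"
      using Cauchy[OF e] by blast
    have "(\<integral>\<^sup>+x. ennreal ((norm (f n x - l x))\<^sup>2) \<partial>M) \<le> ennreal e" if n: "n \<ge> N" for n
    proof -
      have "(\<integral>\<^sup>+x. ennreal ((norm (f n x - l x))\<^sup>2) \<partial>M)
         = (\<integral>\<^sup>+x. liminf (\<lambda>k. ennreal ((norm (f n x - f (r k) x))\<^sup>2)) \<partial>M)"
      proof (rule nn_integral_cong_AE, use conv in eventually_elim)
        fix x assume "(\<lambda>k. f (r k) x) \<longlonglongrightarrow> l x"
        then have "(\<lambda>k. ennreal ((norm (f n x - f (r k) x))\<^sup>2)) \<longlonglongrightarrow> ennreal ((norm (f n x - l x))\<^sup>2)"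
          by (intro tendsto_intros tendsto_ennrealI)
        then show "ennreal ((norm (f n x - l x))\<^sup>2) = liminf (\<lambda>k. ennreal ((norm (f n x - f (r k) x))\<^sup>2))"
          by (intro lim_imp_Liminf[OF sequentially_bot, symmetric])
      qed
      also have "\<dots> \<le> liminf (\<lambda>k. \<integral>\<^sup>+x. ennreal ((norm (f n x - f (r k) x))\<^sup>2) \<partial>M)"
        by (rule nn_integral_liminf) simp
      also have "\<dots> \<le> liminf (\<lambda>k. ennreal e)"
      proof (rule Liminf_mono, rule eventually_mono[OF eventually_ge_at_top[of N]])
        fix k assume "N \<le> k"
        then have "N \<le> r k" using seq_suble[OF r(1), of k] by simp
        then show "(\<integral>\<^sup>+x. ennreal ((norm (f n x - f (r k) x))\<^sup>2) \<partial>M) \<le> ennreal e"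
          using N[OF n] by (simp add: L2_nn_integral[OF L2_diff[OF f f]] ennreal_leI less_imp_le)
      qed
      also have "\<dots> = ennreal e" by (simp add: Liminf_const)
      finally show ?thesis .
    qed
    then show ?thesis by blast
  qed
  obtain N where "(\<integral>\<^sup>+x. ennreal ((norm (f N x - l x))\<^sup>2) \<partial>M) \<le> ennreal 1" using est[of 1] by auto
  then have "L2 M (\<lambda>x. f N x - l x)" by (intro L2_nn_integralI) (auto intro: le_less_trans)
  from L2_diff[OF f[of N] this] have l: "L2 M l" by simp
  have "(\<lambda>n. LINT x|M. (norm (f n x - l x))\<^sup>2) \<longlonglongrightarrow> 0"
  proof (rule LIMSEQ_I)
    fix e :: real assume "0 < e"
    then obtain N where N: "\<And>n. n \<ge> N \<Longrightarrow> (\<integral>\<^sup>+x. ennreal ((norm (f n x - l x))\<^sup>2) \<partial>M) \<le> ennreal (e / 2)"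
      using est[of "e / 2"] by auto
    show "\<exists>N. \<forall>n\<ge>N. norm ((LINT x|M. (norm (f n x - l x))\<^sup>2) - 0) < e"
    proof (intro exI[of _ N] allI impI)
      fix n assume "n \<ge> N"
      from N[OF this] have "(LINT x|M. (norm (f n x - l x))\<^sup>2) \<le> e / 2"
        using \<open>0 < e\<close> by (simp add: L2_nn_integral[OF L2_diff[OF f l]] ennreal_le_iff)
      then show "norm ((LINT x|M. (norm (f n x - l x))\<^sup>2) - 0) < e" using \<open>0 < e\<close> by simp
    qed
  qed
  with f l show ?thesis unfolding L2_tendsto_def by blast
qed

lemma nn_integral_tendsto_imp_L2_tendsto:
  assumes f: "\<And>n. f n \<in> borel_measurable M" and l: "L2 M l"
    and lim: "(\<lambda>n. \<integral>\<^sup>+x. ennreal ((norm (f n x - l x))\<^sup>2) \<partial>M) \<longlonglongrightarrow> 0"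
  shows "\<exists>N. \<forall>m\<ge>N. L2_tendsto M (\<lambda>n. f (n + m)) l"
proof -
  have "\<forall>\<^sub>F n in sequentially. (\<integral>\<^sup>+x. ennreal ((norm (f n x - l x))\<^sup>2) \<partial>M) < 1"
    using lim by (rule order_tendstoD) simp
  then obtain N where N: "\<And>n. n \<ge> N \<Longrightarrow> (\<integral>\<^sup>+x. ennreal ((norm (f n x - l x))\<^sup>2) \<partial>M) < 1"
    unfolding eventually_sequentially by blast
  have fL: "L2 M (f n)" if "n \<ge> N" for n
  proof -
    have "L2 M (\<lambda>x. f n x - l x)"
      using N[OF that] f L2_measurable[OF l] by (intro L2_nn_integralI) (auto intro: less_trans)
    from L2_add[OF this l] show ?thesis by simp
  qed
  show ?thesis
  proof (intro exI[of _ N] allI impI)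
    fix m assume m: "N \<le> m"
    have "(\<lambda>n. \<integral>\<^sup>+x. ennreal ((norm (f (n + m) x - l x))\<^sup>2) \<partial>M) \<longlonglongrightarrow> 0"
      using lim by (rule LIMSEQ_ignore_initial_segment)
    then have "(\<lambda>n. ennreal (LINT x|M. (norm (f (n + m) x - l x))\<^sup>2)) \<longlonglongrightarrow> ennreal 0"
      using m by (simp add: L2_nn_integral[OF L2_diff[OF fL l]])
    then have "(\<lambda>n. LINT x|M. (norm (f (n + m) x - l x))\<^sup>2) \<longlonglongrightarrow> 0"
      by (rule tendsto_ennrealD) auto
    then show "L2_tendsto M (\<lambda>n. f (n + m)) l"
      using l fL m by (simp add: L2_tendsto_def)
  qed
qed

lemma L2_tendsto_imp_nn_integral:
  assumes "L2_tendsto M f l"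
  shows "(\<lambda>n. \<integral>\<^sup>+x. ennreal ((norm (f n x - l x))\<^sup>2) \<partial>M) \<longlonglongrightarrow> 0"
proof -
  have L: "L2 M (\<lambda>x. f n x - l x)" for n using assms by (auto simp: L2_tendsto_def intro: L2_diff)
  have "(\<lambda>n. LINT x|M. (norm (f n x - l x))\<^sup>2) \<longlonglongrightarrow> 0" using assms by (simp add: L2_tendsto_def)
  then have "(\<lambda>n. ennreal (LINT x|M. (norm (f n x - l x))\<^sup>2)) \<longlonglongrightarrow> ennreal 0" by (rule tendsto_ennrealI)
  then show ?thesis by (simp add: L2_nn_integral[OF L])
qed

section \<open>Continuously differentiable functions\<close>

text \<open>The estimates concern squares and products of smooth functions. Their gradients come
  from a single product rule, whereas \<open>smooth\<close> would call for an induction over all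
  iterated derivatives.\<close>

definition C1_gradient :: "('a::euclidean_space \<Rightarrow> real) \<Rightarrow> ('a \<Rightarrow> 'a) \<Rightarrow> bool" where
  "C1_gradient f G \<longleftrightarrow> (\<forall>x. (f has_derivative (\<lambda>h. G x \<bullet> h)) (at x)) \<and> continuous_on UNIV G"

lemma C1_gradient_derivative: "C1_gradient f G \<Longrightarrow> (f has_derivative (\<lambda>h. G x \<bullet> h)) (at x)"
  and C1_gradient_continuous_gradient: "C1_gradient f G \<Longrightarrow> continuous_on UNIV G"
  by (auto simp: C1_gradient_def)

lemma C1_gradient_continuous: "C1_gradient f G \<Longrightarrow> continuous_on UNIV f"
  by (meson C1_gradient_derivative continuous_at_imp_continuous_on has_derivative_continuous)

lemma C1_gradient_borel [measurable_dest]: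
  assumes "C1_gradient f G"
  shows "f \<in> borel_measurable borel" "G \<in> borel_measurable borel"
  using C1_gradient_continuous[OF assms] C1_gradient_continuous_gradient[OF assms]
  by (auto intro: borel_measurable_continuous_onI)

lemma C1_gradient_unique:
  assumes "C1_gradient f G" shows "gradient f x = G x"
proof -
  have "frechet_derivative f (at x) = (\<lambda>h. G x \<bullet> h)"
    by (rule frechet_derivative_at[OF C1_gradient_derivative[OF assms], symmetric])
  then show ?thesis by (simp add: gradient_def euclidean_representation)
qed

lemma C1_gradient_add_mult:
  assumes "C1_gradient f F" "C1_gradient g G"
  shows "C1_gradient (\<lambda>x. f x + c * g x) (\<lambda>x. F x + c *\<^sub>R G x)"
  unfolding C1_gradient_def
proof (intro conjI allI)
  fix x
  show "((\<lambda>x. f x + c * g x) has_derivative (\<lambda>h. (F x + c *\<^sub>R G x) \<bullet> h)) (at x)"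
    by (rule has_derivative_eq_rhs[OF has_derivative_add[OF C1_gradient_derivative[OF assms(1)]
          has_derivative_mult_right[OF C1_gradient_derivative[OF assms(2)]]]])
       (simp add: inner_simps)
qed (intro continuous_intros assms[THEN C1_gradient_continuous_gradient])

lemma C1_gradient_mult:
  assumes "C1_gradient f F" "C1_gradient g G"
  shows "C1_gradient (\<lambda>x. f x * g x) (\<lambda>x. f x *\<^sub>R G x + g x *\<^sub>R F x)"
  unfolding C1_gradient_def
proof (intro conjI allI)
  fix x
  show "((\<lambda>x. f x * g x) has_derivative (\<lambda>h. (f x *\<^sub>R G x + g x *\<^sub>R F x) \<bullet> h)) (at x)"
    by (rule has_derivative_eq_rhs[OF has_derivative_mult[OF C1_gradient_derivative[OF assms(1)]
          C1_gradient_derivative[OF assms(2)]]])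
       (simp add: inner_simps mult.commute)
qed (intro continuous_intros assms[THEN C1_gradient_continuous_gradient] assms[THEN C1_gradient_continuous])

lemma C1_gradient_const: "C1_gradient (\<lambda>x. c) (\<lambda>x. 0)"
  by (auto simp: C1_gradient_def)

section \<open>Smooth functions\<close>

lemma smooth_differentiable:
  assumes "smooth f" shows "iterated_deriv vs f differentiable (at x)"
  using assms unfolding smooth_def differentiable_on_def by auto

lemma smooth_C1_gradient:
  assumes "smooth f" shows "C1_gradient f (gradient f)"
  unfolding C1_gradient_def
proof (intro conjI allI)
  fix x
  have "f differentiable (at x)" using smooth_differentiable[OF assms, of "[]"] by simp
  then have D: "(f has_derivative frechet_derivative f (at x)) (at x)"
    by (simp add: frechet_derivative_works)
  then have lin: "linear (frechet_derivative f (at x))" by (rule has_derivative_linear)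
  have "frechet_derivative f (at x) h = gradient f x \<bullet> h" for h
  proof -
    have "frechet_derivative f (at x) h = frechet_derivative f (at x) (\<Sum>b\<in>Basis. (h \<bullet> b) *\<^sub>R b)"
      by (simp add: euclidean_representation)
    also have "\<dots> = (\<Sum>b\<in>Basis. (h \<bullet> b) * frechet_derivative f (at x) b)"
      by (simp add: linear_sum[OF lin] linear_scale[OF lin])
    also have "\<dots> = gradient f x \<bullet> h"
      unfolding gradient_def inner_sum_left by (intro sum.cong) (auto simp: inner_commute)
    finally show ?thesis .
  qed
  then have "frechet_derivative f (at x) = (\<lambda>h. gradient f x \<bullet> h)" by blast
  with D show "(f has_derivative (\<lambda>h. gradient f x \<bullet> h)) (at x)" by simp
next
  have "continuous_on UNIV (\<lambda>x. frechet_derivative f (at x) b)" for b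
  proof -
    have "iterated_deriv [b] f differentiable_on UNIV" using assms by (simp only: smooth_def)
    then show ?thesis using differentiable_imp_continuous_on by force
  qed
  then show "continuous_on UNIV (gradient f)"
    unfolding gradient_def by (intro continuous_intros)
qed

lemma iterated_deriv_add_mult:
  assumes "smooth f" "smooth g"
  shows "iterated_deriv vs (\<lambda>x. f x + c * g x) = (\<lambda>x. iterated_deriv vs f x + c * iterated_deriv vs g x)"
proof (induction vs)
  case (Cons v vs)
  show ?case
  proof
    fix x
    have "(iterated_deriv vs f has_derivative frechet_derivative (iterated_deriv vs f) (at x)) (at x)"
      "(iterated_deriv vs g has_derivative frechet_derivative (iterated_deriv vs g) (at x)) (at x)"
      using smooth_differentiable[OF assms(1)] smooth_differentiable[OF assms(2)]
      by (simp_all add: frechet_derivative_works)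
    from has_derivative_add[OF this(1) has_derivative_mult_right[OF this(2)], of c]
    have "frechet_derivative (\<lambda>x. iterated_deriv vs f x + c * iterated_deriv vs g x) (at x)
       = (\<lambda>h. frechet_derivative (iterated_deriv vs f) (at x) h + c * frechet_derivative (iterated_deriv vs g) (at x) h)"
      by (rule frechet_derivative_at[symmetric])
    then show "iterated_deriv (v # vs) (\<lambda>x. f x + c * g x) x
       = iterated_deriv (v # vs) f x + c * iterated_deriv (v # vs) g x"
      by (simp add: Cons)
  qed
qed simp

lemma smooth_add_mult:
  assumes "smooth f" "smooth g" shows "smooth (\<lambda>x. f x + c * g x)"
  unfolding smooth_def iterated_deriv_add_mult[OF assms]
proof
  fix vs
  show "(\<lambda>x. iterated_deriv vs f x + c * iterated_deriv vs g x) differentiable_on UNIV"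
    using assms unfolding smooth_def
    by (intro differentiable_on_add differentiable_on_mult differentiable_on_const) auto
qed

lemma gradient_add_mult:
  assumes "smooth f" "smooth g"
  shows "gradient (\<lambda>x. f x + c * g x) x = gradient f x + c *\<^sub>R gradient g x"
  by (rule C1_gradient_unique[OF C1_gradient_add_mult[OF smooth_C1_gradient smooth_C1_gradient]]) fact+

lemma smooth_const: "smooth (\<lambda>x. c)"
proof -
  have const: "\<exists>d. iterated_deriv vs (\<lambda>x. c) = (\<lambda>x. d)" for vs
  proof (induction vs)
    case (Cons v vs)
    then show ?case by (auto simp: frechet_derivative_const)
  qed auto
  show ?thesis unfolding smooth_def
  proof (intro allI)
    fix vs
    obtain d where "iterated_deriv vs (\<lambda>x. c) = (\<lambda>x. d)" using const by blast
    then show "iterated_deriv vs (\<lambda>x. c) differentiable_on UNIV" by (simp only: differentiable_on_const)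
  qed
qed

lemma gradient_const: "gradient (\<lambda>x. c) x = 0"
  by (rule C1_gradient_unique[OF C1_gradient_const])

section \<open>Integration by parts\<close>

lemma C1_gradient_support:
  assumes "C1_gradient f G" "closed K" "\<And>x. x \<notin> K \<Longrightarrow> f x = 0" "x \<notin> K"
  shows "G x = 0"
proof -
  have "((\<lambda>x. 0) has_derivative (\<lambda>h. G x \<bullet> h)) (at x)"
    by (rule has_derivative_transform_within_open[OF C1_gradient_derivative[OF assms(1)], of "- K"])
       (use assms in auto)
  then have "(\<lambda>h. G x \<bullet> h) = (\<lambda>h. 0)" by (rule has_derivative_unique) simp
  then show ?thesis by (metis inner_eq_zero_iff)
qed

lemma integrable_continuous_support:
  fixes f :: "'a::euclidean_space \<Rightarrow> 'b::euclidean_space"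
  assumes "continuous_on UNIV f" "compact K" "\<And>x. x \<notin> K \<Longrightarrow> f x = 0"
  shows "integrable lborel f"
proof -
  have "integrable lborel (\<lambda>x. indicator K x *\<^sub>R f x)"
    using borel_integrable_compact[OF assms(2) continuous_on_subset[OF assms(1)]]
    by (simp add: set_integrable_def)
  moreover have "(\<lambda>x. indicator K x *\<^sub>R f x) = f" using assms(3) by (auto simp: indicator_def fun_eq_iff)
  ultimately show ?thesis by simp
qed

text \<open>The difference quotients in direction \<open>b\<close> integrate to \<open>0\<close> by translation invariance.\<close>

lemma integral_gradient_compact_support:
  fixes f :: "'a::euclidean_space \<Rightarrow> real"
  assumes f: "C1_gradient f G" and K: "compact K" "\<And>x. x \<notin> K \<Longrightarrow> f x = 0"
  shows "(LINT x|lborel. G x) = 0"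
proof (rule euclidean_eqI)
  fix b :: 'a assume b: "b \<in> Basis"
  have G0: "G x = 0" if "x \<notin> K" for x
    using C1_gradient_support[OF f compact_imp_closed[OF K(1)] K(2) that] .
  have fint: "integrable lborel f"
    by (rule integrable_continuous_support[OF C1_gradient_continuous[OF f] K(1)]) (rule K(2))
  have Gint: "integrable lborel G"
    by (rule integrable_continuous_support[OF C1_gradient_continuous_gradient[OF f] K(1)]) (rule G0)
  have [measurable]: "f \<in> borel_measurable borel" "G \<in> borel_measurable borel" using f by measurable
  obtain M where M: "\<And>x. x \<in> K \<Longrightarrow> norm (G x) \<le> M"
    using compact_imp_bounded[OF compact_continuous_image[OF continuous_on_subset[OF C1_gradient_continuous_gradient[OF f]] K(1)]]
    by (auto simp: bounded_iff)
  obtain R where R: "\<And>x. x \<in> K \<Longrightarrow> norm x \<le> R"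
    using compact_imp_bounded[OF K(1)] by (auto simp: bounded_iff)
  define M' where "M' = max M 0"
  have M': "norm (G x) \<le> M'" for x using M[of x] G0[of x] by (cases "x \<in> K") (auto simp: M'_def)
  have lip: "\<bar>f (x + h) - f x\<bar> \<le> M' * norm h" for x h
  proof -
    have "norm (f (x + h) - f x) \<le> M' * norm ((x + h) - x)"
    proof (rule differentiable_bound[of UNIV f "\<lambda>x h. G x \<bullet> h"])
      show "onorm (\<lambda>h. G z \<bullet> h) \<le> M'" for z
        by (rule onorm_le) (metis M' Cauchy_Schwarz_ineq2 mult_right_mono norm_ge_zero order_trans real_norm_def)
    qed (use C1_gradient_derivative[OF f] in auto)
    then show ?thesis by simp
  qed
  define d where "d n x = real (Suc n) * (f (x + (1 / Suc n) *\<^sub>R b) - f x)" for n x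
  have d0: "(LINT x|lborel. d n x) = 0" for n
  proof -
    let ?c = "(1 / Suc n) *\<^sub>R b"
    have "(LINT x|distr lborel borel ((+) ?c). f x) = (LINT x|lborel. f (?c + x))"
      by (rule integral_distr) simp_all
    then have "(LINT x|lborel. f (x + ?c)) = (LINT x|lborel. f x)"
      by (simp only: lborel_distr_plus add.commute)
    moreover have "integrable (distr lborel borel ((+) ?c)) f \<longleftrightarrow> integrable lborel (\<lambda>x. f (?c + x))"
      by (rule integrable_distr_eq) simp_all
    then have "integrable lborel (\<lambda>x. f (x + ?c))"
      using fint by (simp only: lborel_distr_plus add.commute)
    ultimately show ?thesis unfolding d_def using fint by simp
  qed
  have "(\<lambda>n. LINT x|lborel. d n x) \<longlonglongrightarrow> (LINT x|lborel. G x \<bullet> b)"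
  proof (rule integral_dominated_convergence)
    \<comment> \<open>The steps have length at most \<open>1\<close>, so the quotients vanish
      outside the ball of radius \<open>R + 1\<close>; the Lipschitz estimate \<open>lip\<close>
      bounds them by \<open>M'\<close> inside.\<close>
    show "integrable lborel (\<lambda>x. indicator (cball 0 (R + 1)) x *\<^sub>R M')"
      by (intro integrable_real_indicator integrable_scaleR_left) (use emeasure_bounded_finite[OF bounded_cball, of 0 "R + 1"] in auto)
    show "AE x in lborel. (\<lambda>n. d n x) \<longlonglongrightarrow> G x \<bullet> b"
    proof (intro AE_I2)
      fix x
      have "((\<lambda>t. x + t *\<^sub>R b) has_derivative (\<lambda>h. h *\<^sub>R b)) (at 0)"
        by (auto intro!: derivative_eq_intros)
      from has_derivative_compose[OF this C1_gradient_derivative[OF f]]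
      have "((\<lambda>t. f (x + t *\<^sub>R b)) has_real_derivative (G x \<bullet> b)) (at 0)"
        by (rule has_derivative_imp_has_field_derivative) simp
      then have "((\<lambda>t. (f (x + t *\<^sub>R b) - f x) / t) \<longlongrightarrow> G x \<bullet> b) (at 0)"
        by (simp add: DERIV_def)
      moreover have "filterlim (\<lambda>n. 1 / real (Suc n)) (at 0) sequentially"
        unfolding filterlim_at using LIMSEQ_Suc[OF lim_1_over_n] by auto
      ultimately have "(\<lambda>n. (f (x + (1 / real (Suc n)) *\<^sub>R b) - f x) / (1 / real (Suc n))) \<longlonglongrightarrow> G x \<bullet> b"
        by (rule filterlim_compose)
      then show "(\<lambda>n. d n x) \<longlonglongrightarrow> G x \<bullet> b" unfolding d_def by (simp add: mult.commute)
    qed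
    show "AE x in lborel. norm (d n x) \<le> indicator (cball 0 (R + 1)) x *\<^sub>R M'" for n
    proof (intro AE_I2)
      fix x
      have small: "norm ((1 / Suc n) *\<^sub>R b) \<le> 1" using b by simp
      show "norm (d n x) \<le> indicator (cball 0 (R + 1)) x *\<^sub>R M'"
      proof (cases "x \<in> cball 0 (R + 1)")
        case True
        have "norm (d n x) \<le> real (Suc n) * (M' * norm ((1 / Suc n) *\<^sub>R b))"
          unfolding d_def real_norm_def abs_mult using lip[of x "(1 / Suc n) *\<^sub>R b"]
          by (simp only: abs_of_nat mult_left_mono of_nat_0_le_iff)
        also have "\<dots> = M'" using b by (simp add: field_simps)
        finally show ?thesis using True by simp
      next
        case False
        then have "norm x > R + 1" by simp
        moreover have "norm x \<le> norm (x + (1 / Suc n) *\<^sub>R b) + norm ((1 / Suc n) *\<^sub>R b)"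
          using norm_triangle_ineq4[of "x + (1 / Suc n) *\<^sub>R b" "(1 / Suc n) *\<^sub>R b"] by simp
        ultimately have "R < norm x" "R < norm (x + (1 / Suc n) *\<^sub>R b)"
          using small by linarith+
        then have "x \<notin> K" "x + (1 / Suc n) *\<^sub>R b \<notin> K"
          using R[of x] R[of "x + (1 / Suc n) *\<^sub>R b"] by linarith+
        then show ?thesis using K(2) False by (simp add: d_def)
      qed
    qed
  next
    show "(\<lambda>x. G x \<bullet> b) \<in> borel_measurable lborel" by measurable
    show "d n \<in> borel_measurable lborel" for n unfolding d_def by measurable
  qed
  then have "(LINT x|lborel. G x \<bullet> b) = 0" unfolding d0 by (simp add: LIMSEQ_const_iff)
  moreover have "(LINT x|lborel. G x \<bullet> b) = (LINT x|lborel. G x) \<bullet> b"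
    by (rule integral_inner_left) (rule Gint)
  ultimately show "(LINT x|lborel. G x) \<bullet> b = 0 \<bullet> b" by (simp only: inner_zero_left)
qed

lemma integral_lebesgue_on_continuous_support:
  fixes f :: "'a::euclidean_space \<Rightarrow> 'b::euclidean_space"
  assumes "continuous_on UNIV f" "\<And>x. x \<notin> \<Omega> \<Longrightarrow> f x = 0" "open \<Omega>"
  shows "(LINT x|lebesgue_on \<Omega>. f x) = (LINT x|lborel. f x)"
proof -
  have "(LINT x|lebesgue_on \<Omega>. f x) = (LINT x|lebesgue. indicator \<Omega> x *\<^sub>R f x)"
    using assms(3) by (subst integral_restrict_space) auto
  also have "(\<lambda>x. indicator \<Omega> x *\<^sub>R f x) = f" using assms(2) by (auto simp: indicator_def fun_eq_iff)
  also have "(LINT x|lebesgue. f x) = (LINT x|lborel. f x)"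
    by (rule integral_completion) (use borel_measurable_continuous_onI[OF assms(1)] in simp)
  finally show ?thesis .
qed

text \<open>The gradient of the compactly supported product \<open>\<phi> x * \<psi> x\<close>
  integrates to \<open>0\<close>. So the classical gradient of a smooth function is a weak gradient
  in the sense of \<open>H1\<close>.\<close>

lemma smooth_integration_by_parts:
  assumes \<phi>: "smooth \<phi>" and \<psi>: "test_function \<Omega> \<psi>" and \<Omega>: "open \<Omega>"
  shows "(LINT x|lebesgue_on \<Omega>. \<phi> x *\<^sub>R gradient \<psi> x) = - (LINT x|lebesgue_on \<Omega>. \<psi> x *\<^sub>R gradient \<phi> x)"
proof -
  define K where "K = closure {x. \<psi> x \<noteq> 0}"
  have K: "compact K" "K \<subseteq> \<Omega>" "smooth \<psi>" using \<psi> by (auto simp: test_function_def K_def)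
  have \<psi>0: "\<psi> x = 0" if "x \<notin> K" for x using that closure_subset[of "{x. \<psi> x \<noteq> 0}"] unfolding K_def by auto
  note P = smooth_C1_gradient[OF \<phi>] and Q = smooth_C1_gradient[OF K(3)]
  have g0: "gradient \<psi> x = 0" if "x \<notin> K" for x
    using C1_gradient_support[OF Q compact_imp_closed[OF K(1)] \<psi>0 that] .
  have c1: "continuous_on UNIV (\<lambda>x. \<phi> x *\<^sub>R gradient \<psi> x)"
    by (rule continuous_on_scaleR[OF C1_gradient_continuous[OF P] C1_gradient_continuous_gradient[OF Q]])
  have c2: "continuous_on UNIV (\<lambda>x. \<psi> x *\<^sub>R gradient \<phi> x)"
    by (rule continuous_on_scaleR[OF C1_gradient_continuous[OF Q] C1_gradient_continuous_gradient[OF P]])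
  have i1: "integrable lborel (\<lambda>x. \<phi> x *\<^sub>R gradient \<psi> x)" and i2: "integrable lborel (\<lambda>x. \<psi> x *\<^sub>R gradient \<phi> x)"
    by (rule integrable_continuous_support[OF c1 K(1)], simp add: g0)
       (rule integrable_continuous_support[OF c2 K(1)], simp add: \<psi>0)
  have "(LINT x|lborel. \<phi> x *\<^sub>R gradient \<psi> x + \<psi> x *\<^sub>R gradient \<phi> x) = 0"
    by (rule integral_gradient_compact_support[OF C1_gradient_mult[OF P Q] K(1)]) (simp add: \<psi>0)
  then have "(LINT x|lborel. \<phi> x *\<^sub>R gradient \<psi> x) = - (LINT x|lborel. \<psi> x *\<^sub>R gradient \<phi> x)"
    using i1 i2 by (simp add: eq_neg_iff_add_eq_0)
  moreover have "(LINT x|lebesgue_on \<Omega>. \<phi> x *\<^sub>R gradient \<psi> x) = (LINT x|lborel. \<phi> x *\<^sub>R gradient \<psi> x)"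
    using K(2) g0 by (intro integral_lebesgue_on_continuous_support c1 \<Omega>) auto
  moreover have "(LINT x|lebesgue_on \<Omega>. \<psi> x *\<^sub>R gradient \<phi> x) = (LINT x|lborel. \<psi> x *\<^sub>R gradient \<phi> x)"
    using K(2) \<psi>0 by (intro integral_lebesgue_on_continuous_support c2 \<Omega>) auto
  ultimately show ?thesis by simp
qed

section \<open>Control by the gradient and the boundary values\<close>

lemma nn_integral_lborel_translation:
  fixes f :: "'a::euclidean_space \<Rightarrow> ennreal"
  assumes [measurable]: "f \<in> borel_measurable borel"
  shows "(\<integral>\<^sup>+x. f (x + c) \<partial>lborel) = (\<integral>\<^sup>+x. f x \<partial>lborel)"
proof -
  have "(\<integral>\<^sup>+x. f x \<partial>distr lborel borel ((+) c)) = (\<integral>\<^sup>+x. f (c + x) \<partial>lborel)"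
    by (rule nn_integral_distr) simp_all
  then show ?thesis by (simp only: lborel_distr_plus add.commute)
qed

lemma ennreal_le_suminf: "(f i :: ennreal) \<le> (\<Sum>i. f i)"
  using sum_le_suminf[OF summableI, of "{i}" f] by simp

lemma C1_gradient_along_line:
  assumes "C1_gradient f G"
  shows "((\<lambda>s. f (x + s *\<^sub>R h)) has_real_derivative G (x + s *\<^sub>R h) \<bullet> h) (at s)"
proof -
  have "((\<lambda>t. x + t *\<^sub>R h) has_derivative (\<lambda>t. t *\<^sub>R h)) (at s)"
    by (auto intro!: derivative_eq_intros)
  from has_derivative_compose[OF this C1_gradient_derivative[OF assms]]
  show ?thesis by (rule has_derivative_imp_has_field_derivative) simp
qed

lemma C1_gradient_increment_le:
  assumes f: "C1_gradient f G" and "a \<le> b"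
  shows "ennreal \<bar>f (x + b *\<^sub>R h) - f (x + a *\<^sub>R h)\<bar>
    \<le> (\<integral>\<^sup>+s. ennreal \<bar>G (x + s *\<^sub>R h) \<bullet> h\<bar> * indicator {a..b} s \<partial>lborel)"
proof -
  let ?g = "\<lambda>s. G (x + s *\<^sub>R h) \<bullet> h"
  have "continuous_on UNIV ?g"
    by (intro continuous_intros continuous_on_compose2[OF C1_gradient_continuous_gradient[OF f]]) auto
  then have c: "continuous_on {a..b} ?g" by (rule continuous_on_subset) simp
  have int: "integrable lborel (\<lambda>s. indicator {a..b} s *\<^sub>R ?g s)"
    using borel_integrable_atLeastAtMost'[OF c] by (simp add: set_integrable_def)
  have "(LINT s|lborel. indicator {a..b} s *\<^sub>R ?g s) = f (x + b *\<^sub>R h) - f (x + a *\<^sub>R h)"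
  proof (rule integral_FTC_atLeastAtMost[OF \<open>a \<le> b\<close> _ c])
    fix s
    show "((\<lambda>s. f (x + s *\<^sub>R h)) has_vector_derivative ?g s) (at s within {a..b})"
      by (rule has_vector_derivative_at_within)
         (rule C1_gradient_along_line[OF f, THEN has_real_derivative_iff_has_vector_derivative[THEN iffD1]])
  qed
  then have "ennreal \<bar>f (x + b *\<^sub>R h) - f (x + a *\<^sub>R h)\<bar> = ennreal (norm (LINT s|lborel. indicator {a..b} s *\<^sub>R ?g s))"
    by simp
  also have "\<dots> \<le> (\<integral>\<^sup>+s. ennreal (norm (indicator {a..b} s *\<^sub>R ?g s)) \<partial>lborel)"
    by (rule integral_norm_bound_ennreal[OF int])
  also have "\<dots> = (\<integral>\<^sup>+s. ennreal \<bar>?g s\<bar> * indicator {a..b} s \<partial>lborel)"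
    by (intro nn_integral_cong) (auto simp: indicator_def)
  finally show ?thesis .
qed

text \<open>\<open>t\<close> is the first time at which the segment from \<open>x\<close> towards
  \<open>x + h\<close> is outside \<open>\<Omega>\<close>. Up to then it runs inside
  \<open>\<Omega>\<close>, so only the gradient on \<open>\<Omega>\<close> contributes to the
  increment of \<open>f\<close>.\<close>

lemma boundary_crossing:
  assumes f: "C1_gradient f G" and f0: "\<And>x. 0 \<le> f x" and \<Omega>: "open \<Omega>" "x \<in> \<Omega>" "x + h \<notin> \<Omega>"
  shows "\<exists>t\<in>{0..1}. x + t *\<^sub>R h \<in> frontier \<Omega> \<and> ennreal (f x) \<le> ennreal (f (x + t *\<^sub>R h))
     + (\<integral>\<^sup>+s. ennreal (norm (G (x + s *\<^sub>R h)) * norm h) * indicator \<Omega> (x + s *\<^sub>R h) * indicator {0..1} s \<partial>lborel)"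
proof -
  define T where "T = {t\<in>{0..1}. x + t *\<^sub>R h \<in> - \<Omega>}"
  have T_eq: "T = {0..1} \<inter> (\<lambda>t. x + t *\<^sub>R h) -` (- \<Omega>)" by (auto simp: T_def)
  have "closed T" unfolding T_eq
    by (intro closed_Int closed_vimage continuous_intros) (use \<Omega> in auto)
  moreover have "T \<noteq> {}" using \<Omega> by (auto simp: T_def intro!: exI[of _ 1])
  moreover have "bdd_below T" by (auto simp: T_def intro!: bdd_belowI[of _ 0])
  ultimately have tT: "Inf T \<in> T" by (intro closed_contains_Inf)
  define t where "t = Inf T"
  have t: "0 \<le> t" "t \<le> 1" "x + t *\<^sub>R h \<notin> \<Omega>" using tT by (auto simp: t_def T_def)
  have less: "x + s *\<^sub>R h \<in> \<Omega>" if "0 \<le> s" "s < t" for s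
  proof (rule ccontr)
    assume "x + s *\<^sub>R h \<notin> \<Omega>"
    then have "s \<in> T" using that t by (auto simp: T_def)
    then have "t \<le> s" unfolding t_def by (rule cInf_lower) fact
    with that show False by simp
  qed
  have "t \<noteq> 0" using t(3) \<Omega>(2) by (intro notI) simp
  then have t0: "0 < t" using t(1) by simp
  have "(\<lambda>s. x + s *\<^sub>R h) ` {0..<t} \<subseteq> closure \<Omega>"
    using less closure_subset[of \<Omega>] by auto
  then have "(\<lambda>s. x + s *\<^sub>R h) ` closure {0..<t} \<subseteq> closure \<Omega>"
    by (intro image_closure_subset continuous_intros) auto
  moreover have "t \<in> closure {0..<t}" using t0 by simp
  ultimately have "x + t *\<^sub>R h \<in> closure \<Omega>" by blast
  then have fr: "x + t *\<^sub>R h \<in> frontier \<Omega>" using t(3) \<Omega>(1) by (simp add: frontier_def interior_open)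
  have "ennreal (f x) \<le> ennreal (f (x + t *\<^sub>R h) + \<bar>f (x + t *\<^sub>R h) - f (x + 0 *\<^sub>R h)\<bar>)"
    by (intro ennreal_leI) simp
  also have "\<dots> = ennreal (f (x + t *\<^sub>R h)) + ennreal \<bar>f (x + t *\<^sub>R h) - f (x + 0 *\<^sub>R h)\<bar>"
    by (rule ennreal_plus[OF f0]) simp
  also have "ennreal \<bar>f (x + t *\<^sub>R h) - f (x + 0 *\<^sub>R h)\<bar>
      \<le> (\<integral>\<^sup>+s. ennreal \<bar>G (x + s *\<^sub>R h) \<bullet> h\<bar> * indicator {0..t} s \<partial>lborel)"
    by (rule C1_gradient_increment_le[OF f t(1)])
  also have "\<dots> \<le> (\<integral>\<^sup>+s. ennreal (norm (G (x + s *\<^sub>R h)) * norm h) * indicator \<Omega> (x + s *\<^sub>R h) * indicator {0..1} s \<partial>lborel)"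
  \<comment> \<open>At \<open>s = t\<close> the segment is already outside \<open>\<Omega>\<close>,
    so the integrands are compared off this null set.\<close>
  proof (rule nn_integral_mono_AE, use AE_lborel_singleton[of t] in eventually_elim)
    fix s assume "s \<noteq> t"
    then have "s \<in> {0..t} \<Longrightarrow> x + s *\<^sub>R h \<in> \<Omega> \<and> s \<in> {0..1}" using less t by auto
    then show "ennreal \<bar>G (x + s *\<^sub>R h) \<bullet> h\<bar> * indicator {0..t} s
       \<le> ennreal (norm (G (x + s *\<^sub>R h)) * norm h) * indicator \<Omega> (x + s *\<^sub>R h) * indicator {0..1} s"
      by (cases "s \<in> {0..t}") (auto intro!: ennreal_leI Cauchy_Schwarz_ineq2)
  qed
  finally show ?thesis using fr t by (auto simp: add_left_mono)
qed

text \<open>The step function with value \<open>real k * e\<close> on the layer \<open>A k\<close>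
  lies below \<open>f\<close>, because the layers are disjoint.\<close>

lemma layers_le_nn_integral:
  fixes f :: "'a::euclidean_space \<Rightarrow> real"
  assumes [measurable]: "f \<in> borel_measurable borel" "S \<in> sets borel"
    and f0: "\<And>x. 0 \<le> f x" and e: "0 < e"
  defines "A \<equiv> \<lambda>k::nat. {y\<in>S. real k * e \<le> f y \<and> f y < real (Suc k) * e}"
  shows "(\<Sum>k. ennreal (real k * e) * emeasure (hausdorff_measure n) (A k))
     \<le> (\<integral>\<^sup>+y\<in>S. ennreal (f y) \<partial>hausdorff_measure n)"
proof -
  have meas: "A k \<in> sets borel" for k
  proof -
    have "A k = S \<inter> {y\<in>space borel. real k * e \<le> f y \<and> f y < real (Suc k) * e}" by (auto simp: A_def)
    then show ?thesis by simp
  qed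
  have disj: "disjoint_family A"
    unfolding disjoint_family_on_def
  proof safe
    fix i j y assume ij: "i \<noteq> j" and y: "y \<in> A i" "y \<in> A j"
    from y have "real i * e < real (Suc j) * e" "real j * e < real (Suc i) * e"
      by (auto simp: A_def intro: le_less_trans)
    with e have "i < Suc j" "j < Suc i" by (simp_all only: mult_less_cancel_right_pos of_nat_less_iff)
    with ij show "y \<in> {}" by simp
  qed
  have "(\<Sum>k. ennreal (real k * e) * emeasure (hausdorff_measure n) (A k))
     = (\<Sum>k. \<integral>\<^sup>+y\<in>A k. ennreal (real k * e) \<partial>hausdorff_measure n)"
    using meas by (intro suminf_cong) (simp add: nn_integral_cmult_indicator)
  also have "\<dots> = (\<integral>\<^sup>+y. (\<Sum>k. ennreal (real k * e) * indicator (A k) y) \<partial>hausdorff_measure n)"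
    using meas by (intro nn_integral_suminf[symmetric])
       (simp add: measurable_cong_sets[OF sets_hausdorff_measure refl])
  also have "\<dots> \<le> (\<integral>\<^sup>+y\<in>S. ennreal (f y) \<partial>hausdorff_measure n)"
  proof (rule nn_integral_mono)
    fix y
    show "(\<Sum>k. ennreal (real k * e) * indicator (A k) y) \<le> ennreal (f y) * indicator S y"
    proof (cases "\<exists>k. y \<in> A k")
      case True
      then obtain k where k: "y \<in> A k" by blast
      have "(\<Sum>k. ennreal (real k * e) * indicator (A k) y) = ennreal (real k * e)"
        by (rule suminf_cmult_indicator[OF disj k])
      then show ?thesis using k by (auto simp: A_def intro!: ennreal_leI)
    next
      case False then show ?thesis by simp
    qed
  qed
  finally show ?thesis .
qed

text \<open>The frontier is cut into layers on which \<open>f\<close> varies by at most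
  \<open>e\<close>. A point moved out of \<open>\<Omega>\<close> lies in the shadow of some layer
  \<open>A k\<close>, and there \<open>f x\<close> is at most \<open>real k * e + e\<close> plus the
  gradient integral along the segment. Volumes of shadows are bounded by surface measures of layers,
  and the layers add up to the boundary integral. The extra \<open>e\<close> costs at most
  \<open>e\<close>, as the volume is at most \<open>1\<close>.\<close>

lemma nn_integral_escaping_le:
  fixes f :: "'a::euclidean_space \<Rightarrow> real"
  assumes f: "C1_gradient f G" and f0: "\<And>x. 0 \<le> f x"
    and \<Omega>: "open \<Omega>" "emeasure lborel \<Omega> \<le> 1" and h: "norm h \<le> R"
  shows "(\<integral>\<^sup>+x. ennreal (f x) * indicator \<Omega> x * indicator (- \<Omega>) (x + h) \<partial>lborel)
    \<le> ennreal R * (\<integral>\<^sup>+x\<in>\<Omega>. ennreal (norm (G x)) \<partial>lborel)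
     + ennreal (shadow_const TYPE('a) R) * (\<integral>\<^sup>+y. ennreal (f y) \<partial>surface_measure \<Omega>)"
    (is "?L \<le> ?I + ?C * ?B")
proof (rule ennreal_le_epsilon)
  fix e :: real assume e: "0 < e"
  have [measurable]: "f \<in> borel_measurable borel" "G \<in> borel_measurable borel" "\<Omega> \<in> sets borel"
    using f \<Omega> by (auto dest: C1_gradient_borel)
  define A where "A k = {y\<in>frontier \<Omega>. real k * e \<le> f y \<and> f y < real (Suc k) * e}" for k :: nat
  have A_meas: "A k \<in> sets borel" for k
  proof -
    have "A k = frontier \<Omega> \<inter> {y\<in>space borel. real k * e \<le> f y \<and> f y < real (Suc k) * e}" by (auto simp: A_def)
    then show ?thesis by simp
  qed
  have "\<exists>W. W \<in> sets borel \<and> shadow h (A k) \<subseteq> W \<and>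
    emeasure lborel W \<le> ?C * emeasure (hausdorff_measure (DIM('a) - 1)) (A k)" for k
    using shadow_cover[OF h, of "A k"] A_meas[of k] by (metis emeasure_hausdorff_measure)
  then obtain W where W: "\<And>k. W k \<in> sets borel" "\<And>k. shadow h (A k) \<subseteq> W k"
    "\<And>k. emeasure lborel (W k) \<le> ?C * emeasure (hausdorff_measure (DIM('a) - 1)) (A k)" by metis
  note [measurable] = W(1)
  define J where "J x = (\<integral>\<^sup>+s. ennreal (norm (G (x + s *\<^sub>R h)) * norm h) * indicator \<Omega> (x + s *\<^sub>R h) * indicator {0..1} s \<partial>lborel)" for x
  have [measurable]: "J \<in> borel_measurable borel" unfolding J_def by measurable
  have "?L \<le> (\<integral>\<^sup>+x. J x + (ennreal e * indicator \<Omega> x + (\<Sum>k. ennreal (real k * e) * indicator (W k) x)) \<partial>lborel)"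
  proof (rule nn_integral_mono)
    fix x
    show "ennreal (f x) * indicator \<Omega> x * indicator (- \<Omega>) (x + h)
       \<le> J x + (ennreal e * indicator \<Omega> x + (\<Sum>k. ennreal (real k * e) * indicator (W k) x))"
    proof (cases "x \<in> \<Omega> \<and> x + h \<notin> \<Omega>")
      case True
      then obtain t where t: "t \<in> {0..1}" "x + t *\<^sub>R h \<in> frontier \<Omega>" "ennreal (f x) \<le> ennreal (f (x + t *\<^sub>R h)) + J x"
        using boundary_crossing[OF f f0 \<Omega>(1), of x h] unfolding J_def by blast
      define k where "k = nat \<lfloor>f (x + t *\<^sub>R h) / e\<rfloor>"
      have k0: "0 \<le> f (x + t *\<^sub>R h) / e" using f0 e by simp
      have "real k \<le> f (x + t *\<^sub>R h) / e" "f (x + t *\<^sub>R h) / e < real (Suc k)"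
        unfolding k_def using k0 by (simp_all add: of_nat_nat) linarith+
      then have k: "real k * e \<le> f (x + t *\<^sub>R h)" "f (x + t *\<^sub>R h) < real (Suc k) * e"
        using e by (simp_all add: field_simps)
      then have "x + t *\<^sub>R h \<in> A k" using t(2) by (simp add: A_def)
      then have "x \<in> shadow h (A k)" using t(1) by (auto simp: shadow_def)
      then have xW: "x \<in> W k" using W(2) by blast
      have "ennreal (real k * e) = ennreal (real k * e) * indicator (W k) x" using xW by simp
      also have "\<dots> \<le> (\<Sum>k. ennreal (real k * e) * indicator (W k) x)"
        by (rule ennreal_le_suminf)
      finally have le: "ennreal (real k * e) \<le> (\<Sum>k. ennreal (real k * e) * indicator (W k) x)" .
      have "ennreal (f (x + t *\<^sub>R h)) \<le> ennreal (e + real k * e)"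
        using k by (intro ennreal_leI) (simp add: algebra_simps)
      also have "\<dots> = ennreal e + ennreal (real k * e)" using e by (intro ennreal_plus) auto
      also have "\<dots> \<le> ennreal e + (\<Sum>k. ennreal (real k * e) * indicator (W k) x)"
        using le by (rule add_left_mono)
      finally have "ennreal (f (x + t *\<^sub>R h)) + J x \<le> J x + (ennreal e + (\<Sum>k. ennreal (real k * e) * indicator (W k) x))"
        by (subst add.commute) (rule add_left_mono)
      with t(3) have "ennreal (f x) \<le> J x + (ennreal e + (\<Sum>k. ennreal (real k * e) * indicator (W k) x))"
        by (rule order_trans)
      with True show ?thesis by simp
    qed auto
  qed
  also have "\<dots> = (\<integral>\<^sup>+x. J x \<partial>lborel)
       + (\<integral>\<^sup>+x. ennreal e * indicator \<Omega> x + (\<Sum>k. ennreal (real k * e) * indicator (W k) x) \<partial>lborel)"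
    by (rule nn_integral_add) measurable
  also have "(\<integral>\<^sup>+x. ennreal e * indicator \<Omega> x + (\<Sum>k. ennreal (real k * e) * indicator (W k) x) \<partial>lborel)
     = ((\<integral>\<^sup>+x\<in>\<Omega>. ennreal e \<partial>lborel)
       + (\<integral>\<^sup>+x. (\<Sum>k. ennreal (real k * e) * indicator (W k) x) \<partial>lborel))"
    by (rule nn_integral_add) measurable
  also have "(\<integral>\<^sup>+x. J x \<partial>lborel) \<le> ?I"
  proof -
    have "(\<integral>\<^sup>+x. J x \<partial>lborel) = (\<integral>\<^sup>+s. \<integral>\<^sup>+x. ennreal (norm (G (x + s *\<^sub>R h)) * norm h) * indicator \<Omega> (x + s *\<^sub>R h) * indicator {0..1} s \<partial>lborel \<partial>lborel)"
      unfolding J_def by (rule lborel_pair.Fubini') measurable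
    \<comment> \<open>For fixed \<open>s\<close> the translation by \<open>s *\<^sub>R h\<close>
      removes the dependence on \<open>s\<close>.\<close>
    also have "\<dots> = (\<integral>\<^sup>+s. (\<integral>\<^sup>+x\<in>\<Omega>. ennreal (norm (G x) * norm h) \<partial>lborel) * indicator {0..1::real} s \<partial>lborel)"
    proof (rule nn_integral_cong)
      fix s :: real
      have "(\<integral>\<^sup>+x. ennreal (norm (G (x + s *\<^sub>R h)) * norm h) * indicator \<Omega> (x + s *\<^sub>R h) * indicator {0..1} s \<partial>lborel)
        = (\<integral>\<^sup>+x. ennreal (norm (G (x + s *\<^sub>R h)) * norm h) * indicator \<Omega> (x + s *\<^sub>R h) \<partial>lborel) * indicator {0..1} s"
        by (rule nn_integral_multc) measurable
      also have "(\<integral>\<^sup>+x. ennreal (norm (G (x + s *\<^sub>R h)) * norm h) * indicator \<Omega> (x + s *\<^sub>R h) \<partial>lborel)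
         = (\<integral>\<^sup>+x\<in>\<Omega>. ennreal (norm (G x) * norm h) \<partial>lborel)"
        by (rule nn_integral_lborel_translation[where f = "\<lambda>x. ennreal (norm (G x) * norm h) * indicator \<Omega> x"]) measurable
      finally show "(\<integral>\<^sup>+x. ennreal (norm (G (x + s *\<^sub>R h)) * norm h) * indicator \<Omega> (x + s *\<^sub>R h) * indicator {0..1} s \<partial>lborel)
        = (\<integral>\<^sup>+x\<in>\<Omega>. ennreal (norm (G x) * norm h) \<partial>lborel) * indicator {0..1} s" .
    qed
    also have "\<dots> = (\<integral>\<^sup>+x\<in>\<Omega>. ennreal (norm (G x) * norm h) \<partial>lborel)"
      by (simp add: nn_integral_cmult_indicator)
    also have "\<dots> \<le> (\<integral>\<^sup>+x. ennreal R * (ennreal (norm (G x)) * indicator \<Omega> x) \<partial>lborel)"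
    proof (rule nn_integral_mono)
      fix x
      have "ennreal (norm (G x) * norm h) \<le> ennreal (R * norm (G x))"
        using h by (intro ennreal_leI) (simp add: mult.commute mult_right_mono)
      also have "\<dots> = ennreal R * ennreal (norm (G x))" by (rule ennreal_mult'') simp
      finally show "ennreal (norm (G x) * norm h) * indicator \<Omega> x \<le> ennreal R * (ennreal (norm (G x)) * indicator \<Omega> x)"
        by (cases "x \<in> \<Omega>") auto
    qed
    also have "\<dots> = ?I" by (rule nn_integral_cmult) measurable
    finally show ?thesis .
  qed
  also have "(\<integral>\<^sup>+x\<in>\<Omega>. ennreal e \<partial>lborel) \<le> ennreal e"
    using mult_left_mono[OF \<Omega>(2), of "ennreal e"] by (simp add: nn_integral_cmult_indicator)
  also have "(\<integral>\<^sup>+x. (\<Sum>k. ennreal (real k * e) * indicator (W k) x) \<partial>lborel) \<le> ?C * ?B"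
  proof -
    have "(\<integral>\<^sup>+x. (\<Sum>k. ennreal (real k * e) * indicator (W k) x) \<partial>lborel)
       = (\<Sum>k. ennreal (real k * e) * emeasure lborel (W k))"
      by (subst nn_integral_suminf) (auto simp: nn_integral_cmult_indicator)
    also have "\<dots> \<le> (\<Sum>k. ?C * (ennreal (real k * e) * emeasure (hausdorff_measure (DIM('a) - 1)) (A k)))"
    proof (intro suminf_le)
      fix k
      show "ennreal (real k * e) * emeasure lborel (W k)
         \<le> ?C * (ennreal (real k * e) * emeasure (hausdorff_measure (DIM('a) - 1)) (A k))"
        using mult_left_mono[OF W(3)[of k], of "ennreal (real k * e)"] by (simp add: mult_ac)
    qed auto
    also have "\<dots> = ?C * (\<Sum>k. ennreal (real k * e) * emeasure (hausdorff_measure (DIM('a) - 1)) (A k))" by simp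
    also have "\<dots> \<le> ?C * (\<integral>\<^sup>+y\<in>frontier \<Omega>. ennreal (f y) \<partial>hausdorff_measure (DIM('a) - 1))"
      unfolding A_def using f0 e by (intro mult_left_mono layers_le_nn_integral) auto
    also have "(\<integral>\<^sup>+y\<in>frontier \<Omega>. ennreal (f y) \<partial>hausdorff_measure (DIM('a) - 1)) = ?B"
      unfolding surface_measure_def by (subst nn_integral_restrict_space) auto
    finally show ?thesis .
  qed
  finally show "?L \<le> ?I + ?C * ?B + ennreal e" by (simp add: add_ac add_mono)
qed

text \<open>By \<open>ge1\<close> the measure of the translations that move \<open>x\<close> out of
  \<open>\<Omega>\<close> can be inserted as a factor. Tonelli's theorem then leaves, for each fixed
  \<open>h\<close>, the integral bounded in \<open>nn_integral_escaping_le\<close>, and the volume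
  of the ball appears as the constant.\<close>

lemma nn_integral_le_gradient_boundary:
  fixes f :: "'a::euclidean_space \<Rightarrow> real"
  assumes f: "C1_gradient f G" and f0: "\<And>x. 0 \<le> f x"
    and \<Omega>: "open \<Omega>" "emeasure lborel \<Omega> \<le> 1" and R: "2 \<le> emeasure lborel (ball (0::'a) R)"
  shows "(\<integral>\<^sup>+x\<in>\<Omega>. ennreal (f x) \<partial>lborel)
    \<le> emeasure lborel (ball (0::'a) R) * (ennreal R * (\<integral>\<^sup>+x\<in>\<Omega>. ennreal (norm (G x)) \<partial>lborel)
     + ennreal (shadow_const TYPE('a) R) * (\<integral>\<^sup>+y. ennreal (f y) \<partial>surface_measure \<Omega>))"
proof -
  have [measurable]: "f \<in> borel_measurable borel" "G \<in> borel_measurable borel" "\<Omega> \<in> sets borel"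
    using f \<Omega> by (auto dest: C1_gradient_borel)
  let ?B = "ball (0::'a) R"
  have [measurable]: "?B \<in> sets borel" by simp
  have ge1: "1 \<le> (\<integral>\<^sup>+h. indicator (- \<Omega>) (x + h) * indicator ?B h \<partial>lborel)" for x
  proof -
    have "emeasure lborel ?B = (\<integral>\<^sup>+h. indicator ?B h \<partial>lborel)" by simp
    also have "\<dots> \<le> (\<integral>\<^sup>+h. indicator \<Omega> (h + x) + indicator (- \<Omega>) (x + h) * indicator ?B h \<partial>lborel)"
      by (intro nn_integral_mono) (auto simp: indicator_def add.commute)
    also have "\<dots> = (\<integral>\<^sup>+h. indicator \<Omega> (h + x) \<partial>lborel) + (\<integral>\<^sup>+h. indicator (- \<Omega>) (x + h) * indicator ?B h \<partial>lborel)"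
      by (rule nn_integral_add) measurable
    also have "(\<integral>\<^sup>+h. indicator \<Omega> (h + x) \<partial>lborel) = emeasure lborel \<Omega>"
      by (subst nn_integral_lborel_translation[where f = "indicator \<Omega>"]) auto
    finally have "2 \<le> emeasure lborel \<Omega> + (\<integral>\<^sup>+h. indicator (- \<Omega>) (x + h) * indicator ?B h \<partial>lborel)"
      using R by (rule order_trans[rotated])
    also have "\<dots> \<le> 1 + (\<integral>\<^sup>+h. indicator (- \<Omega>) (x + h) * indicator ?B h \<partial>lborel)"
      using \<Omega>(2) by (rule add_right_mono)
    finally have "1 + 1 \<le> 1 + (\<integral>\<^sup>+h. indicator (- \<Omega>) (x + h) * indicator ?B h \<partial>lborel)"
      by (simp only: one_add_one)
    then show ?thesis by (subst (asm) ennreal_add_left_cancel_le) auto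
  qed
  have "(\<integral>\<^sup>+x\<in>\<Omega>. ennreal (f x) \<partial>lborel)
     \<le> (\<integral>\<^sup>+x. (ennreal (f x) * indicator \<Omega> x) * (\<integral>\<^sup>+h. indicator (- \<Omega>) (x + h) * indicator ?B h \<partial>lborel) \<partial>lborel)"
    using mult_left_mono[OF ge1] by (intro nn_integral_mono) fastforce
  also have "\<dots> = (\<integral>\<^sup>+x. \<integral>\<^sup>+h. (ennreal (f x) * indicator \<Omega> x * indicator (- \<Omega>) (x + h)) * indicator ?B h \<partial>lborel \<partial>lborel)"
    by (subst nn_integral_cmult[symmetric]) (auto simp: mult.assoc)
  also have "\<dots> = (\<integral>\<^sup>+h. \<integral>\<^sup>+x. (ennreal (f x) * indicator \<Omega> x * indicator (- \<Omega>) (x + h)) * indicator ?B h \<partial>lborel \<partial>lborel)"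
    by (rule lborel_pair.Fubini') measurable
  also have "\<dots> = (\<integral>\<^sup>+h. (\<integral>\<^sup>+x. ennreal (f x) * indicator \<Omega> x * indicator (- \<Omega>) (x + h) \<partial>lborel) * indicator ?B h \<partial>lborel)"
    by (intro nn_integral_cong nn_integral_multc) measurable
  also have "\<dots> \<le> (\<integral>\<^sup>+h. (ennreal R * (\<integral>\<^sup>+x\<in>\<Omega>. ennreal (norm (G x)) \<partial>lborel)
     + ennreal (shadow_const TYPE('a) R) * (\<integral>\<^sup>+y. ennreal (f y) \<partial>surface_measure \<Omega>)) * indicator ?B h \<partial>lborel)"
  proof (rule nn_integral_mono)
    fix h :: 'a
    show "(\<integral>\<^sup>+x. ennreal (f x) * indicator \<Omega> x * indicator (- \<Omega>) (x + h) \<partial>lborel) * indicator ?B h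
      \<le> (ennreal R * (\<integral>\<^sup>+x\<in>\<Omega>. ennreal (norm (G x)) \<partial>lborel)
     + ennreal (shadow_const TYPE('a) R) * (\<integral>\<^sup>+y. ennreal (f y) \<partial>surface_measure \<Omega>)) * indicator ?B h"
      using nn_integral_escaping_le[OF f f0 \<Omega>, of h R] by (cases "h \<in> ?B") auto
  qed
  also have "\<dots> = (ennreal R * (\<integral>\<^sup>+x\<in>\<Omega>. ennreal (norm (G x)) \<partial>lborel)
     + ennreal (shadow_const TYPE('a) R) * (\<integral>\<^sup>+y. ennreal (f y) \<partial>surface_measure \<Omega>)) * emeasure lborel ?B"
    by (rule nn_integral_cmult_indicator) simp
  finally show ?thesis by (simp add: mult.commute)
qed

section \<open>The trace relation\<close>

lemma nn_integral_lebesgue_on_eq: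
  assumes "open \<Omega>"
  shows "(\<integral>\<^sup>+x. f x \<partial>lebesgue_on \<Omega>) = (\<integral>\<^sup>+x\<in>\<Omega>. f x \<partial>lborel)"
  using assms by (subst nn_integral_restrict_space) (auto simp: nn_integral_completion)

lemma borel_measurable_lebesgue_on_continuous:
  fixes f :: "'a::euclidean_space \<Rightarrow> 'b::euclidean_space"
  assumes "continuous_on UNIV f"
  shows "f \<in> borel_measurable (lebesgue_on \<Omega>)"
  by (intro measurable_restrict_space1 measurable_completion) (use borel_measurable_continuous_onI[OF assms] in simp)

lemma borel_measurable_surface_continuous:
  fixes f :: "'a::euclidean_space \<Rightarrow> 'b::euclidean_space"
  assumes "continuous_on UNIV f"
  shows "f \<in> borel_measurable (surface_measure \<Omega>)"
  unfolding surface_measure_def using borel_measurable_continuous_onI[OF assms]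
  by (intro measurable_restrict_space1) (simp add: measurable_cong_sets[OF sets_hausdorff_measure refl])

lemma emeasure_lebesgue_on_bounded:
  fixes \<Omega> :: "'a::euclidean_space set"
  assumes "open \<Omega>" "bounded \<Omega>"
  shows "emeasure (lebesgue_on \<Omega>) (space (lebesgue_on \<Omega>)) < top"
  using assms emeasure_bounded_finite[OF assms(2)]
  by (simp add: emeasure_restrict_space space_restrict_space)

lemma L2_continuous_bounded:
  fixes f :: "'a::euclidean_space \<Rightarrow> 'b::euclidean_space"
  assumes "continuous_on UNIV f" "open \<Omega>" "bounded \<Omega>"
  shows "L2 (lebesgue_on \<Omega>) f"
proof -
  have "compact (f ` closure \<Omega>)"
    using assms by (intro compact_continuous_image continuous_on_subset[OF assms(1)]) auto
  then obtain B where B: "\<And>x. x \<in> closure \<Omega> \<Longrightarrow> norm (f x) \<le> B"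
    using compact_imp_bounded by (force simp: bounded_iff)
  interpret finite_measure "lebesgue_on \<Omega>"
    using emeasure_lebesgue_on_bounded[OF assms(2,3)] by (intro finite_measureI) auto
  show ?thesis
  proof (rule L2_bound[OF borel_measurable_lebesgue_on_continuous[OF assms(1)]])
    show "integrable (lebesgue_on \<Omega>) (\<lambda>_. B\<^sup>2)" by simp
    show "(norm (f x))\<^sup>2 \<le> B\<^sup>2" if "x \<in> space (lebesgue_on \<Omega>)" for x
      using that B[of x] closure_subset[of \<Omega>] by (intro power_mono) auto
  qed
qed

lemma L2_smooth:
  assumes "smooth \<phi>" "open \<Omega>" "bounded \<Omega>"
  shows "L2 (lebesgue_on \<Omega>) \<phi>" "L2 (lebesgue_on \<Omega>) (gradient \<phi>)"
  using smooth_C1_gradient[OF assms(1)] assms(2,3)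
  by (auto intro!: L2_continuous_bounded dest: C1_gradient_continuous C1_gradient_continuous_gradient)

text \<open>A common shift past the finitely many terms that might fail to be square integrable, in
  particular on a boundary of infinite measure, makes all three convergences hold in the sense of
  \<open>L2_tendsto\<close>.\<close>

lemma H1_trace_approx:
  assumes "H1_trace \<Omega> u g t"
  obtains \<phi> where "\<And>n::nat. smooth (\<phi> n)" "L2_tendsto (lebesgue_on \<Omega>) \<phi> u"
    "L2_tendsto (lebesgue_on \<Omega>) (\<lambda>n. gradient (\<phi> n)) g" "L2_tendsto (surface_measure \<Omega>) \<phi> t"
proof -
  obtain \<phi> where \<phi>: "\<And>n::nat. smooth (\<phi> n)"
    "(\<lambda>n. \<integral>\<^sup>+x. ennreal ((\<phi> n x - u x)\<^sup>2) \<partial>lebesgue_on \<Omega>) \<longlonglongrightarrow> 0"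
    "(\<lambda>n. \<integral>\<^sup>+x. ennreal ((norm (gradient (\<phi> n) x - g x))\<^sup>2) \<partial>lebesgue_on \<Omega>) \<longlonglongrightarrow> 0"
    "(\<lambda>n. \<integral>\<^sup>+x. ennreal ((\<phi> n x - t x)\<^sup>2) \<partial>surface_measure \<Omega>) \<longlonglongrightarrow> 0"
    using assms unfolding H1_trace_def by blast
  have L: "L2 (lebesgue_on \<Omega>) u" "L2 (lebesgue_on \<Omega>) g" "L2 (surface_measure \<Omega>) t"
    using assms by (auto simp: H1_trace_def H1_def)
  note c = smooth_C1_gradient[OF \<phi>(1), THEN C1_gradient_continuous]
  note cg = smooth_C1_gradient[OF \<phi>(1), THEN C1_gradient_continuous_gradient]
  obtain N1 where N1: "\<forall>m\<ge>N1. L2_tendsto (lebesgue_on \<Omega>) (\<lambda>n. \<phi> (n + m)) u"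
    using nn_integral_tendsto_imp_L2_tendsto[where f = \<phi>, OF borel_measurable_lebesgue_on_continuous[OF c] L(1)] \<phi>(2) by auto
  obtain N2 where N2: "\<forall>m\<ge>N2. L2_tendsto (lebesgue_on \<Omega>) (\<lambda>n. gradient (\<phi> (n + m))) g"
    using nn_integral_tendsto_imp_L2_tendsto[where f = "\<lambda>n. gradient (\<phi> n)", OF borel_measurable_lebesgue_on_continuous[OF cg] L(2)] \<phi>(3) by auto
  obtain N3 where N3: "\<forall>m\<ge>N3. L2_tendsto (surface_measure \<Omega>) (\<lambda>n. \<phi> (n + m)) t"
    using nn_integral_tendsto_imp_L2_tendsto[where f = \<phi>, OF borel_measurable_surface_continuous[OF c] L(3)] \<phi>(4) by auto
  show ?thesis
    by (rule that[of "\<lambda>n. \<phi> (n + (N1 + N2 + N3))"]) (use \<phi>(1) N1 N2 N3 in auto)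
qed

text \<open>The trace relation is closed: integration by parts holds for every
  \<open>\<phi> n\<close>, and both of its sides are continuous under convergence in L2.\<close>

lemma L2_tendsto_H1_trace:
  assumes \<Omega>: "open \<Omega>" "bounded \<Omega>" and \<phi>: "\<And>n. smooth (\<phi> n)" "L2_tendsto (lebesgue_on \<Omega>) \<phi> u"
    "L2_tendsto (lebesgue_on \<Omega>) (\<lambda>n. gradient (\<phi> n)) g" "L2_tendsto (surface_measure \<Omega>) \<phi> t"
  shows "H1_trace \<Omega> u g t"
proof -
  have L: "L2 (lebesgue_on \<Omega>) u" "L2 (lebesgue_on \<Omega>) g" "L2 (surface_measure \<Omega>) t"
    and L\<phi>: "\<And>n. L2 (lebesgue_on \<Omega>) (\<phi> n)" "\<And>n. L2 (lebesgue_on \<Omega>) (gradient (\<phi> n))"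
    using \<phi> by (auto simp: L2_tendsto_def)
  have "(LINT x|lebesgue_on \<Omega>. u x *\<^sub>R gradient \<psi> x) = - (LINT x|lebesgue_on \<Omega>. \<psi> x *\<^sub>R g x)"
    if \<psi>: "test_function \<Omega> \<psi>" for \<psi>
  \<comment> \<open>Componentwise, so that both sides become integrals of inner products and
    \<open>L2_tendsto_inner\<close> applies.\<close>
  proof (rule euclidean_eqI)
    fix b :: 'a assume "b \<in> Basis"
    have sm: "smooth \<psi>" using \<psi> by (simp add: test_function_def)
    note L\<psi> = L2_smooth[OF sm \<Omega>]
    have cb: "continuous_on UNIV (\<lambda>x. gradient \<psi> x \<bullet> b)"
      using C1_gradient_continuous_gradient[OF smooth_C1_gradient[OF sm]] by (intro continuous_intros)
    have cb': "continuous_on UNIV (\<lambda>x. \<psi> x *\<^sub>R b)"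
      using C1_gradient_continuous[OF smooth_C1_gradient[OF sm]] by (intro continuous_intros)
    have 1: "(\<lambda>n. LINT x|lebesgue_on \<Omega>. \<phi> n x \<bullet> (gradient \<psi> x \<bullet> b)) \<longlonglongrightarrow> (LINT x|lebesgue_on \<Omega>. u x \<bullet> (gradient \<psi> x \<bullet> b))"
      by (intro L2_tendsto_inner[OF \<phi>(2)] L2_tendsto_const L2_continuous_bounded cb \<Omega>)
    have 2: "(\<lambda>n. LINT x|lebesgue_on \<Omega>. gradient (\<phi> n) x \<bullet> (\<psi> x *\<^sub>R b)) \<longlonglongrightarrow> (LINT x|lebesgue_on \<Omega>. g x \<bullet> (\<psi> x *\<^sub>R b))"
      by (intro L2_tendsto_inner[OF \<phi>(3)] L2_tendsto_const L2_continuous_bounded cb' \<Omega>)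
    have l: "(LINT x|lebesgue_on \<Omega>. v x *\<^sub>R gradient \<psi> x) \<bullet> b = (LINT x|lebesgue_on \<Omega>. v x \<bullet> (gradient \<psi> x \<bullet> b))"
      if "L2 (lebesgue_on \<Omega>) v" for v
      by (subst integral_inner_left[symmetric]) (use L2_integrable_scaleR[OF that L\<psi>(2)] in simp_all)
    have r: "(LINT x|lebesgue_on \<Omega>. \<psi> x *\<^sub>R h x) \<bullet> b = (LINT x|lebesgue_on \<Omega>. h x \<bullet> (\<psi> x *\<^sub>R b))"
      if "L2 (lebesgue_on \<Omega>) h" for h
      by (subst integral_inner_left[symmetric]) (use L2_integrable_scaleR[OF L\<psi>(1) that] in simp_all)
    have "(LINT x|lebesgue_on \<Omega>. \<phi> n x \<bullet> (gradient \<psi> x \<bullet> b)) = - (LINT x|lebesgue_on \<Omega>. gradient (\<phi> n) x \<bullet> (\<psi> x *\<^sub>R b))" for n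
      using smooth_integration_by_parts[OF \<phi>(1) \<psi> \<Omega>(1), of n] l[OF L\<phi>(1), of n] r[OF L\<phi>(2), of n]
      by (simp only: inner_minus_left)
    with 1 have "(\<lambda>n. - (LINT x|lebesgue_on \<Omega>. gradient (\<phi> n) x \<bullet> (\<psi> x *\<^sub>R b))) \<longlonglongrightarrow> (LINT x|lebesgue_on \<Omega>. u x \<bullet> (gradient \<psi> x \<bullet> b))"
      by (simp only:)
    from LIMSEQ_unique[OF this tendsto_minus[OF 2]]
    show "(LINT x|lebesgue_on \<Omega>. u x *\<^sub>R gradient \<psi> x) \<bullet> b = (- (LINT x|lebesgue_on \<Omega>. \<psi> x *\<^sub>R g x)) \<bullet> b"
      by (simp only: inner_minus_left l[OF L(1)] r[OF L(2)])
  qed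
  moreover have "(\<lambda>n. \<integral>\<^sup>+x. ennreal ((\<phi> n x - u x)\<^sup>2) \<partial>lebesgue_on \<Omega>) \<longlonglongrightarrow> 0"
    using L2_tendsto_imp_nn_integral[OF \<phi>(2)] by simp
  moreover have "(\<lambda>n. \<integral>\<^sup>+x. ennreal ((\<phi> n x - t x)\<^sup>2) \<partial>surface_measure \<Omega>) \<longlonglongrightarrow> 0"
    using L2_tendsto_imp_nn_integral[OF \<phi>(4)] by simp
  ultimately show ?thesis
    unfolding H1_trace_def H1_def using L L2_tendsto_imp_nn_integral[OF \<phi>(3)] \<phi>(1) by blast
qed

lemma H1_trace_smooth:
  assumes "open \<Omega>" "bounded \<Omega>" "smooth \<phi>" "L2 (surface_measure \<Omega>) \<phi>"
  shows "H1_trace \<Omega> \<phi> (gradient \<phi>) \<phi>"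
  by (intro L2_tendsto_H1_trace[where \<phi> = "\<lambda>_. \<phi>"] L2_tendsto_const L2_smooth assms)

text \<open>All three terms are squared L2 norms and hence converge along the approximating smooth
  functions. Later estimates therefore only have to treat smooth functions.\<close>

lemma H1_trace_inequality:
  assumes ineq: "\<And>\<phi>. smooth \<phi> \<Longrightarrow> L2 (surface_measure \<Omega>) \<phi> \<Longrightarrow>
      (LINT x|lebesgue_on \<Omega>. (\<phi> x)\<^sup>2)
      \<le> B * (LINT x|lebesgue_on \<Omega>. (norm (gradient \<phi> x))\<^sup>2) + C * (LINT x|surface_measure \<Omega>. (\<phi> x)\<^sup>2)"
    and u: "H1_trace \<Omega> u g t"
  shows "(LINT x|lebesgue_on \<Omega>. (u x)\<^sup>2)
      \<le> B * (LINT x|lebesgue_on \<Omega>. (norm (g x))\<^sup>2) + C * (LINT x|surface_measure \<Omega>. (t x)\<^sup>2)"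
proof -
  obtain \<phi> where \<phi>: "\<And>n::nat. smooth (\<phi> n)" "L2_tendsto (lebesgue_on \<Omega>) \<phi> u"
    "L2_tendsto (lebesgue_on \<Omega>) (\<lambda>n. gradient (\<phi> n)) g" "L2_tendsto (surface_measure \<Omega>) \<phi> t"
    using H1_trace_approx[OF u] by blast
  show ?thesis
  proof (rule LIMSEQ_le)
    show "(\<lambda>n. LINT x|lebesgue_on \<Omega>. (\<phi> n x)\<^sup>2) \<longlonglongrightarrow> (LINT x|lebesgue_on \<Omega>. (u x)\<^sup>2)"
      using L2_tendsto_norm_sq[OF \<phi>(2)] by simp
    show "(\<lambda>n. B * (LINT x|lebesgue_on \<Omega>. (norm (gradient (\<phi> n) x))\<^sup>2) + C * (LINT x|surface_measure \<Omega>. (\<phi> n x)\<^sup>2))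
      \<longlonglongrightarrow> B * (LINT x|lebesgue_on \<Omega>. (norm (g x))\<^sup>2) + C * (LINT x|surface_measure \<Omega>. (t x)\<^sup>2)"
      using L2_tendsto_norm_sq[OF \<phi>(3)] L2_tendsto_norm_sq[OF \<phi>(4)] by (intro tendsto_intros) simp_all
    show "\<exists>N. \<forall>n\<ge>N. (LINT x|lebesgue_on \<Omega>. (\<phi> n x)\<^sup>2)
      \<le> B * (LINT x|lebesgue_on \<Omega>. (norm (gradient (\<phi> n) x))\<^sup>2) + C * (LINT x|surface_measure \<Omega>. (\<phi> n x)\<^sup>2)"
      using ineq[OF \<phi>(1)] \<phi>(4) by (auto simp: L2_tendsto_def)
  qed
qed

text \<open>The pointwise bound of \<open>2 * \<bar>\<phi> x\<bar>\<close> times the norm of the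
  gradient by \<open>\<epsilon> * (\<phi> x)\<^sup>2 + (norm (gradient \<phi> x))\<^sup>2 /
  \<epsilon>\<close>. All integrals are finite, so the estimate holds between real numbers and the
  first term can be moved to the left. The weight stays free because the general inequality and the
  cubes call for different choices.\<close>

lemma absorb_gradient:
  fixes \<phi> :: "'a::euclidean_space \<Rightarrow> real"
  assumes \<phi>: "smooth \<phi>" "L2 (surface_measure \<Omega>) \<phi>" and \<Omega>: "open \<Omega>" "bounded \<Omega>"
    and ab: "0 \<le> a" "0 \<le> b" and \<epsilon>: "0 < \<epsilon>"
    and ineq: "(\<integral>\<^sup>+x\<in>\<Omega>. ennreal ((\<phi> x)\<^sup>2) \<partial>lborel)
      \<le> ennreal a * (\<integral>\<^sup>+x\<in>\<Omega>. ennreal (norm ((2 * \<phi> x) *\<^sub>R gradient \<phi> x)) \<partial>lborel)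
       + ennreal b * (\<integral>\<^sup>+y. ennreal ((\<phi> y)\<^sup>2) \<partial>surface_measure \<Omega>)"
  shows "(1 - a * \<epsilon>) * (LINT x|lebesgue_on \<Omega>. (\<phi> x)\<^sup>2)
     \<le> a / \<epsilon> * (LINT x|lebesgue_on \<Omega>. (norm (gradient \<phi> x))\<^sup>2) + b * (LINT y|surface_measure \<Omega>. (\<phi> y)\<^sup>2)"
proof -
  note L = L2_smooth[OF \<phi>(1) \<Omega>]
  let ?U = "LINT x|lebesgue_on \<Omega>. (\<phi> x)\<^sup>2" and ?G = "LINT x|lebesgue_on \<Omega>. (norm (gradient \<phi> x))\<^sup>2"
    and ?B = "LINT y|surface_measure \<Omega>. (\<phi> y)\<^sup>2"
  have U: "(\<integral>\<^sup>+x. ennreal ((\<phi> x)\<^sup>2) \<partial>lebesgue_on \<Omega>) = ennreal ?U"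
    and B: "(\<integral>\<^sup>+y. ennreal ((\<phi> y)\<^sup>2) \<partial>surface_measure \<Omega>) = ennreal ?B"
    using L2_nn_integral[OF L(1)] L2_nn_integral[OF \<phi>(2)] by simp_all
  have int: "integrable (lebesgue_on \<Omega>) (\<lambda>x. \<epsilon> * (\<phi> x)\<^sup>2 + 1 / \<epsilon> * (norm (gradient \<phi> x))\<^sup>2)"
    using L2_integrable[OF L(1)] L2_integrable[OF L(2)] by simp
  have "(\<integral>\<^sup>+x. ennreal (norm ((2 * \<phi> x) *\<^sub>R gradient \<phi> x)) \<partial>lebesgue_on \<Omega>)
      \<le> (\<integral>\<^sup>+x. ennreal (\<epsilon> * (\<phi> x)\<^sup>2 + 1 / \<epsilon> * (norm (gradient \<phi> x))\<^sup>2) \<partial>lebesgue_on \<Omega>)"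
  proof (intro nn_integral_mono ennreal_leI)
    fix x
    have "0 \<le> (sqrt \<epsilon> * \<bar>\<phi> x\<bar> - norm (gradient \<phi> x) / sqrt \<epsilon>)\<^sup>2" by simp
    also have "\<dots> = \<epsilon> * (\<phi> x)\<^sup>2 + 1 / \<epsilon> * (norm (gradient \<phi> x))\<^sup>2 - 2 * \<bar>\<phi> x\<bar> * norm (gradient \<phi> x)"
      using \<epsilon> by (simp add: power2_diff power_mult_distrib power_divide)
    finally show "norm ((2 * \<phi> x) *\<^sub>R gradient \<phi> x) \<le> \<epsilon> * (\<phi> x)\<^sup>2 + 1 / \<epsilon> * (norm (gradient \<phi> x))\<^sup>2"
      by (simp add: abs_mult)
  qed
  also have "\<dots> = ennreal (LINT x|lebesgue_on \<Omega>. \<epsilon> * (\<phi> x)\<^sup>2 + 1 / \<epsilon> * (norm (gradient \<phi> x))\<^sup>2)"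
    by (rule nn_integral_eq_integral[OF int]) (use \<epsilon> in auto)
  also have "(LINT x|lebesgue_on \<Omega>. \<epsilon> * (\<phi> x)\<^sup>2 + 1 / \<epsilon> * (norm (gradient \<phi> x))\<^sup>2) = \<epsilon> * ?U + 1 / \<epsilon> * ?G"
    using L2_integrable[OF L(1)] L2_integrable[OF L(2)] by simp
  finally have *: "(\<integral>\<^sup>+x. ennreal (norm ((2 * \<phi> x) *\<^sub>R gradient \<phi> x)) \<partial>lebesgue_on \<Omega>) \<le> ennreal (\<epsilon> * ?U + 1 / \<epsilon> * ?G)" .
  have nn: "0 \<le> ?U" "0 \<le> ?G" "0 \<le> ?B" by simp_all
  have "ennreal ?U \<le> ennreal a * (\<integral>\<^sup>+x. ennreal (norm ((2 * \<phi> x) *\<^sub>R gradient \<phi> x)) \<partial>lebesgue_on \<Omega>) + ennreal b * ennreal ?B"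
    using ineq unfolding nn_integral_lebesgue_on_eq[OF \<Omega>(1), symmetric] U B .
  also have "\<dots> \<le> ennreal a * ennreal (\<epsilon> * ?U + 1 / \<epsilon> * ?G) + ennreal b * ennreal ?B"
    using * by (intro add_right_mono mult_left_mono) auto
  also have "\<dots> = ennreal (a * (\<epsilon> * ?U + 1 / \<epsilon> * ?G) + b * ?B)"
    using ab \<epsilon> nn by (simp add: ennreal_mult)
  finally have "?U \<le> a * (\<epsilon> * ?U + 1 / \<epsilon> * ?G) + b * ?B"
    using ab \<epsilon> nn by (subst (asm) ennreal_le_iff) (auto intro!: add_nonneg_nonneg mult_nonneg_nonneg)
  then show ?thesis by (simp add: algebra_simps)
qed

lemma smooth_square_gradient:
  assumes "smooth \<phi>"
  shows "C1_gradient (\<lambda>x. (\<phi> x)\<^sup>2) (\<lambda>x. (2 * \<phi> x) *\<^sub>R gradient \<phi> x)"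
  using C1_gradient_mult[OF smooth_C1_gradient[OF assms] smooth_C1_gradient[OF assms]]
  by (simp add: power2_eq_square scaleR_left_distrib[symmetric])

text \<open>A minimizing sequence of the Dirichlet functional \<open>a \<phi> \<phi> - 2 * l \<phi>\<close>: comparing \<open>\<phi>\<close> with
  \<open>\<phi> + s * \<psi>\<close> for all real \<open>s\<close> bounds the defect in the Euler--Lagrange equation.\<close>

lemma exists_approximate_Riesz:
  fixes a :: "('x \<Rightarrow> real) \<Rightarrow> ('x \<Rightarrow> real) \<Rightarrow> real"
  assumes D: "\<phi>0 \<in> D" "\<And>f g c. f \<in> D \<Longrightarrow> g \<in> D \<Longrightarrow> (\<lambda>x. f x + c * g x) \<in> D"
    and a: "\<And>f g h c. f \<in> D \<Longrightarrow> g \<in> D \<Longrightarrow> h \<in> D \<Longrightarrow> a (\<lambda>x. f x + c * g x) h = a f h + c * a g h"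
    and sym: "\<And>f g. a f g = a g f" and pos: "\<And>f. 0 \<le> a f f"
    and l: "\<And>f g c. f \<in> D \<Longrightarrow> g \<in> D \<Longrightarrow> l (\<lambda>x. f x + c * g x) = l f + c * l g"
    and bound: "\<And>f. f \<in> D \<Longrightarrow> (l f)\<^sup>2 \<le> C * a f f"
  shows "\<exists>\<phi>. \<forall>n. \<phi> n \<in> D \<and> (\<forall>\<psi>\<in>D. (a (\<phi> n) \<psi> - l \<psi>)\<^sup>2 \<le> a \<psi> \<psi> / real (Suc n))"
proof -
  define J where "J f = a f f - 2 * l f" for f
  \<comment> \<open>The bound on \<open>l\<close> and the arithmetic-geometric mean inequality give
    \<open>2 * \<bar>l f\<bar> \<le> \<bar>C\<bar> + a f f\<close>, so the functional is bounded
    below.\<close>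
  have J_ge: "- \<bar>C\<bar> \<le> J f" if "f \<in> D" for f
  proof -
    have "(l f)\<^sup>2 \<le> \<bar>C\<bar> * a f f"
      using bound[OF that] mult_right_mono[OF abs_ge_self[of C] pos[of f]] by linarith
    moreover have "\<bar>C\<bar> * a f f \<le> ((\<bar>C\<bar> + a f f) / 2)\<^sup>2"
      using sum_squares_bound[of "\<bar>C\<bar>" "a f f"] by (simp add: power_divide power2_sum)
    ultimately have "\<bar>l f\<bar>\<^sup>2 \<le> ((\<bar>C\<bar> + a f f) / 2)\<^sup>2" by simp
    then have "\<bar>l f\<bar> \<le> (\<bar>C\<bar> + a f f) / 2"
      by (rule power2_le_imp_le) (use pos[of f] in simp)
    then show ?thesis by (simp add: J_def)
  qed
  define m where "m = Inf (J ` D)"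
  have bdd: "bdd_below (J ` D)" using J_ge by (intro bdd_belowI[of _ "- \<bar>C\<bar>"]) auto
  have m_le: "m \<le> J f" if "f \<in> D" for f
    unfolding m_def using that bdd by (intro cInf_lower) auto
  have "\<exists>f\<in>D. J f < m + 1 / real (Suc n)" for n
  proof -
    have "Inf (J ` D) < m + 1 / real (Suc n)" by (simp add: m_def)
    then have "\<exists>y\<in>J ` D. y < m + 1 / real (Suc n)"
      using D(1) bdd by (subst (asm) cInf_less_iff) auto
    then show ?thesis by auto
  qed
  then obtain \<phi> where \<phi>: "\<And>n. \<phi> n \<in> D" "\<And>n. J (\<phi> n) < m + 1 / real (Suc n)" by metis
  have "(a (\<phi> n) \<psi> - l \<psi>)\<^sup>2 \<le> a \<psi> \<psi> / real (Suc n)" if \<psi>: "\<psi> \<in> D" for n \<psi>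
  proof -
    have "(a (\<phi> n) \<psi> - l \<psi>)\<^sup>2 \<le> 1 / real (Suc n) * a \<psi> \<psi>"
    proof (rule discriminant_le)
      fix s
      let ?f = "\<lambda>x. \<phi> n x + s * \<psi> x"
      have f: "?f \<in> D" using D(2) \<phi>(1) \<psi> by blast
      have "a ?f ?f = a (\<phi> n) ?f + s * a \<psi> ?f" by (rule a[OF \<phi>(1) \<psi> f])
      also have "\<dots> = a (\<phi> n) (\<phi> n) + 2 * s * a (\<phi> n) \<psi> + s\<^sup>2 * a \<psi> \<psi>"
        unfolding sym[of _ ?f] using a[OF \<phi>(1) \<psi> \<phi>(1)] a[OF \<phi>(1) \<psi> \<psi>] sym[of \<psi> "\<phi> n"]
        by (simp add: algebra_simps power2_eq_square)
      finally have "J ?f = J (\<phi> n) + 2 * s * (a (\<phi> n) \<psi> - l \<psi>) + s\<^sup>2 * a \<psi> \<psi>"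
        using l[OF \<phi>(1) \<psi>, of n s] by (simp add: J_def algebra_simps)
      with m_le[OF f] \<phi>(2)[of n] show "0 \<le> 1 / real (Suc n) + 2 * s * (a (\<phi> n) \<psi> - l \<psi>) + s\<^sup>2 * a \<psi> \<psi>"
        by linarith
    qed (rule pos)
    then show ?thesis by simp
  qed
  with \<phi>(1) show ?thesis by blast
qed

lemma exists_ball_volume_ge_2: "\<exists>R\<ge>0. 2 \<le> emeasure lborel (ball (0::'a::euclidean_space) R)"
proof -
  let ?v = "unit_ball_vol (real DIM('a))"
  have v: "0 < ?v" by simp
  define R where "R = max 1 (2 / ?v)"
  have R: "1 \<le> R" "2 / ?v \<le> R" by (auto simp: R_def)
  have "2 \<le> ?v * R" using R(2) v by (simp add: field_simps)
  also have "\<dots> \<le> ?v * R ^ DIM('a)"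
    using v R(1) by (intro mult_left_mono self_le_power) auto
  finally have "ennreal 2 \<le> ennreal (?v * R ^ DIM('a))" by (rule ennreal_leI)
  moreover have "emeasure lborel (ball (0::'a) R) = ennreal (?v * R ^ DIM('a))"
    using R(1) by (subst emeasure_ball) auto
  ultimately show ?thesis using R(1) by (intro exI[of _ R]) auto
qed

section \<open>The torsion function\<close>

abbreviation robin_energy :: "real \<Rightarrow> 'a::euclidean_space set \<Rightarrow> ('a \<Rightarrow> 'a) \<Rightarrow> ('a \<Rightarrow> real) \<Rightarrow> real" where
  "robin_energy \<beta> \<Omega> g t \<equiv> (LINT x|lebesgue_on \<Omega>. (norm (g x))\<^sup>2) + \<beta> * (LINT x|surface_measure \<Omega>. (t x)\<^sup>2)"

abbreviation rayleigh_quotients :: "real \<Rightarrow> 'a::euclidean_space set \<Rightarrow> real set" where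
  "rayleigh_quotients \<beta> \<Omega> \<equiv> {robin_energy \<beta> \<Omega> g t / (LINT x|lebesgue_on \<Omega>. (u x)\<^sup>2) | u g t.
     H1_trace \<Omega> u g t \<and> \<not> (AE x in lebesgue_on \<Omega>. u x = 0)}"

text \<open>The constant is the same for all sets of volume at most \<open>1\<close>, because the
  radius of the ball of translations is fixed before the set. This uniformity is what bounds the
  torsion over all domains.\<close>

lemma Friedrichs_inequality:
  assumes "0 < \<beta>"
  obtains C where "0 < C" "\<And>(\<Omega>::'a::euclidean_space set) u g t. \<lbrakk>open \<Omega>; bounded \<Omega>; emeasure lborel \<Omega> \<le> 1; H1_trace \<Omega> u g t\<rbrakk>
    \<Longrightarrow> (LINT x|lebesgue_on \<Omega>. (u x)\<^sup>2)
      \<le> C * robin_energy \<beta> \<Omega> g t"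
proof -
  obtain R where R: "0 \<le> R" "2 \<le> emeasure lborel (ball (0::'a) R)" using exists_ball_volume_ge_2 by blast
  define V where "V = measure lborel (ball (0::'a) R)"
  have V: "emeasure lborel (ball (0::'a) R) = ennreal V" "0 \<le> V"
    using emeasure_bounded_finite[OF bounded_ball, of "0::'a" R]
    by (auto simp: V_def emeasure_eq_ennreal_measure less_top)
  \<comment> \<open>The summand \<open>1\<close> ensures that \<open>a\<close> is positive and
    \<open>1 / (2 * a)\<close> a legitimate weight.\<close>
  define a where "a = V * R + 1"
  define b where "b = V * shadow_const TYPE('a) R"
  have ab: "0 < a" "0 \<le> b" using V(2) R(1) shadow_const_nonneg[OF R(1), where 'a = 'a]
    by (auto simp: a_def b_def intro!: add_nonneg_pos)
  \<comment> \<open>With \<open>\<epsilon> = 1 / (2 * a)\<close> half of the left-hand side survives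
    the absorption. Doubling yields the coefficients \<open>4 * a\<^sup>2\<close> of the gradient
    and \<open>2 * b\<close> of the boundary term, and the latter is at most
    \<open>C * \<beta>\<close>.\<close>
  define C where "C = 4 * a\<^sup>2 + 2 * b / \<beta>"
  have "0 < C" using ab assms by (auto simp: C_def intro!: add_pos_nonneg)
  moreover have "(LINT x|lebesgue_on \<Omega>. (u x)\<^sup>2)
      \<le> C * robin_energy \<beta> \<Omega> g t"
    if \<Omega>: "open \<Omega>" "bounded \<Omega>" "emeasure lborel \<Omega> \<le> 1" and u: "H1_trace \<Omega> u g t"
    for \<Omega> :: "'a set" and u g t
  proof -
    have "(LINT x|lebesgue_on \<Omega>. (u x)\<^sup>2)
      \<le> C * (LINT x|lebesgue_on \<Omega>. (norm (g x))\<^sup>2) + (C * \<beta>) * (LINT x|surface_measure \<Omega>. (t x)\<^sup>2)"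
    proof (rule H1_trace_inequality[OF _ u])
      fix \<phi> :: "'a \<Rightarrow> real" assume \<phi>: "smooth \<phi>" "L2 (surface_measure \<Omega>) \<phi>"
      let ?U = "LINT x|lebesgue_on \<Omega>. (\<phi> x)\<^sup>2" and ?G = "LINT x|lebesgue_on \<Omega>. (norm (gradient \<phi> x))\<^sup>2"
        and ?B = "LINT y|surface_measure \<Omega>. (\<phi> y)\<^sup>2"
      have "(1 - a * (1 / (2 * a))) * ?U \<le> a / (1 / (2 * a)) * ?G + b * ?B"
      proof (rule absorb_gradient[OF \<phi> \<Omega>(1,2)])
        let ?I = "\<integral>\<^sup>+x\<in>\<Omega>. ennreal (norm ((2 * \<phi> x) *\<^sub>R gradient \<phi> x)) \<partial>lborel"
        have "(\<integral>\<^sup>+x\<in>\<Omega>. ennreal ((\<phi> x)\<^sup>2) \<partial>lborel)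
          \<le> ennreal V * (ennreal R * ?I + ennreal (shadow_const TYPE('a) R) * (\<integral>\<^sup>+y. ennreal ((\<phi> y)\<^sup>2) \<partial>surface_measure \<Omega>))"
          unfolding V(1)[symmetric]
          by (rule nn_integral_le_gradient_boundary[OF smooth_square_gradient[OF \<phi>(1)] _ \<Omega>(1,3) R(2)]) simp
        also have "\<dots> = ennreal (V * R) * ?I + ennreal b * (\<integral>\<^sup>+y. ennreal ((\<phi> y)\<^sup>2) \<partial>surface_measure \<Omega>)"
          using V(2) R(1) shadow_const_nonneg[OF R(1), where 'a = 'a]
          by (simp add: b_def distrib_left ennreal_mult mult.assoc)
        also have "\<dots> \<le> ennreal a * ?I + ennreal b * (\<integral>\<^sup>+y. ennreal ((\<phi> y)\<^sup>2) \<partial>surface_measure \<Omega>)"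
          by (intro add_right_mono mult_right_mono ennreal_leI) (auto simp: a_def)
        finally show "(\<integral>\<^sup>+x\<in>\<Omega>. ennreal ((\<phi> x)\<^sup>2) \<partial>lborel)
          \<le> ennreal a * ?I + ennreal b * (\<integral>\<^sup>+y. ennreal ((\<phi> y)\<^sup>2) \<partial>surface_measure \<Omega>)" .
      qed (use ab in auto)
      then have "?U \<le> 4 * a\<^sup>2 * ?G + 2 * b * ?B" using ab by (simp add: power2_eq_square)
      also have "\<dots> \<le> C * ?G + (C * \<beta>) * ?B"
        using ab assms by (intro add_mono mult_right_mono) (auto simp: C_def field_simps)
      finally show "?U \<le> C * ?G + (C * \<beta>) * ?B" .
    qed
    then show ?thesis by (simp add: distrib_left mult.assoc)
  qed
  ultimately show ?thesis by (rule that)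
qed

text \<open>The energy is minimized over smooth functions only. The minimizing sequence is Cauchy in
  the energy norm, so functions, gradients and boundary values converge separately in L2, and
  closedness of the trace relation identifies the limits as one triple.\<close>

lemma robin_torsion_function_exists:
  fixes \<Omega> :: "'a::euclidean_space set"
  assumes \<beta>: "0 < \<beta>" and \<Omega>: "open \<Omega>" "bounded \<Omega>" "emeasure lborel \<Omega> \<le> 1"
  shows "\<exists>w. robin_torsion_function \<beta> \<Omega> w"
proof -
  let ?M = "lebesgue_on \<Omega>" and ?S = "surface_measure \<Omega>"
  obtain C where C: "0 < C" and C': "\<And>(\<Omega>::'a set) u g t. \<lbrakk>open \<Omega>; bounded \<Omega>; emeasure lborel \<Omega> \<le> 1; H1_trace \<Omega> u g t\<rbrakk>
    \<Longrightarrow> (LINT x|lebesgue_on \<Omega>. (u x)\<^sup>2)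
      \<le> C * robin_energy \<beta> \<Omega> g t"
    by (rule Friedrichs_inequality[OF \<beta>, where 'a = 'a]) blast
  \<comment> \<open>A smooth function need not be square integrable over a boundary of infinite
    measure; \<open>D\<close> retains those with finite energy.\<close>
  define D where "D = {\<phi>. smooth \<phi> \<and> L2 ?S \<phi>}"
  define a where "a \<phi> \<psi> = (LINT x|?M. gradient \<phi> x \<bullet> gradient \<psi> x) + \<beta> * (LINT x|?S. \<phi> x * \<psi> x)" for \<phi> \<psi>
  define l where "l \<phi> = (LINT x|?M. \<phi> x)" for \<phi> :: "'a \<Rightarrow> real"
  have one: "L2 ?M (\<lambda>_. 1::real)" by (rule L2_continuous_bounded[OF _ \<Omega>(1,2)]) simp
  have DL: "L2 ?M \<phi>" "L2 ?M (gradient \<phi>)" "L2 ?S \<phi>" "smooth \<phi>" if "\<phi> \<in> D" for \<phi>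
    using that L2_smooth[OF _ \<Omega>(1,2)] by (auto simp: D_def)
  have D: "(\<lambda>x. f x + c * g x) \<in> D" if "f \<in> D" "g \<in> D" for f g c
    using that unfolding D_def by (auto intro: smooth_add_mult L2_add_mult)
  have a_eq: "a \<phi> \<phi> = (LINT x|?M. (norm (gradient \<phi> x))\<^sup>2) + \<beta> * (LINT x|?S. (\<phi> x)\<^sup>2)" for \<phi>
    by (simp add: a_def dot_square_norm power2_eq_square[symmetric])
  have coercive: "(LINT x|?M. (\<phi> x)\<^sup>2) \<le> C * a \<phi> \<phi>" if "\<phi> \<in> D" for \<phi>
    unfolding a_eq using that by (intro C' H1_trace_smooth \<Omega>) (auto simp: D_def)
  have a_lin: "a (\<lambda>x. f x + c * g x) h = a f h + c * a g h" if "f \<in> D" "g \<in> D" "h \<in> D" for f g h c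
  proof -
    note L = DL[OF that(1)] DL[OF that(2)] DL[OF that(3)]
    have "(LINT x|?M. gradient (\<lambda>x. f x + c * g x) x \<bullet> gradient h x)
      = (LINT x|?M. gradient f x \<bullet> gradient h x + c * (gradient g x \<bullet> gradient h x))"
      using gradient_add_mult[OF L(4) L(8)] by (simp add: inner_simps)
    also have "\<dots> = (LINT x|?M. gradient f x \<bullet> gradient h x) + c * (LINT x|?M. gradient g x \<bullet> gradient h x)"
      using L2_integrable_inner[OF L(2) L(10)] L2_integrable_inner[OF L(6) L(10)] by simp
    finally have 1: "(LINT x|?M. gradient (\<lambda>x. f x + c * g x) x \<bullet> gradient h x)
      = (LINT x|?M. gradient f x \<bullet> gradient h x) + c * (LINT x|?M. gradient g x \<bullet> gradient h x)" .
    have "(LINT x|?S. (f x + c * g x) * h x) = (LINT x|?S. f x * h x + c * (g x * h x))"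
      by (simp add: algebra_simps)
    also have "\<dots> = (LINT x|?S. f x * h x) + c * (LINT x|?S. g x * h x)"
      using L2_integrable_mult[OF L(3) L(11)] L2_integrable_mult[OF L(7) L(11)] by simp
    finally show ?thesis using 1 by (simp add: a_def algebra_simps)
  qed
  have l_lin: "l (\<lambda>x. f x + c * g x) = l f + c * l g" if "f \<in> D" "g \<in> D" for f g c
    using L2_integrable_mult[OF DL(1)[OF that(1)] one] L2_integrable_mult[OF DL(1)[OF that(2)] one]
    by (simp add: l_def)
  have one1: "(LINT x|?M. 1::real) \<le> 1"
  proof -
    have "measure ?M (space ?M) \<le> 1"
      unfolding measure_def using \<Omega> by (intro enn2real_leI) (simp_all add: emeasure_restrict_space space_restrict_space)
    then show ?thesis by simp
  qed
  have l_le: "(LINT x|?M. u x)\<^sup>2 \<le> (LINT x|?M. (u x)\<^sup>2)" if "L2 ?M u" for u :: "'a \<Rightarrow> real"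
  proof -
    have "(LINT x|?M. u x)\<^sup>2 \<le> (LINT x|?M. (u x)\<^sup>2) * (LINT x|?M. 1)"
      using L2_Cauchy_Schwarz[OF that one] by simp
    also have "\<dots> \<le> (LINT x|?M. (u x)\<^sup>2)" using one1 by (intro mult_left_le) auto
    finally show ?thesis .
  qed
  have sym: "a f g = a g f" for f g by (simp add: a_def inner_commute mult.commute)
  have pos: "0 \<le> a f f" for f using \<beta> by (simp add: a_eq)
  have "\<exists>\<phi>. \<forall>n. \<phi> n \<in> D \<and> (\<forall>\<psi>\<in>D. (a (\<phi> n) \<psi> - l \<psi>)\<^sup>2 \<le> a \<psi> \<psi> / real (Suc n))"
  proof (rule exists_approximate_Riesz)
    have "L2 ?S (\<lambda>_. 0::real)" by (simp add: L2_def)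
    then show "(\<lambda>_. 0) \<in> D" by (simp add: D_def smooth_const)
    show "(l f)\<^sup>2 \<le> C * a f f" if "f \<in> D" for f
      using l_le[OF DL(1)[OF that]] coercive[OF that] by (simp add: l_def)
  qed (fact D a_lin sym pos l_lin)+
  then obtain \<phi> where \<phi>: "\<And>n. \<phi> n \<in> D" "\<And>n \<psi>. \<psi> \<in> D \<Longrightarrow> (a (\<phi> n) \<psi> - l \<psi>)\<^sup>2 \<le> a \<psi> \<psi> / real (Suc n)"
    by blast
  define d where "d m n = a (\<lambda>x. \<phi> m x + (- 1) * \<phi> n x) (\<lambda>x. \<phi> m x + (- 1) * \<phi> n x)" for m n
  \<comment> \<open>The form at the difference of two approximate solutions equals the difference of
    their two defects at it, the linear parts cancelling. Thus \<open>(d m n)\<^sup>2\<close> is at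
    most a small multiple of \<open>d m n\<close>, and one factor can be divided out.\<close>
  have d_le: "d m n \<le> 2 / real (Suc m) + 2 / real (Suc n)" for m n
  proof -
    let ?d = "\<lambda>x. \<phi> m x + (- 1) * \<phi> n x"
    have diff_sq: "(x - y)\<^sup>2 \<le> 2 * x\<^sup>2 + 2 * y\<^sup>2" for x y :: real
      using sum_squares_bound[of x "- y"] by (simp add: power2_diff)
    have dD: "?d \<in> D" by (rule D) (rule \<phi>)+
    have "d m n = (a (\<phi> m) ?d - l ?d) - (a (\<phi> n) ?d - l ?d)"
      unfolding d_def using a_lin[OF \<phi>(1) \<phi>(1) dD, of m "-1" n] by simp
    then have "(d m n)\<^sup>2 \<le> 2 * (a (\<phi> m) ?d - l ?d)\<^sup>2 + 2 * (a (\<phi> n) ?d - l ?d)\<^sup>2"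
      by (simp only: diff_sq)
    also have "\<dots> \<le> 2 * (d m n / real (Suc m)) + 2 * (d m n / real (Suc n))"
      using \<phi>(2)[OF dD, of m] \<phi>(2)[OF dD, of n] unfolding d_def by linarith
    also have "\<dots> = d m n * (2 / real (Suc m) + 2 / real (Suc n))" by (simp add: algebra_simps)
    finally have "d m n * d m n \<le> d m n * (2 / real (Suc m) + 2 / real (Suc n))" by (simp add: power2_eq_square)
    moreover have "0 \<le> d m n" unfolding d_def by (rule pos)
    ultimately show ?thesis by (cases "d m n = 0") (simp_all add: mult_le_cancel_left_pos)
  qed
  have d_small: "\<exists>N. \<forall>m\<ge>N. \<forall>n\<ge>N. d m n < e" if "0 < e" for e
  proof -
    have "0 < e / 4" using that by simp
    then obtain N where N: "1 / real (Suc N) < e / 4" by (rule nat_approx_posE)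
    have "d m n < e" if "N \<le> m" "N \<le> n" for m n
    proof -
      have "1 / real (Suc m) \<le> 1 / real (Suc N)" "1 / real (Suc n) \<le> 1 / real (Suc N)"
        using that by (simp_all add: frac_le)
      with N d_le[of m n] show ?thesis by linarith
    qed
    then show ?thesis by blast
  qed
  have d_eq: "d m n = (LINT x|?M. (norm (gradient (\<phi> m) x - gradient (\<phi> n) x))\<^sup>2) + \<beta> * (LINT x|?S. (\<phi> m x - \<phi> n x)\<^sup>2)" for m n
    unfolding d_def a_eq using gradient_add_mult[OF DL(4)[OF \<phi>(1)] DL(4)[OF \<phi>(1)], of m "-1" n] by simp
  have nn: "0 \<le> (LINT x|?M. (norm (gradient (\<phi> m) x - gradient (\<phi> n) x))\<^sup>2)" "0 \<le> (LINT x|?S. (\<phi> m x - \<phi> n x)\<^sup>2)" for m n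
    by simp_all
  \<comment> \<open>Gradients and boundary values are controlled by the energy directly, the
    functions themselves through \<open>coercive\<close>.\<close>
  have "\<exists>w. L2_tendsto ?M \<phi> w"
  proof (rule L2_complete)
    fix e :: real assume "0 < e"
    then obtain N where N: "\<forall>m\<ge>N. \<forall>n\<ge>N. d m n < e / C" using d_small[of "e / C"] C by auto
    have "(LINT x|?M. (norm (\<phi> m x - \<phi> n x))\<^sup>2) < e" if "N \<le> m" "N \<le> n" for m n
    proof -
      have "(LINT x|?M. (norm (\<phi> m x - \<phi> n x))\<^sup>2) \<le> C * d m n"
        using coercive[OF D[OF \<phi>(1) \<phi>(1)], of m "-1" n] by (simp add: d_def)
      also have "\<dots> < C * (e / C)" using N that C by (intro mult_strict_left_mono) auto
      finally show ?thesis using C by simp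
    qed
    then show "\<exists>N. \<forall>m\<ge>N. \<forall>n\<ge>N. (LINT x|?M. (norm (\<phi> m x - \<phi> n x))\<^sup>2) < e" by blast
  qed (rule DL(1)[OF \<phi>(1)])
  then obtain w where w: "L2_tendsto ?M \<phi> w" by blast
  have "\<exists>g. L2_tendsto ?M (\<lambda>n. gradient (\<phi> n)) g"
  proof (rule L2_complete)
    fix e :: real assume "0 < e"
    then obtain N where N: "\<forall>m\<ge>N. \<forall>n\<ge>N. d m n < e" using d_small by blast
    have "(LINT x|?M. (norm (gradient (\<phi> m) x - gradient (\<phi> n) x))\<^sup>2) \<le> d m n" for m n
      using nn(2)[of m n] \<beta> by (simp add: d_eq)
    then show "\<exists>N. \<forall>m\<ge>N. \<forall>n\<ge>N. (LINT x|?M. (norm (gradient (\<phi> m) x - gradient (\<phi> n) x))\<^sup>2) < e"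
      using N by (meson le_less_trans)
  qed (rule DL(2)[OF \<phi>(1)])
  then obtain g where g: "L2_tendsto ?M (\<lambda>n. gradient (\<phi> n)) g" by blast
  have "\<exists>t. L2_tendsto ?S \<phi> t"
  proof (rule L2_complete)
    fix e :: real assume e: "0 < e"
    then obtain N where N: "\<forall>m\<ge>N. \<forall>n\<ge>N. d m n < \<beta> * e" using d_small[of "\<beta> * e"] \<beta> by auto
    have "(LINT x|?S. (norm (\<phi> m x - \<phi> n x))\<^sup>2) < e" if "N \<le> m" "N \<le> n" for m n
    proof -
      have "\<beta> * (LINT x|?S. (\<phi> m x - \<phi> n x)\<^sup>2) \<le> d m n" using nn(1)[of m n] by (simp add: d_eq)
      also have "\<dots> < \<beta> * e" using N that by blast
      finally show ?thesis using \<beta> by simp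
    qed
    then show "\<exists>N. \<forall>m\<ge>N. \<forall>n\<ge>N. (LINT x|?S. (norm (\<phi> m x - \<phi> n x))\<^sup>2) < e" by blast
  qed (rule DL(3)[OF \<phi>(1)])
  then obtain t where t: "L2_tendsto ?S \<phi> t" by blast
  have trace: "H1_trace \<Omega> w g t"
    by (rule L2_tendsto_H1_trace[OF \<Omega>(1,2) DL(4)[OF \<phi>(1)] w g t])
  have weak_smooth: "(LINT x|?M. g x \<bullet> gradient \<psi> x) + \<beta> * (LINT x|?S. t x * \<psi> x) = (LINT x|?M. \<psi> x)" if \<psi>: "\<psi> \<in> D" for \<psi>
  proof -
    have "(\<lambda>n. a (\<phi> n) \<psi>) \<longlonglongrightarrow> (LINT x|?M. g x \<bullet> gradient \<psi> x) + \<beta> * (LINT x|?S. t x * \<psi> x)"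
      unfolding a_def
      using L2_tendsto_inner[OF g L2_tendsto_const[OF DL(2)[OF \<psi>]]] L2_tendsto_inner[OF t L2_tendsto_const[OF DL(3)[OF \<psi>]]]
      by (intro tendsto_intros) simp_all
    moreover have "(\<lambda>n. a (\<phi> n) \<psi>) \<longlonglongrightarrow> l \<psi>"
    proof -
      have "(\<lambda>n. a \<psi> \<psi> * (1 / real (Suc n))) \<longlonglongrightarrow> a \<psi> \<psi> * 0"
        by (intro tendsto_mult tendsto_const LIMSEQ_Suc[OF lim_1_over_n])
      then have "(\<lambda>n. a \<psi> \<psi> / real (Suc n)) \<longlonglongrightarrow> 0" by simp
      then have "(\<lambda>n. (a (\<phi> n) \<psi> - l \<psi>)\<^sup>2) \<longlonglongrightarrow> 0"
        by (rule tendsto_sandwich[OF _ _ tendsto_const, rotated 2]) (use \<phi>(2)[OF \<psi>] in auto)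
      from tendsto_real_sqrt[OF this] have "(\<lambda>n. a (\<phi> n) \<psi> - l \<psi>) \<longlonglongrightarrow> 0"
        by (simp add: tendsto_rabs_zero_iff)
      then show ?thesis by (simp add: LIM_zero_iff)
    qed
    ultimately show ?thesis unfolding l_def[symmetric] by (rule LIMSEQ_unique)
  qed
  \<comment> \<open>Every term is continuous along the smooth functions approximating
    \<open>v\<close>, which belong to \<open>D\<close>.\<close>
  have "(LINT x|?M. g x \<bullet> h x) + \<beta> * (LINT x|?S. t x * s x) = (LINT x|?M. v x)" if v: "H1_trace \<Omega> v h s" for v h s
  proof -
    obtain \<psi> where \<psi>: "\<And>n::nat. smooth (\<psi> n)" "L2_tendsto ?M \<psi> v"
      "L2_tendsto ?M (\<lambda>n. gradient (\<psi> n)) h" "L2_tendsto ?S \<psi> s"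
      using H1_trace_approx[OF v] by blast
    have \<psi>D: "\<psi> n \<in> D" for n using \<psi> by (auto simp: D_def L2_tendsto_def)
    have Lg: "L2 ?M g" "L2 ?S t" using g t by (auto simp: L2_tendsto_def)
    have "(\<lambda>n. (LINT x|?M. g x \<bullet> gradient (\<psi> n) x) + \<beta> * (LINT x|?S. t x * \<psi> n x))
       \<longlonglongrightarrow> (LINT x|?M. g x \<bullet> h x) + \<beta> * (LINT x|?S. t x * s x)"
      using L2_tendsto_inner[OF L2_tendsto_const[OF Lg(1)] \<psi>(3)] L2_tendsto_inner[OF L2_tendsto_const[OF Lg(2)] \<psi>(4)]
      by (intro tendsto_intros) simp_all
    moreover have "(\<lambda>n. LINT x|?M. \<psi> n x) \<longlonglongrightarrow> (LINT x|?M. v x)"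
      using L2_tendsto_inner[OF \<psi>(2) L2_tendsto_const[OF one]] by simp
    ultimately show ?thesis unfolding weak_smooth[OF \<psi>D] by (rule LIMSEQ_unique)
  qed
  with trace show ?thesis unfolding robin_torsion_function_def by blast
qed

text \<open>Each of two solutions is tested with the other; by symmetry of the form the left-hand
  sides agree, hence so do the integrals. This determines the value without comparing the solutions
  pointwise.\<close>

lemma robin_torsion_eq:
  assumes w: "robin_torsion_function \<beta> \<Omega> w"
  shows "robin_torsion \<beta> \<Omega> = (LINT x|lebesgue_on \<Omega>. w x)"
  unfolding robin_torsion_def
proof (rule the_equality)
  show "\<exists>v. robin_torsion_function \<beta> \<Omega> v \<and> (LINT x|lebesgue_on \<Omega>. w x) = (LINT x|lebesgue_on \<Omega>. v x)"
    using w by blast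
  fix T assume "\<exists>v. robin_torsion_function \<beta> \<Omega> v \<and> T = (LINT x|lebesgue_on \<Omega>. v x)"
  then obtain v where v: "robin_torsion_function \<beta> \<Omega> v" "T = (LINT x|lebesgue_on \<Omega>. v x)" by blast
  obtain g t where w': "H1_trace \<Omega> w g t" "\<And>v h s. H1_trace \<Omega> v h s \<Longrightarrow>
      (LINT x|lebesgue_on \<Omega>. g x \<bullet> h x) + \<beta> * (LINT x|surface_measure \<Omega>. t x * s x) = (LINT x|lebesgue_on \<Omega>. v x)"
    using w unfolding robin_torsion_function_def by blast
  obtain h s where v': "H1_trace \<Omega> v h s" "\<And>u k r. H1_trace \<Omega> u k r \<Longrightarrow>
      (LINT x|lebesgue_on \<Omega>. h x \<bullet> k x) + \<beta> * (LINT x|surface_measure \<Omega>. s x * r x) = (LINT x|lebesgue_on \<Omega>. u x)"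
    using v unfolding robin_torsion_function_def by blast
  from w'(2)[OF v'(1)] v'(2)[OF w'(1)] show "T = (LINT x|lebesgue_on \<Omega>. w x)"
    unfolding v(2) by (simp add: inner_commute mult.commute)
qed

lemma robin_torsion_solution:
  fixes \<Omega> :: "'a::euclidean_space set"
  assumes "0 < \<beta>" "open \<Omega>" "bounded \<Omega>" "emeasure lborel \<Omega> \<le> 1"
  obtains w g t where "H1_trace \<Omega> w g t" "robin_torsion \<beta> \<Omega> = (LINT x|lebesgue_on \<Omega>. w x)"
    "robin_torsion \<beta> \<Omega> = robin_energy \<beta> \<Omega> g t"
    "\<And>v h s. H1_trace \<Omega> v h s \<Longrightarrow>
      (LINT x|lebesgue_on \<Omega>. g x \<bullet> h x) + \<beta> * (LINT x|surface_measure \<Omega>. t x * s x) = (LINT x|lebesgue_on \<Omega>. v x)"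
proof -
  obtain w where w: "robin_torsion_function \<beta> \<Omega> w" using robin_torsion_function_exists[OF assms] by blast
  then obtain g t where gt: "H1_trace \<Omega> w g t" "\<And>v h s. H1_trace \<Omega> v h s \<Longrightarrow>
      (LINT x|lebesgue_on \<Omega>. g x \<bullet> h x) + \<beta> * (LINT x|surface_measure \<Omega>. t x * s x) = (LINT x|lebesgue_on \<Omega>. v x)"
    unfolding robin_torsion_function_def by blast
  show ?thesis
  proof (rule that[OF gt(1) robin_torsion_eq[OF w] _ gt(2)])
    show "robin_torsion \<beta> \<Omega> = robin_energy \<beta> \<Omega> g t"
      unfolding robin_torsion_eq[OF w] gt(2)[OF gt(1), symmetric]
      by (simp add: dot_square_norm power2_eq_square[symmetric])
  qed
qed

section \<open>Bounds for the torsion and the eigenvalue\<close>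

lemma LINT_sq_le:
  assumes "L2 M u" "emeasure M (space M) \<le> ennreal P" "0 \<le> P"
  shows "(LINT x|M. u x)\<^sup>2 \<le> P * (LINT x|M. (u x :: real)\<^sup>2)"
proof -
  have fin: "finite_measure M" using assms(2) by (intro finite_measureI) (auto simp: top_unique)
  then have one: "L2 M (\<lambda>_. 1::real)" by (simp add: L2_def finite_measure.integrable_const)
  have "measure M (space M) \<le> P" unfolding measure_def using assms(2,3) by (intro enn2real_leI)
  moreover have "(LINT x|M. u x)\<^sup>2 \<le> (LINT x|M. (u x)\<^sup>2) * measure M (space M)"
    using L2_Cauchy_Schwarz[OF assms(1) one] by simp
  moreover have "(LINT x|M. (u x)\<^sup>2) * measure M (space M) \<le> (LINT x|M. (u x)\<^sup>2) * P"
    using calculation(1) by (intro mult_left_mono) auto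
  ultimately show ?thesis by (simp add: mult.commute)
qed

lemma emeasure_lebesgue_on_self: "open \<Omega> \<Longrightarrow> emeasure (lebesgue_on \<Omega>) (space (lebesgue_on \<Omega>)) = emeasure lborel \<Omega>"
  by (simp add: emeasure_restrict_space space_restrict_space)

lemma robin_torsion_nonneg:
  fixes \<Omega> :: "'a::euclidean_space set"
  assumes "0 < \<beta>" "open \<Omega>" "bounded \<Omega>" "emeasure lborel \<Omega> \<le> 1"
  shows "0 \<le> robin_torsion \<beta> \<Omega>"
proof -
  obtain g :: "'a \<Rightarrow> 'a" and t where
    "robin_torsion \<beta> \<Omega> = robin_energy \<beta> \<Omega> g t"
    by (rule robin_torsion_solution[OF assms]) blast
  then show ?thesis using assms(1) by simp
qed

lemma robin_eigenvalue_mult_torsion_le: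
  assumes \<beta>: "0 < \<beta>" and \<Omega>: "open \<Omega>" "bounded \<Omega>" "emeasure lborel \<Omega> \<le> 1"
  shows "robin_eigenvalue \<beta> \<Omega> * robin_torsion \<beta> \<Omega> \<le> 1"
\<comment> \<open>If the torsion does not vanish, the torsion function is not zero almost everywhere
  and is a competitor for the eigenvalue.\<close>
proof (cases "robin_torsion \<beta> \<Omega> = 0")
  case False
  let ?T = "robin_torsion \<beta> \<Omega>"
  have T: "0 < ?T" using robin_torsion_nonneg[OF assms] False by simp
  obtain w g t where w: "H1_trace \<Omega> w g t" "?T = (LINT x|lebesgue_on \<Omega>. w x)"
    "?T = robin_energy \<beta> \<Omega> g t"
    by (rule robin_torsion_solution[OF assms]) blast
  have L: "L2 (lebesgue_on \<Omega>) w" using w(1) by (simp add: H1_trace_def H1_def)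
  let ?U = "LINT x|lebesgue_on \<Omega>. (w x)\<^sup>2"
  \<comment> \<open>Cauchy--Schwarz against the constant \<open>1\<close>, whose squared norm is the
    volume; the bound \<open>1\<close> of the product originates here.\<close>
  have TU: "?T\<^sup>2 \<le> ?U"
    using LINT_sq_le[OF L, of 1] \<Omega> emeasure_lebesgue_on_self[OF \<Omega>(1)] unfolding w(2) by simp
  have "0 < ?T\<^sup>2" using T by simp
  then have U: "0 < ?U" using TU by linarith
  have "\<not> (AE x in lebesgue_on \<Omega>. w x = 0)"
  proof
    assume "AE x in lebesgue_on \<Omega>. w x = 0"
    then have "(LINT x|lebesgue_on \<Omega>. w x) = (LINT x|lebesgue_on \<Omega>. 0)"
      using L2_measurable[OF L] by (intro integral_cong_AE) auto
    then show False using T w(2) by simp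
  qed
  then have "robin_eigenvalue \<beta> \<Omega> \<le> ?T / ?U"
    unfolding robin_eigenvalue_def
  proof (intro cInf_lower)
    show "?T / ?U \<in> rayleigh_quotients \<beta> \<Omega>"
      using w(1,3) \<open>\<not> (AE x in lebesgue_on \<Omega>. w x = 0)\<close> by auto
  next
    show "bdd_below (rayleigh_quotients \<beta> \<Omega>)"
      using \<beta> by (intro bdd_belowI[of _ 0]) auto
  qed
  then have "robin_eigenvalue \<beta> \<Omega> * ?T \<le> ?T / ?U * ?T" using T by (intro mult_right_mono) auto
  also have "\<dots> = ?T\<^sup>2 / ?U" by (simp add: power2_eq_square)
  also have "\<dots> \<le> 1" using TU U by simp
  finally show ?thesis .
qed simp

text \<open>By Cauchy--Schwarz the squared torsion is at most the squared L2 norm of the torsion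
  function, which is at most \<open>C\<close> times its energy, that is, \<open>C\<close> times the
  torsion. One factor cancels.\<close>

lemma robin_torsion_bounded:
  assumes \<beta>: "0 < \<beta>"
  obtains C where "0 < C" "\<And>\<Omega>::'a::euclidean_space set. \<lbrakk>open \<Omega>; bounded \<Omega>; emeasure lborel \<Omega> \<le> 1\<rbrakk> \<Longrightarrow> robin_torsion \<beta> \<Omega> \<le> C"
proof -
  obtain C where C: "0 < C" and C': "\<And>(\<Omega>::'a set) u g t. \<lbrakk>open \<Omega>; bounded \<Omega>; emeasure lborel \<Omega> \<le> 1; H1_trace \<Omega> u g t\<rbrakk>
    \<Longrightarrow> (LINT x|lebesgue_on \<Omega>. (u x)\<^sup>2)
      \<le> C * robin_energy \<beta> \<Omega> g t"
    by (rule Friedrichs_inequality[OF \<beta>, where 'a = 'a]) blast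
  have "robin_torsion \<beta> \<Omega> \<le> C" if \<Omega>: "open \<Omega>" "bounded \<Omega>" "emeasure lborel \<Omega> \<le> 1" for \<Omega> :: "'a set"
  proof -
    let ?T = "robin_torsion \<beta> \<Omega>"
    obtain w g t where w: "H1_trace \<Omega> w g t" "?T = (LINT x|lebesgue_on \<Omega>. w x)"
      "?T = robin_energy \<beta> \<Omega> g t"
      by (rule robin_torsion_solution[OF \<beta> \<Omega>]) blast
    have L: "L2 (lebesgue_on \<Omega>) w" using w(1) by (simp add: H1_trace_def H1_def)
    have "?T\<^sup>2 \<le> (LINT x|lebesgue_on \<Omega>. (w x)\<^sup>2)"
      using LINT_sq_le[OF L, of 1] \<Omega> emeasure_lebesgue_on_self[OF \<Omega>(1)] unfolding w(2) by simp
    also have "\<dots> \<le> C * ?T" unfolding w(3) by (rule C'[OF \<Omega> w(1)])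
    finally have "?T * ?T \<le> C * ?T" by (simp add: power2_eq_square)
    then show ?thesis
      using robin_torsion_nonneg[OF \<beta> \<Omega>] C by (cases "?T = 0") (simp_all add: mult_le_cancel_right_pos)
  qed
  with C show ?thesis by (rule that)
qed

text \<open>The weak equation tested with the constant \<open>1\<close> fixes the boundary integral
  of the trace at \<open>1 / \<beta>\<close>. Cauchy--Schwarz on a boundary of measure at most
  \<open>P\<close> then bounds the boundary part of the energy from below.\<close>

lemma robin_torsion_ge:
  assumes \<beta>: "0 < \<beta>" and \<Omega>: "open \<Omega>" "bounded \<Omega>" "emeasure lborel \<Omega> = 1"
    and P: "emeasure (surface_measure \<Omega>) (space (surface_measure \<Omega>)) \<le> ennreal P" "0 < P"
  shows "1 / (\<beta> * P) \<le> robin_torsion \<beta> \<Omega>"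
proof -
  let ?T = "robin_torsion \<beta> \<Omega>"
  have \<Omega>1: "emeasure lborel \<Omega> \<le> 1" using \<Omega> by simp
  obtain w g t where w: "H1_trace \<Omega> w g t"
    "?T = robin_energy \<beta> \<Omega> g t"
    "\<And>v h s. H1_trace \<Omega> v h s \<Longrightarrow>
      (LINT x|lebesgue_on \<Omega>. g x \<bullet> h x) + \<beta> * (LINT x|surface_measure \<Omega>. t x * s x) = (LINT x|lebesgue_on \<Omega>. v x)"
    by (rule robin_torsion_solution[OF \<beta> \<Omega>(1,2) \<Omega>1]) blast
  have L: "L2 (surface_measure \<Omega>) t" using w(1) by (simp add: H1_trace_def)
  have "finite_measure (surface_measure \<Omega>)"
    using P(1) by (intro finite_measureI) (auto simp: top_unique)
  then have "L2 (surface_measure \<Omega>) (\<lambda>_. 1::real)" by (simp add: L2_def finite_measure.integrable_const)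
  then have "H1_trace \<Omega> (\<lambda>_. 1) (gradient (\<lambda>_. 1)) (\<lambda>_. 1)"
    by (intro H1_trace_smooth \<Omega> smooth_const)
  from w(3)[OF this] have "\<beta> * (LINT x|surface_measure \<Omega>. t x) = 1"
    using emeasure_lebesgue_on_self[OF \<Omega>(1)] \<Omega>(3) by (simp add: gradient_const measure_def)
  then have I: "(LINT x|surface_measure \<Omega>. t x) = 1 / \<beta>" using \<beta> by (simp add: field_simps)
  have "(1 / \<beta>)\<^sup>2 \<le> P * (LINT x|surface_measure \<Omega>. (t x)\<^sup>2)"
    using LINT_sq_le[OF L P(1)] P(2) unfolding I by simp
  then have "1 / (\<beta> * P) \<le> \<beta> * (LINT x|surface_measure \<Omega>. (t x)\<^sup>2)"
    using \<beta> P(2) by (simp add: field_simps power2_eq_square)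
  then show ?thesis unfolding w(2) by (simp add: add_increasing)
qed

lemma robin_eigenvalue_ge:
  assumes \<beta>: "0 < \<beta>" and \<Omega>: "open \<Omega>" "bounded \<Omega>" "emeasure lborel \<Omega> = 1"
    and P: "emeasure (surface_measure \<Omega>) (space (surface_measure \<Omega>)) < top"
    and ineq: "\<And>u g t. H1_trace \<Omega> u g t \<Longrightarrow> \<mu> * (LINT x|lebesgue_on \<Omega>. (u x)\<^sup>2)
       \<le> robin_energy \<beta> \<Omega> g t"
  shows "\<mu> \<le> robin_eigenvalue \<beta> \<Omega>"
  unfolding robin_eigenvalue_def
proof (rule cInf_greatest)
  \<comment> \<open>The infimum of the empty set of reals is unspecified, so a competitor is
    exhibited: the constant \<open>1\<close>, whose trace is square integrable because the boundary
    has finite measure.\<close>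
  have "finite_measure (surface_measure \<Omega>)"
    using P by (intro finite_measureI) auto
  then have "L2 (surface_measure \<Omega>) (\<lambda>_. 1::real)" by (simp add: L2_def finite_measure.integrable_const)
  then have "H1_trace \<Omega> (\<lambda>_. 1) (gradient (\<lambda>_. 1)) (\<lambda>_. 1)"
    by (intro H1_trace_smooth \<Omega> smooth_const)
  moreover have "\<not> (AE x in lebesgue_on \<Omega>. (1::real) = 0)"
    using emeasure_lebesgue_on_self[OF \<Omega>(1)] \<Omega>(3) by (simp add: ae_filter_eq_bot_iff eventually_const_iff)
  ultimately show "rayleigh_quotients \<beta> \<Omega> \<noteq> {}"
    by blast
next
  fix q assume "q \<in> rayleigh_quotients \<beta> \<Omega>"
  then obtain u g t where q: "q = robin_energy \<beta> \<Omega> g t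
            / (LINT x|lebesgue_on \<Omega>. (u x)\<^sup>2)" and u: "H1_trace \<Omega> u g t" "\<not> (AE x in lebesgue_on \<Omega>. u x = 0)"
    by blast
  have L: "L2 (lebesgue_on \<Omega>) u" using u(1) by (simp add: H1_trace_def H1_def)
  have "(LINT x|lebesgue_on \<Omega>. (u x)\<^sup>2) \<noteq> 0"
    using u(2) L2_integrable[OF L] by (simp add: integral_nonneg_eq_0_iff_AE)
  moreover have "0 \<le> (LINT x|lebesgue_on \<Omega>. (u x)\<^sup>2)" by simp
  ultimately have "0 < (LINT x|lebesgue_on \<Omega>. (u x)\<^sup>2)" by linarith
  with ineq[OF u(1)] show "\<mu> \<le> q" unfolding q by (simp add: pos_le_divide_eq)
qed

section \<open>Hausdorff measure on coordinate hyperplanes\<close>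

text \<open>Uniqueness of Haar measure, obtained by integrating
  \<open>indicator A (x + y) * indicator B y\<close> in both orders. The unit volume of
  \<open>B\<close> allows its indicator to be inserted, and its symmetry turns \<open>y - x\<close>
  into \<open>x - y\<close>, so that translation invariance of \<open>\<nu>\<close>
  suffices.\<close>

lemma translation_invariant_measure_eq:
  fixes \<nu> :: "'a::euclidean_space measure"
  assumes sets [measurable_cong]: "sets \<nu> = sets borel" and \<sigma>: "sigma_finite_measure \<nu>"
    and inv: "\<And>v. distr \<nu> borel ((+) v) = \<nu>"
    and B [measurable]: "B \<in> sets borel" and sym: "\<And>x. - x \<in> B \<longleftrightarrow> x \<in> B" and B1: "emeasure lborel B = 1"
    and A [measurable]: "A \<in> sets borel"
  shows "emeasure \<nu> A = emeasure \<nu> B * emeasure lborel A"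
proof -
  interpret \<nu>: sigma_finite_measure \<nu> by (rule \<sigma>)
  interpret P: pair_sigma_finite \<nu> lborel ..
  have shift: "(\<integral>\<^sup>+x. f (x + v) \<partial>\<nu>) = (\<integral>\<^sup>+x. f x \<partial>\<nu>)" if [measurable]: "f \<in> borel_measurable borel" for f v
  proof -
    have "(\<integral>\<^sup>+x. f x \<partial>distr \<nu> borel ((+) v)) = (\<integral>\<^sup>+x. f (v + x) \<partial>\<nu>)"
      by (rule nn_integral_distr) simp_all
    then show ?thesis by (simp only: inv add.commute)
  qed
  have "emeasure \<nu> A = (\<integral>\<^sup>+x. indicator A x \<partial>\<nu>)" by (simp add: sets)
  also have "\<dots> = (\<integral>\<^sup>+y. (\<integral>\<^sup>+x. indicator A x \<partial>\<nu>) * indicator B y \<partial>lborel)"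
    using B1 by (subst nn_integral_cmult_indicator) (simp_all)
  also have "\<dots> = (\<integral>\<^sup>+y. \<integral>\<^sup>+x. indicator A (x + y) * indicator B y \<partial>\<nu> \<partial>lborel)"
  proof (rule nn_integral_cong)
    fix y :: 'a
    have "(\<integral>\<^sup>+x. indicator A (x + y) * indicator B y \<partial>\<nu>) = (\<integral>\<^sup>+x. indicator A (x + y) \<partial>\<nu>) * indicator B y"
      by (rule nn_integral_multc) measurable
    also have "(\<integral>\<^sup>+x. indicator A (x + y) \<partial>\<nu>) = (\<integral>\<^sup>+x. indicator A x \<partial>\<nu>)"
      by (rule shift) measurable
    finally show "(\<integral>\<^sup>+x. indicator A x \<partial>\<nu>) * indicator B y = (\<integral>\<^sup>+x. indicator A (x + y) * indicator B y \<partial>\<nu>)" by simp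
  qed
  also have "\<dots> = (\<integral>\<^sup>+x. \<integral>\<^sup>+y. indicator A (x + y) * indicator B y \<partial>lborel \<partial>\<nu>)"
    by (rule P.Fubini') measurable
  also have "\<dots> = (\<integral>\<^sup>+x. \<integral>\<^sup>+y. indicator A y * indicator B (y - x) \<partial>lborel \<partial>\<nu>)"
  proof (rule nn_integral_cong)
    fix x :: 'a
    have "(\<integral>\<^sup>+y. indicator A (x + y) * indicator B y \<partial>lborel)
       = (\<integral>\<^sup>+y. (\<lambda>y. indicator A y * indicator B (y - x)) (y + x) \<partial>lborel)"
      by (simp add: add.commute)
    also have "\<dots> = (\<integral>\<^sup>+y. indicator A y * indicator B (y - x) \<partial>lborel)"
      by (rule nn_integral_lborel_translation) measurable
    finally show "(\<integral>\<^sup>+y. indicator A (x + y) * indicator B y \<partial>lborel) = (\<integral>\<^sup>+y. indicator A y * indicator B (y - x) \<partial>lborel)" .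
  qed
  also have "\<dots> = (\<integral>\<^sup>+y. \<integral>\<^sup>+x. indicator A y * indicator B (y - x) \<partial>\<nu> \<partial>lborel)"
    by (rule P.Fubini'[symmetric]) measurable
  also have "\<dots> = (\<integral>\<^sup>+y. emeasure \<nu> B * indicator A y \<partial>lborel)"
  proof (rule nn_integral_cong)
    fix y :: 'a
    have "indicator B (y - x) = (indicator B (x + (- y)) :: ennreal)" for x
      using sym[of "x - y"] by (simp add: indicator_def)
    then have "(\<integral>\<^sup>+x. indicator A y * indicator B (y - x) \<partial>\<nu>) = indicator A y * (\<integral>\<^sup>+x. indicator B (x + (- y)) \<partial>\<nu>)"
      by (simp add: nn_integral_cmult)
    also have "(\<integral>\<^sup>+x. indicator B (x + (- y)) \<partial>\<nu>) = (\<integral>\<^sup>+x. indicator B x \<partial>\<nu>)"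
      by (rule shift) measurable
    finally show "(\<integral>\<^sup>+x. indicator A y * indicator B (y - x) \<partial>\<nu>) = emeasure \<nu> B * indicator A y"
      by (simp add: mult.commute sets)
  qed
  also have "\<dots> = emeasure \<nu> B * emeasure lborel A" by (rule nn_integral_cmult_indicator) simp
  finally show ?thesis .
qed

section \<open>Finite Hausdorff measure of bounded pieces of hyperplanes\<close>

lemma hausdorff_content_le_finite_cover:
  assumes "finite I" "A \<subseteq> (\<Union>i\<in>I. U i)" "\<And>i. i \<in> I \<Longrightarrow> bounded (U i)" "\<And>i. i \<in> I \<Longrightarrow> diameter (U i) \<le> \<delta>" "0 \<le> \<delta>"
  shows "hausdorff_content k \<delta> A \<le> (\<Sum>i\<in>I. hausdorff_weight k (U i))"
proof -
  obtain h where h: "bij_betw h {0..<card I} I" using ex_bij_betw_nat_finite[OF assms(1)] by blast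
  define V where "V n = (if n < card I then U (h n) else {})" for n
  have hI: "h n \<in> I" if "n < card I" for n using h that by (auto simp: bij_betw_def)
  have "hausdorff_content k \<delta> A \<le> (\<Sum>n. hausdorff_weight k (V n))"
  proof (rule hausdorff_content_le_cover)
    show "A \<subseteq> (\<Union>n. V n)"
    proof
      fix x assume "x \<in> A"
      then obtain i where i: "i \<in> I" "x \<in> U i" using assms(2) by blast
      then have "i \<in> h ` {0..<card I}" using h by (simp add: bij_betw_def)
      then obtain n where "n < card I" "h n = i" by auto
      then have "x \<in> V n" using i by (simp add: V_def)
      then show "x \<in> (\<Union>n. V n)" by blast
    qed
    show "bounded (V n)" for n using assms(3)[OF hI[of n]] by (simp add: V_def)
    show "diameter (V n) \<le> \<delta>" for n using assms(4)[OF hI[of n]] assms(5) by (simp add: V_def)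
  qed
  also have "\<dots> = (\<Sum>n\<in>{0..<card I}. hausdorff_weight k (V n))"
    by (rule suminf_finite) (auto simp: V_def)
  also have "\<dots> = (\<Sum>n\<in>{0..<card I}. hausdorff_weight k (U (h n)))"
    by (intro sum.cong) (auto simp: V_def)
  also have "\<dots> = (\<Sum>i\<in>I. hausdorff_weight k (U i))"
    by (rule sum.reindex_bij_betw[OF h])
  finally show ?thesis .
qed

lemma exists_grid_index:
  fixes t L :: real
  assumes "0 \<le> t" "t \<le> L" "0 < L" "0 < m"
  shows "\<exists>j<m. real j * L / real m \<le> t \<and> t \<le> (real j + 1) * L / real m"
\<comment> \<open>The right end point belongs to the last cell, since the floor would give index
  \<open>m\<close>.\<close>
proof (cases "t = L")
  case True
  have "real (m - 1) + 1 = real m" using assms(4) by simp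
  then show ?thesis using True assms
    by (intro exI[of _ "m - 1"]) (auto simp: field_simps)
next
  case False
  define j where "j = nat \<lfloor>t * m / L\<rfloor>"
  have "0 \<le> t * m / L" using assms by simp
  then have j: "real j \<le> t * m / L" "t * m / L < real j + 1"
    unfolding j_def by (simp_all add: of_nat_nat)
  have "t * m / L < real m" using False assms by (simp add: field_simps)
  then have "j < m" using j(1) by linarith
  then show ?thesis using j assms by (intro exI[of _ j]) (auto simp: field_simps)
qed

text \<open>A grid of \<open>m ^ (DIM('a) - 1)\<close> cells, each of diameter at most
  \<open>DIM('a) * L / m\<close>, has total weight independent of \<open>m\<close>, so contents at
  all scales share one bound. The crude diameter comes from the sum norm and affects only the
  constant.\<close>

lemma hausdorff_outer_hyperplane_cube_finite:
  fixes i :: "'a::euclidean_space"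
  assumes i: "i \<in> Basis" and L: "0 < L"
  shows "hausdorff_outer (DIM('a) - 1) {y::'a. y \<bullet> i = 0 \<and> (\<forall>b\<in>Basis - {i}. 0 \<le> y \<bullet> b \<and> y \<bullet> b \<le> L)} < top"
proof -
  let ?F = "{y::'a. y \<bullet> i = 0 \<and> (\<forall>b\<in>Basis - {i}. 0 \<le> y \<bullet> b \<and> y \<bullet> b \<le> L)}"
  let ?k = "DIM('a) - 1" and ?v = "unit_ball_vol (real (DIM('a) - 1))"
  define C where "C = ?v * (real DIM('a) * L / 2) ^ ?k"
  have "hausdorff_content ?k \<delta> ?F \<le> ennreal C" if \<delta>: "0 < \<delta>" for \<delta>
  proof -
    obtain m0 :: nat where m0: "real DIM('a) * L / \<delta> < real m0" using reals_Archimedean2 by blast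
    define m where "m = Suc m0"
    have m: "0 < m" "real DIM('a) * L / real m \<le> \<delta>"
      using m0 \<delta> by (auto simp: m_def field_simps)
    define I where "I = PiE (Basis - {i}) (\<lambda>_. {..<m})"
    define U where "U j = {y::'a. y \<bullet> i = 0 \<and> (\<forall>b\<in>Basis - {i}. real (j b) * L / m \<le> y \<bullet> b \<and> y \<bullet> b \<le> (real (j b) + 1) * L / m)}" for j
    have finI: "finite I" unfolding I_def by (intro finite_PiE) auto
    have cardI: "card I = m ^ ?k" using i unfolding I_def by (simp add: card_PiE card_Diff_singleton)
    have dist_le: "dist y z \<le> real DIM('a) * L / m" if "y \<in> U j" "z \<in> U j" for y z j
    proof -
      have "dist y z \<le> (\<Sum>b\<in>Basis. \<bar>(y - z) \<bullet> b\<bar>)" unfolding dist_norm by (rule norm_le_l1)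
      also have "\<dots> \<le> (\<Sum>b\<in>(Basis::'a set). L / m)"
      proof (rule sum_mono)
        fix b :: 'a assume b: "b \<in> Basis"
        show "\<bar>(y - z) \<bullet> b\<bar> \<le> L / m"
        proof (cases "b = i")
          case True then show ?thesis using that L by (simp add: U_def inner_simps)
        next
          case False
          have "(real (j b) + 1) * L / m - real (j b) * L / m = L / m" by (simp add: distrib_right add_divide_distrib)
          moreover have "real (j b) * L / m \<le> y \<bullet> b" "y \<bullet> b \<le> (real (j b) + 1) * L / m"
            "real (j b) * L / m \<le> z \<bullet> b" "z \<bullet> b \<le> (real (j b) + 1) * L / m"
            using that b False by (auto simp: U_def)
          ultimately show ?thesis unfolding inner_diff_left by linarith
        qed
      qed
      finally show ?thesis by simp
    qed
    have diam: "diameter (U j) \<le> real DIM('a) * L / m" for j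
      using L by (intro diameter_le) (auto intro: dist_le simp: dist_norm[symmetric])
    have bdd: "bounded (U j)" for j
      unfolding bounded_def
    proof (cases "U j = {}")
      case False
      then obtain y where "y \<in> U j" by blast
      then show "\<exists>x e. \<forall>y\<in>U j. dist x y \<le> e" using dist_le by blast
    qed auto
    have weight: "hausdorff_weight ?k (U j) \<le> ennreal (?v * (real DIM('a) * L / m / 2) ^ ?k)" for j
    proof -
      have "?v * (diameter (U j) / 2) ^ ?k \<le> ?v * (real DIM('a) * L / m / 2) ^ ?k"
        using diam[of j] diameter_ge_0[OF bdd[of j]]
        by (intro mult_left_mono power_mono divide_right_mono) auto
      then show ?thesis unfolding hausdorff_weight_def by (auto intro: ennreal_leI)
    qed
    have "hausdorff_content ?k \<delta> ?F \<le> (\<Sum>j\<in>I. hausdorff_weight ?k (U j))"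
    proof (rule hausdorff_content_le_finite_cover[OF finI])
      show "?F \<subseteq> (\<Union>j\<in>I. U j)"
      proof
        fix y assume y: "y \<in> ?F"
        have "\<forall>b\<in>Basis - {i}. \<exists>j<m. real j * L / real m \<le> y \<bullet> b \<and> y \<bullet> b \<le> (real j + 1) * L / real m"
          using y L m(1) by (intro ballI exists_grid_index) auto
        then obtain j where j: "\<And>b. b \<in> Basis - {i} \<Longrightarrow> j b < m \<and> real (j b) * L / real m \<le> y \<bullet> b \<and> y \<bullet> b \<le> (real (j b) + 1) * L / real m"
          by metis
        have "y \<in> U (restrict j (Basis - {i}))" using y j by (simp add: U_def)
        moreover have "restrict j (Basis - {i}) \<in> I" using j by (auto simp: I_def)
        ultimately show "y \<in> (\<Union>j\<in>I. U j)" by blast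
      qed
    qed (use bdd diam m(2) \<delta> in \<open>auto intro: order_trans\<close>)
    also have "\<dots> \<le> (\<Sum>j\<in>I. ennreal (?v * (real DIM('a) * L / m / 2) ^ ?k))"
      by (intro sum_mono weight)
    also have "\<dots> = of_nat (m ^ ?k) * ennreal (?v * (real DIM('a) * L / m / 2) ^ ?k)" by (simp add: cardI)
    also have "\<dots> = ennreal (real (m ^ ?k) * (?v * (real DIM('a) * L / m / 2) ^ ?k))"
      using L by (simp add: ennreal_mult ennreal_of_nat_eq_real_of_nat)
    also have "real (m ^ ?k) * (?v * (real DIM('a) * L / m / 2) ^ ?k) = C"
      using m(1) by (simp add: C_def power_divide)
    finally show ?thesis .
  qed
  then have "hausdorff_outer ?k ?F \<le> ennreal C"
    unfolding hausdorff_outer_def by (intro SUP_least) auto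
  then show ?thesis by (rule le_less_trans) simp
qed

text \<open>The product of the Hausdorff measure on a coordinate hyperplane with one-dimensional Lebesgue
  measure is translation invariant, hence a multiple of Lebesgue measure.\<close>

lemma hausdorff_hyperplane_Fubini:
  fixes i :: "'a::euclidean_space"
  assumes i: "i \<in> Basis"
  shows "\<exists>c\<ge>0. \<forall>f\<in>borel_measurable borel.
    (\<integral>\<^sup>+y. (\<integral>\<^sup>+s. f (y + s *\<^sub>R i) \<partial>lborel) * indicator {y. y \<bullet> i = 0} y \<partial>hausdorff_measure (DIM('a) - 1))
      = ennreal c * (\<integral>\<^sup>+x. f x \<partial>lborel)"
proof -
  let ?H = "hausdorff_measure (DIM('a) - 1) :: 'a measure"
  let ?P = "{y::'a. y \<bullet> i = 0}"
  have ii: "i \<bullet> i = 1" using i by simp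
  have [measurable]: "?P \<in> sets borel"
    by (intro borel_closed closed_Collect_eq continuous_intros)
  define \<mu> where "\<mu> = density ?H (indicator ?P)"
  have sets\<mu> [measurable_cong]: "sets \<mu> = sets borel" by (simp add: \<mu>_def)
  define \<nu> where "\<nu> = distr (\<mu> \<Otimes>\<^sub>M lborel) borel (\<lambda>(y, s). y + s *\<^sub>R i)"
  have sets\<nu>: "sets \<nu> = sets borel" by (simp add: \<nu>_def)
  have int\<nu>: "(\<integral>\<^sup>+x. f x \<partial>\<nu>) = (\<integral>\<^sup>+y. (\<integral>\<^sup>+s. f (y + s *\<^sub>R i) \<partial>lborel) * indicator ?P y \<partial>?H)"
    if [measurable]: "f \<in> borel_measurable borel" for f
  proof -
    have "(\<integral>\<^sup>+x. f x \<partial>\<nu>) = (\<integral>\<^sup>+z. f (case z of (y, s) \<Rightarrow> y + s *\<^sub>R i) \<partial>(\<mu> \<Otimes>\<^sub>M lborel))"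
      unfolding \<nu>_def by (rule nn_integral_distr) measurable
    also have "\<dots> = (\<integral>\<^sup>+y. \<integral>\<^sup>+s. f (case (y, s) of (y, s) \<Rightarrow> y + s *\<^sub>R i) \<partial>lborel \<partial>\<mu>)"
      by (rule lborel.nn_integral_fst[symmetric]) measurable
    also have "\<dots> = (\<integral>\<^sup>+y. indicator ?P y * (\<integral>\<^sup>+s. f (y + s *\<^sub>R i) \<partial>lborel) \<partial>?H)"
      unfolding \<mu>_def by (subst nn_integral_density) (auto simp: measurable_cong_sets[OF sets_hausdorff_measure refl])
    finally show ?thesis by (simp add: mult.commute)
  qed
  have inv: "distr \<nu> borel ((+) v) = \<nu>" for v
  proof (rule measure_eqI)
    fix A assume "A \<in> sets (distr \<nu> borel ((+) v))"
    then have A [measurable]: "A \<in> sets borel" by simp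
    \<comment> \<open>The component of \<open>v\<close> in the hyperplane is absorbed by translation
      invariance of the Hausdorff measure, the component along \<open>i\<close> by that of Lebesgue
      measure on the line.\<close>
    define v' where "v' = v - (v \<bullet> i) *\<^sub>R i"
    have v': "v = v' + (v \<bullet> i) *\<^sub>R i" "v' \<bullet> i = 0" by (simp_all add: v'_def inner_simps ii)
    define g where "g y = (\<integral>\<^sup>+s. indicator A (y + s *\<^sub>R i) \<partial>lborel) * indicator ?P y" for y
    have [measurable]: "g \<in> borel_measurable borel" unfolding g_def by measurable
    have "emeasure (distr \<nu> borel ((+) v)) A = (\<integral>\<^sup>+x. indicator A x \<partial>distr \<nu> borel ((+) v))" by simp
    also have "\<dots> = (\<integral>\<^sup>+x. indicator A (v + x) \<partial>\<nu>)"
      by (rule nn_integral_distr) (simp_all add: measurable_cong_sets[OF sets\<nu> refl])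
    also have "\<dots> = (\<integral>\<^sup>+y. (\<integral>\<^sup>+s. indicator A (v + (y + s *\<^sub>R i)) \<partial>lborel) * indicator ?P y \<partial>?H)"
      by (rule int\<nu>) measurable
    also have "\<dots> = (\<integral>\<^sup>+y. g (v' + y) \<partial>?H)"
    proof (rule nn_integral_cong)
      fix y
      have "(\<integral>\<^sup>+s. indicator A (v + (y + s *\<^sub>R i)) \<partial>lborel)
         = (\<integral>\<^sup>+s. (\<lambda>s. indicator A (v' + y + s *\<^sub>R i)) (s + v \<bullet> i) \<partial>lborel)"
        by (subst v'(1)) (simp add: algebra_simps)
      also have "\<dots> = (\<integral>\<^sup>+s. indicator A (v' + y + s *\<^sub>R i) \<partial>lborel)"
        by (rule nn_integral_lborel_translation) measurable
      finally show "(\<integral>\<^sup>+s. indicator A (v + (y + s *\<^sub>R i)) \<partial>lborel) * indicator ?P y = g (v' + y)"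
        by (simp add: g_def indicator_def inner_simps v'(2))
    qed
    also have "\<dots> = (\<integral>\<^sup>+y. g y \<partial>?H)" by (rule nn_integral_hausdorff_translation) measurable
    also have "\<dots> = (\<integral>\<^sup>+x. indicator A x \<partial>\<nu>)" unfolding g_def by (rule int\<nu>[symmetric]) measurable
    also have "\<dots> = emeasure \<nu> A" by (simp add: sets\<nu>)
    finally show "emeasure (distr \<nu> borel ((+) v)) A = emeasure \<nu> A" .
  qed (simp add: sets\<nu>)
  \<comment> \<open>Finiteness on boxes gives sigma-finiteness, on which Tonelli's theorem rests,
    and makes the proportionality constant finite.\<close>
  have box_finite: "emeasure \<nu> (box (- (real n + 1) *\<^sub>R One) ((real n + 1) *\<^sub>R One)) < top" for n
  proof -
    let ?l = "real n + 1"
    let ?F = "{y::'a. y \<bullet> i = 0 \<and> (\<forall>b\<in>Basis - {i}. 0 \<le> y \<bullet> b \<and> y \<bullet> b \<le> 2 * ?l)}"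
    let ?F' = "{y::'a. y \<bullet> i = 0 \<and> (\<forall>b\<in>Basis - {i}. \<bar>y \<bullet> b\<bar> \<le> ?l)}"
    \<comment> \<open>The translation moves the symmetric cube to one starting at the origin; its
      component along \<open>i\<close> is cancelled so that the hyperplane is preserved.\<close>
    have F'_sub: "?F' \<subseteq> (+) (- (?l *\<^sub>R One) + ?l *\<^sub>R i) ` ?F"
    proof
      fix y assume y: "y \<in> ?F'"
      have "y + ?l *\<^sub>R One - ?l *\<^sub>R i \<in> ?F"
      proof (intro CollectI conjI ballI)
        show "(y + ?l *\<^sub>R One - ?l *\<^sub>R i) \<bullet> i = 0" using y i by (simp add: inner_simps ii)
        fix b assume b: "b \<in> Basis - {i}"
        then have eq: "(y + ?l *\<^sub>R One - ?l *\<^sub>R i) \<bullet> b = y \<bullet> b + ?l"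
          using i by (auto simp: inner_simps inner_Basis)
        have "\<bar>y \<bullet> b\<bar> \<le> ?l" using y b by blast
        then have "- ?l \<le> y \<bullet> b" "y \<bullet> b \<le> ?l" by (simp_all only: abs_le_iff minus_le_iff)
        then show "0 \<le> (y + ?l *\<^sub>R One - ?l *\<^sub>R i) \<bullet> b" "(y + ?l *\<^sub>R One - ?l *\<^sub>R i) \<bullet> b \<le> 2 * ?l"
          unfolding eq by simp_all
      qed
      then show "y \<in> (+) (- (?l *\<^sub>R One) + ?l *\<^sub>R i) ` ?F"
        by (intro image_eqI[of _ _ "y + ?l *\<^sub>R One - ?l *\<^sub>R i"]) auto
    qed
    have "?F' = ?P \<inter> (\<Inter>b\<in>Basis - {i}. {y. \<bar>y \<bullet> b\<bar> \<le> ?l})" by auto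
    then have "closed ?F'"
      by (auto intro!: closed_Int closed_INT closed_Collect_le closed_Collect_eq continuous_intros)
    then have F'_meas: "?F' \<in> sets borel" by simp
    have "emeasure \<nu> (box (- ?l *\<^sub>R One) (?l *\<^sub>R One)) = (\<integral>\<^sup>+x. indicator (box (- ?l *\<^sub>R One) (?l *\<^sub>R One)) x \<partial>\<nu>)"
      by (simp add: sets\<nu>)
    also have "\<dots> = (\<integral>\<^sup>+y. (\<integral>\<^sup>+s. indicator (box (- ?l *\<^sub>R One) (?l *\<^sub>R One)) (y + s *\<^sub>R i) \<partial>lborel) * indicator ?P y \<partial>?H)"
      by (rule int\<nu>) simp
    also have "\<dots> \<le> (\<integral>\<^sup>+y. ennreal (2 * ?l) * indicator ?F' y \<partial>?H)"
    proof (rule nn_integral_mono)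
      fix y :: 'a
      have sub: "y + s *\<^sub>R i \<in> box (- ?l *\<^sub>R One) (?l *\<^sub>R One) \<Longrightarrow> y \<in> ?P \<Longrightarrow> y \<in> ?F' \<and> s \<in> {- ?l..?l}" for s
      proof -
        assume x: "y + s *\<^sub>R i \<in> box (- ?l *\<^sub>R One) (?l *\<^sub>R One)" and y: "y \<in> ?P"
        have "\<bar>y \<bullet> b\<bar> \<le> ?l" if b: "b \<in> Basis - {i}" for b
        proof -
          have "i \<bullet> b = 0" using b i by (auto simp: inner_Basis)
          then show ?thesis using x b by (auto simp: mem_box inner_simps abs_le_iff dest!: bspec[of _ _ b])
        qed
        moreover have "- ?l < s" "s < ?l" using x y i ii by (auto simp: mem_box inner_simps dest!: bspec[of _ _ i])
        ultimately show "y \<in> ?F' \<and> s \<in> {- ?l..?l}" using y by auto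
      qed
      have "(\<integral>\<^sup>+s. indicator (box (- ?l *\<^sub>R One) (?l *\<^sub>R One)) (y + s *\<^sub>R i) \<partial>lborel) * indicator ?P y
         \<le> (\<integral>\<^sup>+s. indicator ?F' y * indicator {- ?l..?l} s \<partial>lborel)"
      proof (cases "y \<in> ?P")
        case True
        then have "(\<integral>\<^sup>+s. indicator (box (- ?l *\<^sub>R One) (?l *\<^sub>R One)) (y + s *\<^sub>R i) \<partial>lborel)
         \<le> (\<integral>\<^sup>+s. indicator ?F' y * indicator {- ?l..?l} s \<partial>lborel)"
          using sub by (intro nn_integral_mono) (auto simp: indicator_def)
        with True show ?thesis by simp
      qed simp
      also have "\<dots> = indicator ?F' y * ennreal (2 * ?l)"
        by (subst nn_integral_cmult_indicator) simp_all
      finally show "(\<integral>\<^sup>+s. indicator (box (- ?l *\<^sub>R One) (?l *\<^sub>R One)) (y + s *\<^sub>R i) \<partial>lborel) * indicator ?P y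
        \<le> ennreal (2 * ?l) * indicator ?F' y" by (simp add: mult.commute)
    qed
    also have "\<dots> = ennreal (2 * ?l) * emeasure ?H ?F'" using F'_meas by (intro nn_integral_cmult_indicator) simp
    also have "emeasure ?H ?F' = hausdorff_outer (DIM('a) - 1) ?F'" using F'_meas by (rule emeasure_hausdorff_measure)
    also have "\<dots> \<le> hausdorff_outer (DIM('a) - 1) ?F"
      using hausdorff_outer_mono[OF F'_sub] by (simp only: hausdorff_outer_translation)
    finally have "emeasure \<nu> (box (- ?l *\<^sub>R One) (?l *\<^sub>R One)) \<le> ennreal (2 * ?l) * hausdorff_outer (DIM('a) - 1) ?F"
      by (simp add: mult_left_mono)
    also have "\<dots> < top"
      using hausdorff_outer_hyperplane_cube_finite[OF i, of "2 * ?l"] by (auto simp: ennreal_mult_less_top)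
    finally show ?thesis .
  qed
  have cover: "\<exists>n. x \<in> box (- (real n + 1) *\<^sub>R One) ((real n + 1) *\<^sub>R One)" for x :: 'a
  proof -
    obtain n :: nat where n: "norm x < real n" using reals_Archimedean2 by blast
    have "x \<in> box (- (real n + 1) *\<^sub>R One) ((real n + 1) *\<^sub>R One)"
      unfolding mem_box
    proof (intro ballI conjI)
      fix b :: 'a assume b: "b \<in> Basis"
      then have "\<bar>x \<bullet> b\<bar> \<le> norm x" by (rule Basis_le_norm)
      with n have "- (real n + 1) < x \<bullet> b" "x \<bullet> b < real n + 1" by linarith+
      then show "(- (real n + 1) *\<^sub>R One) \<bullet> b < x \<bullet> b" "x \<bullet> b < ((real n + 1) *\<^sub>R One) \<bullet> b"
        using b by simp_all
    qed
    then show ?thesis by blast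
  qed
  have \<sigma>: "sigma_finite_measure \<nu>"
  proof
    let ?A = "range (\<lambda>n. box (- (real n + 1) *\<^sub>R One) ((real n + 1) *\<^sub>R One)) :: 'a set set"
    have "\<Union>?A = space \<nu>" using cover by (auto simp: \<nu>_def)
    moreover have "\<forall>a\<in>?A. emeasure \<nu> a \<noteq> \<infinity>"
      using box_finite by (simp only: infinity_ennreal_def) (blast dest: less_imp_neq)
    ultimately show "\<exists>A. countable A \<and> A \<subseteq> sets \<nu> \<and> \<Union>A = space \<nu> \<and> (\<forall>a\<in>A. emeasure \<nu> a \<noteq> \<infinity>)"
      by (intro exI[of _ ?A]) (auto simp: sets\<nu>)
  qed
  let ?B = "box (- (1/2) *\<^sub>R One) ((1/2) *\<^sub>R One) :: 'a set"
  have sym: "- x \<in> ?B \<longleftrightarrow> x \<in> ?B" for x :: 'a by (auto simp: mem_box)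
  have B1: "emeasure lborel ?B = 1"
    by (subst emeasure_lborel_box) (auto simp: inner_simps)
  have \<nu>A: "emeasure \<nu> A = emeasure \<nu> ?B * emeasure lborel A" if "A \<in> sets borel" for A
    by (rule translation_invariant_measure_eq[OF sets\<nu> \<sigma> inv _ sym B1 that]) simp
  have "emeasure \<nu> ?B \<le> emeasure \<nu> (box (- (real 0 + 1) *\<^sub>R One) ((real 0 + 1) *\<^sub>R One))"
    by (intro emeasure_mono subset_box_imp(4)) (simp_all add: sets\<nu>)
  then have fin: "emeasure \<nu> ?B < top" using box_finite[of 0] by (rule le_less_trans)
  define c where "c = enn2real (emeasure \<nu> ?B)"
  have c: "0 \<le> c" "emeasure \<nu> ?B = ennreal c"
    unfolding c_def by (rule enn2real_nonneg) (rule ennreal_enn2real[OF fin, symmetric])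
  note \<nu>A' = \<nu>A[unfolded c(2)]
  have "\<nu> = scale_measure (ennreal c) lborel"
    by (rule measure_eqI) (simp_all add: sets\<nu> \<nu>A')
  then have "(\<integral>\<^sup>+x. f x \<partial>\<nu>) = ennreal c * (\<integral>\<^sup>+x. f x \<partial>lborel)" if "f \<in> borel_measurable borel" for f
    using that by (simp add: nn_integral_scale_measure)
  with c(1) int\<nu> show ?thesis by (intro exI[of _ c]) auto
qed

section \<open>Cubes and their faces\<close>

abbreviation cube :: "'a::euclidean_space \<Rightarrow> real \<Rightarrow> 'a set" where
  "cube p r \<equiv> box p (p + r *\<^sub>R One)"

abbreviation closed_cube :: "'a::euclidean_space \<Rightarrow> real \<Rightarrow> 'a set" where
  "closed_cube p r \<equiv> cbox p (p + r *\<^sub>R One)"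

text \<open>The offset \<open>a\<close> is \<open>0\<close> or \<open>r\<close> for the two faces
  orthogonal to \<open>i\<close>. Open faces are pairwise disjoint parts of the frontier and serve
  the trace estimate; closed faces cover the frontier and serve the perimeter bound.\<close>

definition open_face :: "'a::euclidean_space \<Rightarrow> real \<Rightarrow> 'a \<Rightarrow> real \<Rightarrow> 'a set" where
  "open_face p r i a = {x. x \<bullet> i = p \<bullet> i + a \<and> (\<forall>b\<in>Basis - {i}. p \<bullet> b < x \<bullet> b \<and> x \<bullet> b < p \<bullet> b + r)}"

definition closed_face :: "'a::euclidean_space \<Rightarrow> real \<Rightarrow> 'a \<Rightarrow> real \<Rightarrow> 'a set" where
  "closed_face p r i a = {x. x \<bullet> i = p \<bullet> i + a \<and> (\<forall>b\<in>Basis - {i}. p \<bullet> b \<le> x \<bullet> b \<and> x \<bullet> b \<le> p \<bullet> b + r)}"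

lemma closed_closed_face: "closed (closed_face p r i a)"
proof -
  have "closed_face p r i a = {x. x \<bullet> i = p \<bullet> i + a} \<inter> (\<Inter>b\<in>Basis - {i}. {x. p \<bullet> b \<le> x \<bullet> b} \<inter> {x. x \<bullet> b \<le> p \<bullet> b + r})"
    by (auto simp: closed_face_def)
  then show ?thesis
    by (auto intro!: closed_Int closed_INT closed_Collect_le closed_Collect_eq continuous_intros)
qed

lemma borel_open_face [measurable]: "open_face p r i a \<in> sets borel"
proof -
  have eq: "open_face p r i a = {x. x \<bullet> i = p \<bullet> i + a} \<inter> (\<Inter>b\<in>Basis - {i}. {x. p \<bullet> b < x \<bullet> b} \<inter> {x. x \<bullet> b < p \<bullet> b + r})"
    by (auto simp: open_face_def)
  have "closed {x. x \<bullet> i = p \<bullet> i + a}" by (intro closed_Collect_eq continuous_intros)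
  moreover have "open (\<Inter>b\<in>Basis - {i}. {x. p \<bullet> b < x \<bullet> b} \<inter> {x. x \<bullet> b < p \<bullet> b + r})"
    by (intro open_INT ballI open_Int open_Collect_less continuous_intros) simp
  ultimately show ?thesis unfolding eq by (intro sets.Int borel_closed borel_open)
qed

lemma inner_line_coordinate:
  fixes i :: "'a::euclidean_space"
  assumes "i \<in> Basis" "b \<in> Basis"
  shows "(y + s *\<^sub>R i) \<bullet> b = (if b = i then y \<bullet> i + s else y \<bullet> b)"
  using assms by (auto simp: inner_simps inner_Basis)

text \<open>In this form the slices of the cube in direction \<open>i\<close> are intervals of
  length \<open>r\<close> over the projection of a face, so the inner integral of
  \<open>face_constant_Fubini\<close> becomes explicit.\<close>

lemma line_in_cube_iff:
  fixes i :: "'a::euclidean_space"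
  assumes i: "i \<in> Basis" and y: "y \<bullet> i = 0"
  shows "y + s *\<^sub>R i \<in> cube p r \<longleftrightarrow> y \<in> open_face (p - (p \<bullet> i) *\<^sub>R i) r i 0 \<and> p \<bullet> i < s \<and> s < p \<bullet> i + r"
proof -
  have p: "(p - (p \<bullet> i) *\<^sub>R i) \<bullet> b = (if b = i then 0 else p \<bullet> b)" if "b \<in> Basis" for b
    using inner_line_coordinate[OF i that, of p "- (p \<bullet> i)"] by simp
  have l: "(y + s *\<^sub>R i) \<bullet> b = (if b = i then s else y \<bullet> b)" if "b \<in> Basis" for b
    using inner_line_coordinate[OF i that, of y s] y by simp
  have q: "(p + r *\<^sub>R One) \<bullet> b = p \<bullet> b + r" if "b \<in> Basis" for b
    using that by (simp add: inner_add_left)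
  have "y + s *\<^sub>R i \<in> cube p r \<longleftrightarrow> (\<forall>b\<in>Basis. p \<bullet> b < (if b = i then s else y \<bullet> b) \<and> (if b = i then s else y \<bullet> b) < p \<bullet> b + r)"
    by (simp only: mem_box l q cong: ball_cong)
  also have "\<dots> \<longleftrightarrow> y \<in> open_face (p - (p \<bullet> i) *\<^sub>R i) r i 0 \<and> p \<bullet> i < s \<and> s < p \<bullet> i + r"
    using i y by (auto simp: open_face_def p)
  finally show ?thesis .
qed

lemma line_in_closed_cube_iff:
  fixes i :: "'a::euclidean_space"
  assumes i: "i \<in> Basis" and y: "y \<bullet> i = 0"
  shows "y + s *\<^sub>R i \<in> closed_cube p r \<longleftrightarrow> y \<in> closed_face (p - (p \<bullet> i) *\<^sub>R i) r i 0 \<and> p \<bullet> i \<le> s \<and> s \<le> p \<bullet> i + r"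
proof -
  have p: "(p - (p \<bullet> i) *\<^sub>R i) \<bullet> b = (if b = i then 0 else p \<bullet> b)" if "b \<in> Basis" for b
    using inner_line_coordinate[OF i that, of p "- (p \<bullet> i)"] by simp
  have l: "(y + s *\<^sub>R i) \<bullet> b = (if b = i then s else y \<bullet> b)" if "b \<in> Basis" for b
    using inner_line_coordinate[OF i that, of y s] y by simp
  have q: "(p + r *\<^sub>R One) \<bullet> b = p \<bullet> b + r" if "b \<in> Basis" for b
    using that by (simp add: inner_add_left)
  have "y + s *\<^sub>R i \<in> closed_cube p r \<longleftrightarrow> (\<forall>b\<in>Basis. p \<bullet> b \<le> (if b = i then s else y \<bullet> b) \<and> (if b = i then s else y \<bullet> b) \<le> p \<bullet> b + r)"
    by (simp only: mem_box l q cong: ball_cong)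
  also have "\<dots> \<longleftrightarrow> y \<in> closed_face (p - (p \<bullet> i) *\<^sub>R i) r i 0 \<and> p \<bullet> i \<le> s \<and> s \<le> p \<bullet> i + r"
    using i y by (auto simp: closed_face_def p)
  finally show ?thesis .
qed

lemma face_translation:
  fixes i :: "'a::euclidean_space"
  assumes i: "i \<in> Basis"
  shows "(p \<bullet> i + a) *\<^sub>R i + y \<in> open_face p r i a \<longleftrightarrow> y \<in> open_face (p - (p \<bullet> i) *\<^sub>R i) r i 0"
    "(p \<bullet> i + a) *\<^sub>R i + y \<in> closed_face p r i a \<longleftrightarrow> y \<in> closed_face (p - (p \<bullet> i) *\<^sub>R i) r i 0"
proof -
  have p: "(p - (p \<bullet> i) *\<^sub>R i) \<bullet> b = (if b = i then 0 else p \<bullet> b)" if "b \<in> Basis" for b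
    using inner_line_coordinate[OF i that, of p "- (p \<bullet> i)"] by simp
  have y: "((p \<bullet> i + a) *\<^sub>R i + y) \<bullet> b = (if b = i then y \<bullet> i + (p \<bullet> i + a) else y \<bullet> b)" if "b \<in> Basis" for b
    using inner_line_coordinate[OF i that, of y "p \<bullet> i + a"] by (simp add: add.commute)
  show "(p \<bullet> i + a) *\<^sub>R i + y \<in> open_face p r i a \<longleftrightarrow> y \<in> open_face (p - (p \<bullet> i) *\<^sub>R i) r i 0"
    using i by (auto simp: open_face_def p y)
  show "(p \<bullet> i + a) *\<^sub>R i + y \<in> closed_face p r i a \<longleftrightarrow> y \<in> closed_face (p - (p \<bullet> i) *\<^sub>R i) r i 0"
    using i by (auto simp: closed_face_def p y)
qed

text \<open>\<open>c i\<close> is the density of the Hausdorff measure on the hyperplane orthogonal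
  to \<open>i\<close> with respect to Lebesgue measure there. It is allowed to depend on
  \<open>i\<close>, as invariance is established under translations and not under rotations.\<close>

definition face_constant :: "('a::euclidean_space \<Rightarrow> real) \<Rightarrow> bool" where
  "face_constant c \<longleftrightarrow> (\<forall>i\<in>Basis. 0 \<le> c i \<and> (\<forall>f\<in>borel_measurable borel.
    (\<integral>\<^sup>+y. (\<integral>\<^sup>+s. f (y + s *\<^sub>R i) \<partial>lborel) * indicator {y. y \<bullet> i = 0} y \<partial>hausdorff_measure (DIM('a) - 1))
      = ennreal (c i) * (\<integral>\<^sup>+x. f x \<partial>lborel)))"

lemma face_constant_exists: "\<exists>c. face_constant (c :: 'a::euclidean_space \<Rightarrow> real)"
  unfolding face_constant_def
  by (rule exI[of _ "\<lambda>i. SOME k. 0 \<le> k \<and> (\<forall>f\<in>borel_measurable borel.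
    (\<integral>\<^sup>+y. (\<integral>\<^sup>+s. f (y + s *\<^sub>R i) \<partial>lborel) * indicator {y. y \<bullet> i = 0} y \<partial>hausdorff_measure (DIM('a) - 1))
      = ennreal k * (\<integral>\<^sup>+x. f x \<partial>lborel))"], intro ballI, rule someI_ex) (rule hausdorff_hyperplane_Fubini)

lemma face_constant_nonneg: "face_constant c \<Longrightarrow> i \<in> Basis \<Longrightarrow> 0 \<le> c i"
  by (simp add: face_constant_def)

lemma face_constant_Fubini:
  fixes f :: "'a::euclidean_space \<Rightarrow> ennreal"
  assumes "face_constant c" "i \<in> Basis" "f \<in> borel_measurable borel"
  shows "(\<integral>\<^sup>+y. (\<integral>\<^sup>+s. f (y + s *\<^sub>R i) \<partial>lborel) * indicator {y. y \<bullet> i = 0} y \<partial>hausdorff_measure (DIM('a) - 1))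
      = ennreal (c i) * (\<integral>\<^sup>+x. f x \<partial>lborel)"
  using assms by (simp add: face_constant_def)

section \<open>Measure of the faces and traces on them\<close>

lemma emeasure_cube:
  fixes p :: "'a::euclidean_space"
  assumes "0 < r"
  shows "emeasure lborel (cube p r) = ennreal (r ^ DIM('a))" "emeasure lborel (closed_cube p r) = ennreal (r ^ DIM('a))"
  using assms by (simp_all add: emeasure_lborel_box_eq emeasure_lborel_cbox_eq inner_simps)

text \<open>Fubini for the indicator of the closed cube reads \<open>r\<close> times the measure of
  the projected face equals \<open>c i * r ^ DIM('a)\<close>; a translation carries the projection
  to the face itself.\<close>

lemma emeasure_closed_face:
  fixes p :: "'a::euclidean_space"
  assumes c: "face_constant c" and i: "i \<in> Basis" and r: "0 < r"
  shows "emeasure (hausdorff_measure (DIM('a) - 1)) (closed_face p r i a) = ennreal (c i * r ^ (DIM('a) - 1))"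
proof -
  let ?H = "hausdorff_measure (DIM('a) - 1) :: 'a measure"
  let ?F = "closed_face (p - (p \<bullet> i) *\<^sub>R i) r i 0" and ?K = "closed_cube p r"
  have meas: "closed_face q r j a \<in> sets borel" for q j :: 'a and a by (intro borel_closed closed_closed_face)
  have "(\<integral>\<^sup>+y. (\<integral>\<^sup>+s. indicator ?K (y + s *\<^sub>R i) \<partial>lborel) * indicator {y. y \<bullet> i = 0} y \<partial>?H)
     = (\<integral>\<^sup>+y\<in>?F. ennreal r \<partial>?H)"
  proof (rule nn_integral_cong)
    fix y :: 'a
    show "(\<integral>\<^sup>+s. indicator ?K (y + s *\<^sub>R i) \<partial>lborel) * indicator {y. y \<bullet> i = 0} y = ennreal r * indicator ?F y"
    proof (cases "y \<bullet> i = 0")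
      case True
      have "(\<integral>\<^sup>+s. indicator ?K (y + s *\<^sub>R i) \<partial>lborel) = (\<integral>\<^sup>+s. indicator ?F y * indicator {p \<bullet> i..p \<bullet> i + r} s \<partial>lborel)"
        by (intro nn_integral_cong) (auto simp: indicator_def line_in_closed_cube_iff[OF i True])
      also have "\<dots> = indicator ?F y * ennreal r" using r by (subst nn_integral_cmult_indicator) auto
      finally show ?thesis using True by (simp add: mult.commute)
    next
      case False
      have "i \<bullet> i = 1" using i by simp
      then have "y \<notin> ?F" using False i by (auto simp: closed_face_def inner_simps)
      then show ?thesis using False by simp
    qed
  qed
  also have "\<dots> = ennreal r * emeasure ?H ?F"
    using meas by (intro nn_integral_cmult_indicator) simp
  finally have "ennreal r * emeasure ?H ?F = ennreal (c i) * (\<integral>\<^sup>+x. indicator ?K x \<partial>lborel)"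
    using face_constant_Fubini[OF c i, of "indicator ?K"] by simp
  also have "\<dots> = ennreal (c i) * ennreal (r ^ DIM('a))" using emeasure_cube(2)[OF r, of p] by simp
  also have "\<dots> = ennreal r * ennreal (c i * r ^ (DIM('a) - 1))"
  proof -
    have "c i * r ^ DIM('a) = r * (c i * r ^ (DIM('a) - 1))"
      unfolding power_minus_mult[OF DIM_positive, of r, symmetric, where 'a = 'a] by (simp only: mult_ac)
    then show ?thesis using r face_constant_nonneg[OF c i] by (simp add: ennreal_mult[symmetric])
  qed
  finally have F: "emeasure ?H ?F = ennreal (c i * r ^ (DIM('a) - 1))"
    using r by (simp add: ennreal_mult_cancel_left)
  have "closed_face p r i a = (+) ((p \<bullet> i + a) *\<^sub>R i) ` ?F"
  proof (intro equalityI subsetI)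
    fix x assume x: "x \<in> closed_face p r i a"
    then have "x - (p \<bullet> i + a) *\<^sub>R i \<in> ?F" using face_translation(2)[OF i, of p a "x - (p \<bullet> i + a) *\<^sub>R i" r] by simp
    then show "x \<in> (+) ((p \<bullet> i + a) *\<^sub>R i) ` ?F" by (intro image_eqI[of _ _ "x - (p \<bullet> i + a) *\<^sub>R i"]) auto
  qed (use face_translation(2)[OF i] in auto)
  then have "hausdorff_outer (DIM('a) - 1) (closed_face p r i a) = hausdorff_outer (DIM('a) - 1) ?F"
    by (simp only: hausdorff_outer_translation)
  then show ?thesis using F emeasure_hausdorff_measure[OF meas] by simp
qed

text \<open>The comparison points may be end points, but the gradient is integrated over the open
  interval, so that only points of the open cube contribute.\<close>

lemma C1_gradient_line_bound:
  assumes f: "C1_gradient f G" and f0: "\<And>x. 0 \<le> f x" and s: "s \<in> {\<alpha>..\<alpha>'}" "t \<in> {\<alpha>..\<alpha>'}" and h: "norm h = 1"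
  shows "ennreal (f (y + s *\<^sub>R h)) \<le> ennreal (f (y + t *\<^sub>R h))
     + (\<integral>\<^sup>+s. ennreal (norm (G (y + s *\<^sub>R h))) * indicator {\<alpha><..<\<alpha>'} s \<partial>lborel)"
proof -
  have "ennreal \<bar>f (y + s *\<^sub>R h) - f (y + t *\<^sub>R h)\<bar>
     \<le> (\<integral>\<^sup>+u. ennreal \<bar>G (y + u *\<^sub>R h) \<bullet> h\<bar> * indicator {min s t..max s t} u \<partial>lborel)"
    using C1_gradient_increment_le[OF f, of "min s t" "max s t" y h]
    by (cases "s \<le> t") (simp_all add: min_def max_def abs_minus_commute)
  also have "\<dots> \<le> (\<integral>\<^sup>+s. ennreal (norm (G (y + s *\<^sub>R h))) * indicator {\<alpha><..<\<alpha>'} s \<partial>lborel)"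
  proof (rule nn_integral_mono_AE, use AE_lborel_singleton[of \<alpha>] AE_lborel_singleton[of \<alpha>'] in eventually_elim)
    fix u assume "u \<noteq> \<alpha>" "u \<noteq> \<alpha>'"
    then have "u \<in> {min s t..max s t} \<Longrightarrow> u \<in> {\<alpha><..<\<alpha>'}" using s by auto
    then show "ennreal \<bar>G (y + u *\<^sub>R h) \<bullet> h\<bar> * indicator {min s t..max s t} u
       \<le> ennreal (norm (G (y + u *\<^sub>R h))) * indicator {\<alpha><..<\<alpha>'} u"
      using Cauchy_Schwarz_ineq2[of "G (y + u *\<^sub>R h)" h] h
      by (cases "u \<in> {min s t..max s t}") (auto intro!: ennreal_leI)
  qed
  finally have *: "ennreal \<bar>f (y + s *\<^sub>R h) - f (y + t *\<^sub>R h)\<bar> \<le> (\<integral>\<^sup>+s. ennreal (norm (G (y + s *\<^sub>R h))) * indicator {\<alpha><..<\<alpha>'} s \<partial>lborel)" .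
  have "ennreal (f (y + s *\<^sub>R h)) \<le> ennreal (f (y + t *\<^sub>R h) + \<bar>f (y + s *\<^sub>R h) - f (y + t *\<^sub>R h)\<bar>)"
    by (intro ennreal_leI) simp
  also have "\<dots> = ennreal (f (y + t *\<^sub>R h)) + ennreal \<bar>f (y + s *\<^sub>R h) - f (y + t *\<^sub>R h)\<bar>"
    by (rule ennreal_plus[OF f0]) simp
  also have "\<dots> \<le> ennreal (f (y + t *\<^sub>R h)) + (\<integral>\<^sup>+s. ennreal (norm (G (y + s *\<^sub>R h))) * indicator {\<alpha><..<\<alpha>'} s \<partial>lborel)"
    using * by (rule add_left_mono)
  finally show ?thesis .
qed

text \<open>On every chord in direction \<open>i\<close> the value of \<open>f\<close> is compared
  with the one at the end lying on the chosen face, at the cost of the gradient along the chord.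
  Integration along the chord contributes the factor \<open>r\<close>;
  \<open>face_constant_Fubini\<close> then assembles the chords, which brings in \<open>c i\<close>
  with the volume integrals.\<close>

lemma cube_face_trace:
  fixes p :: "'a::euclidean_space"
  assumes c: "face_constant c" and i: "i \<in> Basis" and r: "0 < r" and a: "a \<in> {0, r}"
    and f: "C1_gradient f G" and f0: "\<And>x. 0 \<le> f x"
  shows "ennreal (c i) * (\<integral>\<^sup>+x\<in>cube p r. ennreal (f x) \<partial>lborel)
    \<le> ennreal r * (\<integral>\<^sup>+y\<in>open_face p r i a. ennreal (f y) \<partial>hausdorff_measure (DIM('a) - 1))
     + ennreal r * (ennreal (c i) * (\<integral>\<^sup>+x\<in>cube p r. ennreal (norm (G x)) \<partial>lborel))"
proof -
  let ?H = "hausdorff_measure (DIM('a) - 1) :: 'a measure"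
  let ?P = "{y::'a. y \<bullet> i = 0}" and ?K = "cube p r" and ?\<alpha> = "p \<bullet> i"
  let ?\<Phi> = "open_face (p - (p \<bullet> i) *\<^sub>R i) r i 0"
  have [measurable]: "f \<in> borel_measurable borel" "G \<in> borel_measurable borel" "?K \<in> sets borel"
    using f by (auto dest: C1_gradient_borel)
  have [measurable]: "?P \<in> sets borel" by (intro borel_closed closed_Collect_eq continuous_intros)
  have Hm: "borel_measurable ?H = borel_measurable borel"
    by (rule measurable_cong_sets[OF sets_hausdorff_measure refl])
  define D where "D y = (\<integral>\<^sup>+s. ennreal (norm (G (y + s *\<^sub>R i))) * indicator ?K (y + s *\<^sub>R i) \<partial>lborel)" for y
  have [measurable]: "D \<in> borel_measurable borel" unfolding D_def by measurable
  have n: "norm i = 1" using i by simp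
  have "ennreal (c i) * (\<integral>\<^sup>+x\<in>?K. ennreal (f x) \<partial>lborel)
    = (\<integral>\<^sup>+y. (\<integral>\<^sup>+s. ennreal (f (y + s *\<^sub>R i)) * indicator ?K (y + s *\<^sub>R i) \<partial>lborel) * indicator ?P y \<partial>?H)"
    by (rule face_constant_Fubini[OF c i, symmetric]) measurable
  also have "\<dots> \<le> (\<integral>\<^sup>+y. ennreal r * (ennreal (f ((?\<alpha> + a) *\<^sub>R i + y)) * indicator (open_face p r i a) ((?\<alpha> + a) *\<^sub>R i + y))
      + ennreal r * (D y * indicator ?P y) \<partial>?H)"
  proof (rule nn_integral_mono)
    fix y :: 'a
    let ?R = "ennreal (f (y + (?\<alpha> + a) *\<^sub>R i)) + D y"
    show "(\<integral>\<^sup>+s. ennreal (f (y + s *\<^sub>R i)) * indicator ?K (y + s *\<^sub>R i) \<partial>lborel) * indicator ?P y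
      \<le> ennreal r * (ennreal (f ((?\<alpha> + a) *\<^sub>R i + y)) * indicator (open_face p r i a) ((?\<alpha> + a) *\<^sub>R i + y))
      + ennreal r * (D y * indicator ?P y)"
    proof (cases "y \<bullet> i = 0")
      case True
      note line = line_in_cube_iff[OF i True, of _ p r]
      show ?thesis
      proof (cases "y \<in> ?\<Phi>")
        case yF: True
        have D_eq: "D y = (\<integral>\<^sup>+s. ennreal (norm (G (y + s *\<^sub>R i))) * indicator {?\<alpha><..<?\<alpha> + r} s \<partial>lborel)"
          unfolding D_def by (intro nn_integral_cong) (auto simp: indicator_def line yF)
        have "(\<integral>\<^sup>+s. ennreal (f (y + s *\<^sub>R i)) * indicator ?K (y + s *\<^sub>R i) \<partial>lborel)
          \<le> (\<integral>\<^sup>+s. ?R * indicator {?\<alpha><..<?\<alpha> + r} s \<partial>lborel)"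
        proof (rule nn_integral_mono)
          fix s
          show "ennreal (f (y + s *\<^sub>R i)) * indicator ?K (y + s *\<^sub>R i) \<le> ?R * indicator {?\<alpha><..<?\<alpha> + r} s"
          proof (cases "s \<in> {?\<alpha><..<?\<alpha> + r}")
            case True
            have "ennreal (f (y + s *\<^sub>R i)) \<le> ?R"
              unfolding D_eq by (rule C1_gradient_line_bound[OF f f0 _ _ n]) (use True a r in auto)
            then show ?thesis using True yF by (simp add: line)
          next
            case False
            then show ?thesis by (auto simp: line indicator_def)
          qed
        qed
        also have "\<dots> = ?R * ennreal r" using r by (subst nn_integral_cmult_indicator) auto
        finally show ?thesis
          using True yF face_translation(1)[OF i, of p a y r] by (simp add: algebra_simps)
      next
        case False
        then have "y + s *\<^sub>R i \<notin> ?K" for s by (simp add: line)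
        then show ?thesis by simp
      qed
    qed simp
  qed
  also have "\<dots> = ennreal r * (\<integral>\<^sup>+y. ennreal (f ((?\<alpha> + a) *\<^sub>R i + y)) * indicator (open_face p r i a) ((?\<alpha> + a) *\<^sub>R i + y) \<partial>?H)
      + ennreal r * (\<integral>\<^sup>+y\<in>?P. D y \<partial>?H)"
    by (simp add: nn_integral_add nn_integral_cmult Hm)
  also have "(\<integral>\<^sup>+y. ennreal (f ((?\<alpha> + a) *\<^sub>R i + y)) * indicator (open_face p r i a) ((?\<alpha> + a) *\<^sub>R i + y) \<partial>?H)
     = (\<integral>\<^sup>+y\<in>open_face p r i a. ennreal (f y) \<partial>?H)"
    by (rule nn_integral_hausdorff_translation[where f = "\<lambda>y. ennreal (f y) * indicator (open_face p r i a) y"]) measurable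
  also have "(\<integral>\<^sup>+y\<in>?P. D y \<partial>?H) = ennreal (c i) * (\<integral>\<^sup>+x\<in>?K. ennreal (norm (G x)) \<partial>lborel)"
    unfolding D_def by (rule face_constant_Fubini[OF c i]) measurable
  finally show ?thesis .
qed

text \<open>\<open>cube_face_trace\<close> is summed over all faces. \<open>S\<close> counts each
  \<open>c i\<close> twice, for opposite faces, so \<open>S * r ^ (DIM('a) - 1)\<close> is the sum
  of the measures of the closed faces.\<close>

lemma cube_trace:
  fixes p :: "'a::euclidean_space" and c :: "'a \<Rightarrow> real"
  assumes c: "face_constant c" and r: "0 < r" and f: "C1_gradient f G" and f0: "\<And>x. 0 \<le> f x"
  defines "S \<equiv> 2 * (\<Sum>i\<in>Basis. c i)"
  shows "ennreal S * (\<integral>\<^sup>+x\<in>cube p r. ennreal (f x) \<partial>lborel)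
    \<le> ennreal r * (\<Sum>(i,a)\<in>Basis \<times> {0, r}. \<integral>\<^sup>+y\<in>open_face p r i a. ennreal (f y) \<partial>hausdorff_measure (DIM('a) - 1))
     + ennreal (r * S) * (\<integral>\<^sup>+x\<in>cube p r. ennreal (norm (G x)) \<partial>lborel)"
proof -
  let ?I = "\<integral>\<^sup>+x\<in>cube p r. ennreal (f x) \<partial>lborel"
  let ?J = "\<integral>\<^sup>+x\<in>cube p r. ennreal (norm (G x)) \<partial>lborel"
  let ?B = "\<lambda>i a. \<integral>\<^sup>+y\<in>open_face p r i a. ennreal (f y) \<partial>hausdorff_measure (DIM('a) - 1)"
  have S: "ennreal S = (\<Sum>(i,a)\<in>(Basis::'a set) \<times> {0, r}. ennreal (c i))"
  proof -
    have "(\<Sum>(i,a)\<in>(Basis::'a set) \<times> {0, r}. ennreal (c i)) = (\<Sum>i\<in>(Basis::'a set). \<Sum>a\<in>{0, r}. ennreal (c i))"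
      by (rule sum.cartesian_product[symmetric])
    also have "\<dots> = (\<Sum>i\<in>(Basis::'a set). ennreal (2 * c i))"
      using r face_constant_nonneg[OF c] by (intro sum.cong refl) (simp add: ennreal_mult)
    also have "\<dots> = ennreal (\<Sum>i\<in>(Basis::'a set). 2 * c i)"
      using face_constant_nonneg[OF c] by (intro sum_ennreal) simp
    finally show ?thesis by (simp add: S_def sum_distrib_left)
  qed
  have "ennreal S * ?I = (\<Sum>(i,a)\<in>(Basis::'a set) \<times> {0, r}. ennreal (c i) * ?I)"
    unfolding S by (simp add: sum_distrib_right case_prod_unfold)
  also have "\<dots> \<le> (\<Sum>(i,a)\<in>(Basis::'a set) \<times> {0, r}. ennreal r * ?B i a + ennreal r * (ennreal (c i) * ?J))"
    using cube_face_trace[OF c _ r _ f f0] by (intro sum_mono) auto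
  also have "\<dots> = ennreal r * (\<Sum>(i,a)\<in>(Basis::'a set) \<times> {0, r}. ?B i a)
     + ennreal r * ((\<Sum>(i,a)\<in>(Basis::'a set) \<times> {0, r}. ennreal (c i)) * ?J)"
    by (simp add: sum.distrib sum_distrib_left sum_distrib_right case_prod_unfold)
  also have "ennreal r * ((\<Sum>(i,a)\<in>(Basis::'a set) \<times> {0, r}. ennreal (c i)) * ?J) = ennreal (r * S) * ?J"
    unfolding S[symmetric] using r by (simp add: ennreal_mult' mult.assoc)
  finally show ?thesis .
qed

section \<open>Rows of separated cubes\<close>

text \<open>The factor \<open>2\<close> leaves gaps of width \<open>r\<close> between consecutive
  cubes, so a ball of radius \<open>r\<close> about a point of one closed cube meets no
  other.\<close>

abbreviation row_corner :: "'a::euclidean_space \<Rightarrow> real \<Rightarrow> nat \<Rightarrow> 'a" where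
  "row_corner e r k \<equiv> (2 * real k * r) *\<^sub>R e"

definition cube_row :: "'a::euclidean_space \<Rightarrow> nat \<Rightarrow> real \<Rightarrow> 'a set" where
  "cube_row e N r = (\<Union>k<N. cube (row_corner e r k) r)"

lemma cube_row_separated:
  fixes e :: "'a::euclidean_space"
  assumes e: "e \<in> Basis" and r: "0 < r" and jk: "j \<noteq> k"
    and x: "x \<in> closed_cube (row_corner e r j) r"
    and y: "y \<in> closed_cube (row_corner e r k) r"
  shows "r \<le> dist x y"
proof -
  have ee: "e \<bullet> e = 1" using e by simp
  have coord: "2 * real l * r \<le> z \<bullet> e \<and> z \<bullet> e \<le> 2 * real l * r + r"
    if "z \<in> closed_cube (row_corner e r l) r" for z l
    using that e by (auto simp: mem_box inner_add_left dest!: bspec[of _ _ e])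
  have gap: "r \<le> \<bar>a - b\<bar>" if "m < n" "2 * real m * r \<le> a \<and> a \<le> 2 * real m * r + r"
    "2 * real n * r \<le> b \<and> b \<le> 2 * real n * r + r" for m n :: nat and a b
  proof -
    have "(real m + 1) * r \<le> real n * r" using that(1) r by (intro mult_right_mono) auto
    then have "real m * r + r \<le> real n * r" by (simp add: distrib_right)
    then show ?thesis using that by (simp add: mult.assoc)
  qed
  have "r \<le> \<bar>x \<bullet> e - y \<bullet> e\<bar>"
  proof (cases "j < k")
    case True
    then show ?thesis by (rule gap) (rule coord[OF x], rule coord[OF y])
  next
    case False
    then have "k < j" using jk by simp
    then have "r \<le> \<bar>y \<bullet> e - x \<bullet> e\<bar>" by (rule gap) (rule coord[OF y], rule coord[OF x])
    then show ?thesis by (simp add: abs_minus_commute)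
  qed
  also have "\<dots> = \<bar>(x - y) \<bullet> e\<bar>" by (simp add: inner_diff_left)
  also have "\<dots> \<le> dist x y" unfolding dist_norm by (rule Basis_le_norm[OF e])
  finally show ?thesis .
qed

lemma cube_subset_cbox: "x \<in> cube p r \<Longrightarrow> x \<in> closed_cube p r"
  using box_subset_cbox by blast

lemma open_face_subset_cbox: "0 < r \<Longrightarrow> a \<in> {0, r} \<Longrightarrow> x \<in> open_face p r i a \<Longrightarrow> x \<in> closed_cube p r"
  unfolding open_face_def mem_box by (auto simp: inner_add_left) (metis DiffI add_increasing2 empty_iff insert_iff less_eq_real_def order_refl)+

lemma open_cube_row: "open (cube_row e N r)"
  unfolding cube_row_def by (intro open_UN ballI open_box)

lemma bounded_cube_row: "bounded (cube_row e N r)"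
  unfolding cube_row_def by (intro bounded_UN) auto

lemma disjoint_cubes:
  assumes "e \<in> Basis" "0 < r"
  shows "disjoint_family_on (\<lambda>k. cube (row_corner e r k) r) A"
  unfolding disjoint_family_on_def
proof (intro ballI impI equals0I)
  fix j k x assume "j \<noteq> k" "x \<in> cube (row_corner e r j) r \<inter> cube (row_corner e r k) r"
  then have "r \<le> dist x x"
    by (intro cube_row_separated[OF assms, of j k]) (auto intro: cube_subset_cbox)
  with assms(2) show False by simp
qed

lemma nn_integral_cube_row:
  fixes e :: "'a::euclidean_space"
  assumes "e \<in> Basis" "0 < r" and [measurable]: "f \<in> borel_measurable borel"
  shows "(\<integral>\<^sup>+x\<in>cube_row e N r. f x \<partial>lborel)
    = (\<Sum>k<N. \<integral>\<^sup>+x\<in>cube (row_corner e r k) r. f x \<partial>lborel)"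
proof -
  have ind: "indicator (cube_row e N r) x = (\<Sum>k<N. indicator (cube (row_corner e r k) r) x :: ennreal)" for x
    unfolding cube_row_def by (rule indicator_UN_disjoint) (simp_all add: disjoint_cubes assms)
  have "(\<integral>\<^sup>+x\<in>cube_row e N r. f x \<partial>lborel)
    = (\<integral>\<^sup>+x. (\<Sum>k<N. f x * indicator (cube (row_corner e r k) r) x) \<partial>lborel)"
    by (simp only: ind sum_distrib_left)
  also have "\<dots> = (\<Sum>k<N. \<integral>\<^sup>+x\<in>cube (row_corner e r k) r. f x \<partial>lborel)"
    by (rule nn_integral_sum) simp
  finally show ?thesis .
qed

lemma emeasure_cube_row:
  fixes e :: "'a::euclidean_space"
  assumes "e \<in> Basis" "0 < r"
  shows "emeasure lborel (cube_row e N r) = ennreal (real N * r ^ DIM('a))"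
proof -
  have "emeasure lborel (cube_row e N r) = (\<integral>\<^sup>+x\<in>cube_row e N r. 1 \<partial>lborel)"
    using open_cube_row[of e N r] by simp
  also have "\<dots> = (\<Sum>k<N. \<integral>\<^sup>+x\<in>cube (row_corner e r k) r. 1 \<partial>lborel)"
    using assms by (intro nn_integral_cube_row) auto
  also have "\<dots> = (\<Sum>k<N. ennreal (r ^ DIM('a)))"
    using emeasure_cube(1)[OF assms(2), where 'a = 'a] by simp
  also have "\<dots> = ennreal (real N * r ^ DIM('a))"
    using assms(2) by (simp add: ennreal_mult ennreal_of_nat_eq_real_of_nat)
  finally show ?thesis .
qed

lemma frontier_cube_row:
  fixes e :: "'a::euclidean_space"
  assumes x: "x \<in> frontier (cube_row e N r)" and r: "0 < r"
  obtains k where "k < N" "x \<in> closed_cube (row_corner e r k) r"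
    "x \<notin> cube (row_corner e r k) r"
proof -
  have x': "x \<in> closure (cube_row e N r)" "x \<notin> cube_row e N r"
    using x open_cube_row[of e N r] by (auto simp: frontier_def interior_open)
  have "closed (\<Union>k<N. closed_cube (row_corner e r k) r)"
    by (intro closed_UN) auto
  moreover have "cube_row e N r \<subseteq> (\<Union>k<N. closed_cube (row_corner e r k) r)"
    unfolding cube_row_def by (intro UN_mono box_subset_cbox) auto
  ultimately have "closure (cube_row e N r) \<subseteq> (\<Union>k<N. closed_cube (row_corner e r k) r)"
    by (rule closure_minimal[rotated])
  then obtain k where "k < N" "x \<in> closed_cube (row_corner e r k) r"
    using x'(1) by blast
  moreover have "x \<notin> cube (row_corner e r k) r" using x'(2) \<open>k < N\<close> by (auto simp: cube_row_def)
  ultimately show ?thesis by (rule that)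
qed

lemma frontier_cube_row_subset:
  fixes e :: "'a::euclidean_space"
  assumes r: "0 < r"
  shows "frontier (cube_row e N r) \<subseteq> (\<Union>(k, i, a)\<in>{..<N} \<times> Basis \<times> {0, r}. closed_face (row_corner e r k) r i a)"
proof
  fix x assume "x \<in> frontier (cube_row e N r)"
  then obtain k where k: "k < N" "x \<in> closed_cube (row_corner e r k) r"
    "x \<notin> cube (row_corner e r k) r"
    using r by (rule frontier_cube_row)
  let ?p = "row_corner e r k"
  have c: "?p \<bullet> b \<le> x \<bullet> b" "x \<bullet> b \<le> ?p \<bullet> b + r" if "b \<in> Basis" for b
    using k(2) that unfolding mem_box inner_add_left by simp_all
  obtain i where i: "i \<in> Basis" "\<not> (?p \<bullet> i < x \<bullet> i \<and> x \<bullet> i < ?p \<bullet> i + r)"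
    using k(3) unfolding mem_box inner_add_left by auto
  then have "x \<bullet> i = ?p \<bullet> i + 0 \<or> x \<bullet> i = ?p \<bullet> i + r" using c[OF i(1)] by linarith
  then have "x \<in> closed_face ?p r i 0 \<or> x \<in> closed_face ?p r i r"
    using c by (auto simp: closed_face_def)
  then show "x \<in> (\<Union>(k, i, a)\<in>{..<N} \<times> Basis \<times> {0, r}. closed_face (row_corner e r k) r i a)"
    using k(1) i(1) by blast
qed

text \<open>A face point is in the closure of its own cube but not in the cube, as its
  \<open>i\<close>-th coordinate is extreme; the separation of the row excludes the other
  cubes.\<close>

lemma open_face_subset_frontier:
  fixes e :: "'a::euclidean_space"
  assumes e: "e \<in> Basis" and r: "0 < r" and k: "k < N" and i: "i \<in> Basis" and a: "a \<in> {0, r}"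
  shows "open_face (row_corner e r k) r i a \<subseteq> frontier (cube_row e N r)"
proof
  let ?p = "row_corner e r k"
  fix x assume x: "x \<in> open_face ?p r i a"
  then have xb: "x \<in> closed_cube ?p r" using r a by (intro open_face_subset_cbox)
  have "?p + (r / 2) *\<^sub>R One \<in> cube ?p r" using r by (simp add: mem_box inner_add_left)
  then have "cube ?p r \<noteq> {}" by blast
  then have "closure (cube ?p r) = closed_cube ?p r" by (rule closure_box)
  moreover have "cube ?p r \<subseteq> cube_row e N r" using k by (auto simp: cube_row_def)
  then have "closure (cube ?p r) \<subseteq> closure (cube_row e N r)" by (rule closure_mono)
  ultimately have "x \<in> closure (cube_row e N r)" using xb by blast
  moreover have "x \<notin> cube_row e N r"
  proof
    assume "x \<in> cube_row e N r"
    then obtain j where j: "x \<in> cube (row_corner e r j) r" by (auto simp: cube_row_def)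
    show False
    proof (cases "j = k")
      case True
      then have "?p \<bullet> i < x \<bullet> i" "x \<bullet> i < ?p \<bullet> i + r"
        using j i unfolding mem_box inner_add_left by simp_all
      moreover have "x \<bullet> i = ?p \<bullet> i + a" using x by (simp add: open_face_def)
      ultimately show False using a by auto
    next
      case False
      then have "r \<le> dist x x" by (rule cube_row_separated[OF e r _ cube_subset_cbox[OF j] xb])
      then show False using r by simp
    qed
  qed
  ultimately show "x \<in> frontier (cube_row e N r)"
    using open_cube_row[of e N r] by (simp add: frontier_def interior_open)
qed

text \<open>Different cubes are separated. Within one cube, a face orthogonal to \<open>i\<close>
  has extreme \<open>i\<close>-th coordinate, whereas the other open faces keep that coordinate
  strictly inside or at the opposite end.\<close>

lemma disjoint_open_faces:
  fixes e :: "'a::euclidean_space"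
  assumes e: "e \<in> Basis" and r: "0 < r"
  shows "disjoint_family_on (\<lambda>(k, i, a). open_face (row_corner e r k) r i a) ({..<N} \<times> Basis \<times> {0, r})"
  unfolding disjoint_family_on_def
proof (intro ballI impI, rule ccontr)
  let ?F = "\<lambda>(k, i, a). open_face (row_corner e r k) r i a" and ?I = "{..<N} \<times> Basis \<times> {0, r}"
  fix z z' assume zI: "z \<in> ?I" "z' \<in> ?I" and ne: "z \<noteq> z'" and meet: "?F z \<inter> ?F z' \<noteq> {}"
  obtain k i a k' i' a' where z: "z = (k, i, a)" "z' = (k', i', a')" by (metis prod_cases3)
  have kia: "k \<in> {..<N}" "i \<in> Basis" "a \<in> {0, r}" "k' \<in> {..<N}" "i' \<in> Basis" "a' \<in> {0, r}"
    using zI by (simp_all add: z)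
  obtain x where x: "x \<in> open_face (row_corner e r k) r i a" "x \<in> open_face (row_corner e r k') r i' a'"
    using meet by (auto simp: z)
  have "k = k'"
  proof (rule ccontr)
    assume "k \<noteq> k'"
    then have "r \<le> dist x x"
      by (rule cube_row_separated[OF e r _ open_face_subset_cbox[OF r kia(3) x(1)] open_face_subset_cbox[OF r kia(6) x(2)]])
    then show False using r by simp
  qed
  moreover have "i = i'"
  proof (rule ccontr)
    assume "i \<noteq> i'"
    then have "i \<in> Basis - {i'}" using kia(2) by blast
    then have "(row_corner e r k) \<bullet> i < x \<bullet> i" "x \<bullet> i < (row_corner e r k) \<bullet> i + r"
      using x(2) \<open>k = k'\<close> unfolding open_face_def by blast+
    moreover have "x \<bullet> i = (row_corner e r k) \<bullet> i + a" using x(1) unfolding open_face_def by blast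
    ultimately show False using kia(3) by auto
  qed
  moreover have "a = a'" using x calculation by (simp add: open_face_def)
  ultimately show False using ne by (simp add: z)
qed

text \<open>Closed faces overlap along edges, which is harmless for an upper bound.\<close>

lemma surface_cube_row_le:
  fixes e :: "'a::euclidean_space" and c :: "'a \<Rightarrow> real"
  assumes c: "face_constant c" and r: "0 < r"
  shows "emeasure (surface_measure (cube_row e N r)) (space (surface_measure (cube_row e N r)))
    \<le> ennreal (real N * (2 * (\<Sum>i\<in>Basis. c i)) * r ^ (DIM('a) - 1))"
proof -
  let ?H = "hausdorff_measure (DIM('a) - 1) :: 'a measure" and ?I = "{..<N} \<times> (Basis :: 'a set) \<times> {0, r}"
  have "emeasure (surface_measure (cube_row e N r)) (space (surface_measure (cube_row e N r)))
     = emeasure ?H (frontier (cube_row e N r))"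
    unfolding surface_measure_def by (simp add: space_restrict_space emeasure_restrict_space)
  also have "\<dots> \<le> emeasure ?H (\<Union>(k, i, a)\<in>?I. closed_face (row_corner e r k) r i a)"
    by (intro emeasure_mono frontier_cube_row_subset r)
       (auto intro!: sets.finite_UN borel_closed closed_closed_face)
  also have "\<dots> \<le> (\<Sum>z\<in>?I. emeasure ?H (case z of (k, i, a) \<Rightarrow> closed_face (row_corner e r k) r i a))"
    by (intro emeasure_subadditive_finite) (auto intro!: borel_closed closed_closed_face)
  also have "\<dots> = (\<Sum>z\<in>?I. ennreal (case z of (k, i, a) \<Rightarrow> c i * r ^ (DIM('a) - 1)))"
    by (intro sum.cong refl) (auto simp: emeasure_closed_face[OF c _ r] simp del: One_nat_def)
  also have "\<dots> = ennreal (\<Sum>z\<in>?I. case z of (k, i, a) \<Rightarrow> c i * r ^ (DIM('a) - 1))"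
    using face_constant_nonneg[OF c] r by (intro sum_ennreal) auto
  also have "(\<Sum>z\<in>?I. case z of (k, i, a) \<Rightarrow> c i * r ^ (DIM('a) - 1)) = (\<Sum>k<N. \<Sum>i\<in>Basis. \<Sum>a\<in>{0, r}. c i * r ^ (DIM('a) - 1))"
    by (simp only: sum.cartesian_product)
  also have "\<dots> = real N * (2 * (\<Sum>i\<in>Basis. c i)) * r ^ (DIM('a) - 1)"
    using r by (simp add: sum_distrib_left sum_distrib_right mult_ac)
  finally show ?thesis .
qed

text \<open>Disjointness of the open faces lets the sum of all face integrals be bounded by one
  integral over the frontier, with the same \<open>S\<close> as in
  \<open>surface_cube_row_le\<close>.\<close>

lemma cube_row_trace:
  fixes e :: "'a::euclidean_space" and c :: "'a \<Rightarrow> real" and N :: nat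
  assumes c: "face_constant c" and e: "e \<in> Basis" and r: "0 < r"
    and f: "C1_gradient f G" and f0: "\<And>x. 0 \<le> f x"
  defines "S \<equiv> 2 * (\<Sum>i\<in>Basis. c i)" and "\<Omega> \<equiv> cube_row e N r"
  shows "ennreal S * (\<integral>\<^sup>+x\<in>\<Omega>. ennreal (f x) \<partial>lborel)
    \<le> ennreal r * (\<integral>\<^sup>+y. ennreal (f y) \<partial>surface_measure \<Omega>)
     + ennreal (r * S) * (\<integral>\<^sup>+x\<in>\<Omega>. ennreal (norm (G x)) \<partial>lborel)"
proof -
  have [measurable]: "f \<in> borel_measurable borel" "G \<in> borel_measurable borel"
    using f by (auto dest: C1_gradient_borel)
  let ?H = "hausdorff_measure (DIM('a) - 1) :: 'a measure"
  let ?p = "\<lambda>k. row_corner e r k"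
  let ?I = "{..<N} \<times> (Basis :: 'a set) \<times> {0, r}"
  let ?F = "\<lambda>(k, i, a). open_face (?p k) r i a"
  have Hm: "borel_measurable ?H = borel_measurable borel"
    by (rule measurable_cong_sets[OF sets_hausdorff_measure refl])
  have "ennreal S * (\<integral>\<^sup>+x\<in>\<Omega>. ennreal (f x) \<partial>lborel)
     = (\<Sum>k<N. ennreal S * (\<integral>\<^sup>+x\<in>cube (?p k) r. ennreal (f x) \<partial>lborel))"
    unfolding \<Omega>_def by (subst nn_integral_cube_row[OF e r]) (auto simp: sum_distrib_left)
  also have "\<dots> \<le> (\<Sum>k<N. ennreal r * (\<Sum>(i,a)\<in>Basis \<times> {0, r}. \<integral>\<^sup>+y\<in>open_face (?p k) r i a. ennreal (f y) \<partial>?H)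
     + ennreal (r * S) * (\<integral>\<^sup>+x\<in>cube (?p k) r. ennreal (norm (G x)) \<partial>lborel))"
    unfolding S_def by (intro sum_mono cube_trace[OF c r f f0])
  also have "\<dots> = ennreal r * (\<Sum>k<N. \<Sum>(i,a)\<in>Basis \<times> {0, r}. \<integral>\<^sup>+y\<in>open_face (?p k) r i a. ennreal (f y) \<partial>?H)
     + ennreal (r * S) * (\<Sum>k<N. \<integral>\<^sup>+x\<in>cube (?p k) r. ennreal (norm (G x)) \<partial>lborel)"
    by (simp only: sum.distrib sum_distrib_left)
  also have "(\<Sum>k<N. \<integral>\<^sup>+x\<in>cube (?p k) r. ennreal (norm (G x)) \<partial>lborel)
     = (\<integral>\<^sup>+x\<in>\<Omega>. ennreal (norm (G x)) \<partial>lborel)"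
    unfolding \<Omega>_def by (subst nn_integral_cube_row[OF e r]) auto
  also have "(\<Sum>k<N. \<Sum>(i,a)\<in>Basis \<times> {0, r}. \<integral>\<^sup>+y\<in>open_face (?p k) r i a. ennreal (f y) \<partial>?H)
     = (\<Sum>z\<in>?I. \<integral>\<^sup>+y\<in>?F z. ennreal (f y) \<partial>?H)"
    by (simp add: sum.cartesian_product case_prod_unfold)
  also have "\<dots> = (\<integral>\<^sup>+y. (\<Sum>z\<in>?I. ennreal (f y) * indicator (?F z) y) \<partial>?H)"
    by (rule nn_integral_sum[symmetric]) (auto simp: Hm)
  also have "\<dots> \<le> (\<integral>\<^sup>+y\<in>frontier \<Omega>. ennreal (f y) \<partial>?H)"
  proof (rule nn_integral_mono)
    fix y
    have "(\<Sum>z\<in>?I. indicator (?F z) y :: ennreal) = indicator (\<Union>(?F ` ?I)) y"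
      by (rule indicator_UN_disjoint[symmetric, OF _ disjoint_open_faces[OF e r]]) simp
    also have "\<dots> \<le> indicator (frontier \<Omega>) y"
    proof -
      have "\<Union>(?F ` ?I) \<subseteq> frontier \<Omega>"
        unfolding \<Omega>_def
      proof (rule UN_least)
        fix z assume "z \<in> ?I"
        then show "?F z \<subseteq> frontier (cube_row e N r)"
          using open_face_subset_frontier[OF e r, of "fst z" N "fst (snd z)" "snd (snd z)"] by (auto simp: case_prod_unfold)
      qed
      then show ?thesis by (auto simp: indicator_def)
    qed
    finally have "ennreal (f y) * (\<Sum>z\<in>?I. indicator (?F z) y) \<le> ennreal (f y) * indicator (frontier \<Omega>) y"
      by (rule mult_left_mono) simp
    then show "(\<Sum>z\<in>?I. ennreal (f y) * indicator (?F z) y) \<le> ennreal (f y) * indicator (frontier \<Omega>) y"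
      by (simp only: sum_distrib_left)
  qed
  also have "(\<integral>\<^sup>+y\<in>frontier \<Omega>. ennreal (f y) \<partial>?H) = (\<integral>\<^sup>+y. ennreal (f y) \<partial>surface_measure \<Omega>)"
    unfolding surface_measure_def by (subst nn_integral_restrict_space) auto
  finally show ?thesis by (simp add: mult_left_mono add_right_mono)
qed

section \<open>Lipschitz boundary of a row of cubes\<close>

text \<open>Near a boundary point of a cube the active constraints are of the form
  \<open>\<sigma> i * (x \<bullet> i - p \<bullet> i) > 0\<close> with signs \<open>\<sigma> i\<close>; in the direction of the normalised sum of the vectors
  \<open>\<sigma> i *\<^sub>R i\<close> the boundary is the graph of a maximum of finitely many affine functions.\<close>

lemma lipschitz_graph_of_active_constraints:
  fixes p :: "'a::euclidean_space"
  assumes I: "I \<subseteq> Basis" "I \<noteq> {}" and \<sigma>: "\<And>i. i \<in> I \<Longrightarrow> (\<sigma> i)\<^sup>2 = (1::real)"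
  shows "\<exists>e L. \<exists>\<gamma>::'a \<Rightarrow> real. norm e = 1 \<and> L-lipschitz_on {y. y \<bullet> e = 0} \<gamma> \<and>
    (\<forall>x. \<gamma> (x - (x \<bullet> e) *\<^sub>R e) < x \<bullet> e \<longleftrightarrow> (\<forall>i\<in>I. 0 < \<sigma> i * (x \<bullet> i - p \<bullet> i)))"
proof -
  have fin: "finite I" using I(1) finite_Basis by (rule finite_subset)
  \<comment> \<open>\<open>s\<close> is the length of the sum of the active signed basis vectors; it
    normalises \<open>e\<close> and reappears as the Lipschitz constant.\<close>
  define s where "s = sqrt (real (card I))"
  have s: "0 < s" "s\<^sup>2 = real (card I)" using fin I(2) by (simp_all add: s_def card_gt_0_iff)
  define e where "e = (1 / s) *\<^sub>R (\<Sum>i\<in>I. \<sigma> i *\<^sub>R i)"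
  have ei: "e \<bullet> i = \<sigma> i / s" if "i \<in> I" for i
  proof -
    have "(\<Sum>j\<in>I. \<sigma> j *\<^sub>R j) \<bullet> i = (\<Sum>j\<in>I. if j = i then \<sigma> i else 0)"
      unfolding inner_sum_left using I(1) that by (intro sum.cong refl) (auto simp: inner_Basis subset_iff)
    also have "\<dots> = \<sigma> i" using fin that by simp
    finally show ?thesis by (simp add: e_def)
  qed
  have "e \<bullet> e = (1 / s) * (\<Sum>i\<in>I. \<sigma> i * (e \<bullet> i))"
    by (subst (2) e_def) (simp add: inner_sum_right)
  also have "(\<Sum>i\<in>I. \<sigma> i * (e \<bullet> i)) = (\<Sum>i\<in>I. 1 / s)"
    using \<sigma> by (intro sum.cong refl) (simp add: ei power2_eq_square)
  also have "(1 / s) * (\<Sum>i\<in>I. 1 / s) = real (card I) / s\<^sup>2" by (simp add: power2_eq_square)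
  also have "\<dots> = 1" using s(1) unfolding s(2)[symmetric] by simp
  finally have e1: "norm e = 1" by (simp add: norm_eq_sqrt_inner)
  define \<gamma> where "\<gamma> y = Max ((\<lambda>i. s * (\<sigma> i * (p \<bullet> i - y \<bullet> i))) ` I)" for y
  have \<gamma>_ge: "s * (\<sigma> i * (p \<bullet> i - y \<bullet> i)) \<le> \<gamma> y" if "i \<in> I" for i y
    unfolding \<gamma>_def using fin that by (intro Max_ge) auto
  have one_sided: "\<gamma> y \<le> \<gamma> z + s * dist y z" for y z
  proof -
    have "s * (\<sigma> i * (p \<bullet> i - y \<bullet> i)) \<le> \<gamma> z + s * dist y z" if i: "i \<in> I" for i
    proof -
      have abs1: "\<bar>\<sigma> i\<bar> = 1" using \<sigma>[OF i] by (auto simp: power2_eq_1_iff)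
      have "\<sigma> i * ((z - y) \<bullet> i) \<le> \<bar>(z - y) \<bullet> i\<bar>"
        using abs_ge_self[of "\<sigma> i * ((z - y) \<bullet> i)"] abs1 by (simp add: abs_mult)
      also have "\<dots> \<le> dist y z" unfolding dist_norm
        using Basis_le_norm[of i "z - y"] i I(1) by (auto simp: norm_minus_commute)
      finally have "s * (\<sigma> i * ((z - y) \<bullet> i)) \<le> s * dist y z" using s(1) by (intro mult_left_mono) auto
      moreover have "s * (\<sigma> i * (p \<bullet> i - y \<bullet> i)) = s * (\<sigma> i * (p \<bullet> i - z \<bullet> i)) + s * (\<sigma> i * ((z - y) \<bullet> i))"
        by (simp add: inner_diff_left algebra_simps)
      ultimately show ?thesis using \<gamma>_ge[OF i, of z] by linarith
    qed
    then show ?thesis unfolding \<gamma>_def[of y] using fin I(2) by (subst Max_le_iff) auto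
  qed
  have "s-lipschitz_on {y. y \<bullet> e = 0} \<gamma>"
  proof (rule lipschitz_onI)
    fix y z
    show "dist (\<gamma> y) (\<gamma> z) \<le> s * dist y z"
      using one_sided[of y z] one_sided[of z y] by (simp add: dist_real_def dist_commute abs_le_iff)
  qed (use s in simp)
  moreover have "\<gamma> (x - (x \<bullet> e) *\<^sub>R e) < x \<bullet> e \<longleftrightarrow> (\<forall>i\<in>I. 0 < \<sigma> i * (x \<bullet> i - p \<bullet> i))" for x
  proof -
    \<comment> \<open>Subtracting \<open>(x \<bullet> e) *\<^sub>R e\<close> lowers the
      \<open>i\<close>-th coordinate by \<open>(x \<bullet> e) * \<sigma> i / s\<close>, which
      \<open>s * \<sigma> i\<close> turns into \<open>x \<bullet> e\<close>. Hence every active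
      constraint takes the form of a bound below \<open>x \<bullet> e\<close>, and together they say
      that the maximum is below it.\<close>
    have eq: "s * (\<sigma> i * (p \<bullet> i - (x - (x \<bullet> e) *\<^sub>R e) \<bullet> i)) = x \<bullet> e - s * (\<sigma> i * (x \<bullet> i - p \<bullet> i))" if i: "i \<in> I" for i
    proof -
      have "s * (\<sigma> i * (p \<bullet> i - (x - (x \<bullet> e) *\<^sub>R e) \<bullet> i))
        = s * (\<sigma> i * ((x \<bullet> e) * (\<sigma> i / s))) - s * (\<sigma> i * (x \<bullet> i - p \<bullet> i))"
        by (simp only: inner_diff_left inner_scaleR_left ei[OF i]) (simp add: algebra_simps)
      also have "s * (\<sigma> i * ((x \<bullet> e) * (\<sigma> i / s))) = (x \<bullet> e) * (\<sigma> i)\<^sup>2"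
        using s(1) by (simp add: power2_eq_square)
      finally show ?thesis using \<sigma>[OF i] by simp
    qed
    have "\<gamma> (x - (x \<bullet> e) *\<^sub>R e) < x \<bullet> e \<longleftrightarrow> (\<forall>i\<in>I. s * (\<sigma> i * (p \<bullet> i - (x - (x \<bullet> e) *\<^sub>R e) \<bullet> i)) < x \<bullet> e)"
      unfolding \<gamma>_def using fin I(2) by (subst Max_less_iff) auto
    also have "\<dots> \<longleftrightarrow> (\<forall>i\<in>I. 0 < \<sigma> i * (x \<bullet> i - p \<bullet> i))"
      using s(1) by (intro ball_cong refl) (simp only: eq, simp add: zero_less_mult_iff)
    finally show ?thesis .
  qed
  ultimately show ?thesis using e1 by blast
qed

lemma lipschitz_boundary_cube_row:
  fixes e :: "'a::euclidean_space"
  assumes e: "e \<in> Basis" and r: "0 < r"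
  shows "lipschitz_boundary (cube_row e N r)"
  unfolding lipschitz_boundary_def
proof
  fix p assume "p \<in> frontier (cube_row e N r)"
  then obtain k where k: "k < N" "p \<in> closed_cube (row_corner e r k) r"
    "p \<notin> cube (row_corner e r k) r"
    using r by (rule frontier_cube_row)
  define P where "P = row_corner e r k"
  have q: "(P + r *\<^sub>R One) \<bullet> b = P \<bullet> b + r" if "b \<in> Basis" for b using that by (simp add: inner_add_left)
  have pb: "P \<bullet> b \<le> p \<bullet> b" "p \<bullet> b \<le> P \<bullet> b + r" if "b \<in> Basis" for b
    using k(2) that unfolding P_def[symmetric] mem_box by (simp_all add: q)
  \<comment> \<open>The sign points into the cube: positive on a lower face, negative on an upper
    one.\<close>
  define \<sigma> where "\<sigma> i = (if p \<bullet> i = P \<bullet> i then 1 else - 1 :: real)" for i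
  define I where "I = {i\<in>Basis. p \<bullet> i = P \<bullet> i \<or> p \<bullet> i = P \<bullet> i + r}"
  obtain b0 where b0: "b0 \<in> Basis" "\<not> (P \<bullet> b0 < p \<bullet> b0 \<and> p \<bullet> b0 < P \<bullet> b0 + r)"
    using k(3) unfolding P_def[symmetric] mem_box by (auto simp: q)
  then have "b0 \<in> I" using pb[of b0] by (auto simp: I_def)
  then have I: "I \<subseteq> Basis" "I \<noteq> {}" by (auto simp: I_def)
  \<comment> \<open>\<open>U\<close> is the open set on which the constraints that are inactive at
    \<open>p\<close> persist.\<close>
  define U where "U = (\<Inter>i\<in>Basis. {x. (p \<bullet> i \<noteq> P \<bullet> i \<longrightarrow> P \<bullet> i < x \<bullet> i)} \<inter> {x. (p \<bullet> i \<noteq> P \<bullet> i + r \<longrightarrow> x \<bullet> i < P \<bullet> i + r)})"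
  have "open U" unfolding U_def
  proof (intro open_INT ballI open_Int)
    fix i :: 'a
    show "open {x. p \<bullet> i \<noteq> P \<bullet> i \<longrightarrow> P \<bullet> i < x \<bullet> i}"
      by (cases "p \<bullet> i = P \<bullet> i") (simp_all add: open_Collect_less continuous_intros)
    show "open {x. p \<bullet> i \<noteq> P \<bullet> i + r \<longrightarrow> x \<bullet> i < P \<bullet> i + r}"
      by (cases "p \<bullet> i = P \<bullet> i + r") (simp_all add: open_Collect_less continuous_intros)
  qed simp
  moreover have "p \<in> U" using pb by (fastforce simp: U_def)
  ultimately obtain \<rho>0 where \<rho>0: "0 < \<rho>0" "ball p \<rho>0 \<subseteq> U" by (metis openE)
  \<comment> \<open>A radius of at most \<open>r\<close> keeps all other cubes of the row out of the
    ball.\<close>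
  define \<rho> where "\<rho> = min \<rho>0 r"
  have \<rho>: "0 < \<rho>" "ball p \<rho> \<subseteq> U" "\<rho> \<le> r" using \<rho>0 r by (auto simp: \<rho>_def)
  have local: "x \<in> cube_row e N r \<longleftrightarrow> (\<forall>i\<in>I. 0 < \<sigma> i * (x \<bullet> i - p \<bullet> i))" if x: "x \<in> ball p \<rho>" for x
  proof
    assume "x \<in> cube_row e N r"
    then obtain j where j: "x \<in> cube (row_corner e r j) r" by (auto simp: cube_row_def)
    have "j = k"
    proof (rule ccontr)
      assume "j \<noteq> k"
      then have "r \<le> dist x p" by (rule cube_row_separated[OF e r _ cube_subset_cbox[OF j] k(2)])
      then show False using x \<rho>(3) by (simp add: dist_commute)
    qed
    then have xb: "P \<bullet> b < x \<bullet> b" "x \<bullet> b < P \<bullet> b + r" if "b \<in> Basis" for b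
      using j that unfolding mem_box P_def[symmetric] by (simp_all add: q P_def[symmetric])
    show "\<forall>i\<in>I. 0 < \<sigma> i * (x \<bullet> i - p \<bullet> i)"
    proof
      fix i assume "i \<in> I"
      then show "0 < \<sigma> i * (x \<bullet> i - p \<bullet> i)" using xb[of i] by (auto simp: I_def \<sigma>_def)
    qed
  next
    assume *: "\<forall>i\<in>I. 0 < \<sigma> i * (x \<bullet> i - p \<bullet> i)"
    have xU: "x \<in> U" using x \<rho>(2) by blast
    have "P \<bullet> b < x \<bullet> b \<and> x \<bullet> b < P \<bullet> b + r" if b: "b \<in> Basis" for b
    proof
      show "P \<bullet> b < x \<bullet> b"
      proof (cases "p \<bullet> b = P \<bullet> b")
        case True
        then have "b \<in> I" using b by (simp add: I_def)
        then show ?thesis using * True by (auto simp: \<sigma>_def)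
      next
        case False then show ?thesis using xU b by (auto simp: U_def)
      qed
      show "x \<bullet> b < P \<bullet> b + r"
      proof (cases "p \<bullet> b = P \<bullet> b + r")
        case True
        then have "b \<in> I" using b by (simp add: I_def)
        then have "0 < \<sigma> b * (x \<bullet> b - p \<bullet> b)" using * by blast
        then show ?thesis using True r by (simp add: \<sigma>_def)
      next
        case False then show ?thesis using xU b by (auto simp: U_def)
      qed
    qed
    then have "x \<in> cube P r" unfolding mem_box by (simp add: q)
    then show "x \<in> cube_row e N r" using k(1) by (auto simp: cube_row_def P_def)
  qed
  have "(\<sigma> i)\<^sup>2 = 1" for i by (simp add: \<sigma>_def)
  then obtain e' L and \<gamma> :: "'a \<Rightarrow> real" where g: "norm e' = 1" "L-lipschitz_on {y. y \<bullet> e' = 0} \<gamma>"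
    "\<forall>x. \<gamma> (x - (x \<bullet> e') *\<^sub>R e') < x \<bullet> e' \<longleftrightarrow> (\<forall>i\<in>I. 0 < \<sigma> i * (x \<bullet> i - p \<bullet> i))"
    using lipschitz_graph_of_active_constraints[OF I, of \<sigma> p] by blast
  have "cube_row e N r \<inter> ball p \<rho> = {x \<in> ball p \<rho>. \<gamma> (x - (x \<bullet> e') *\<^sub>R e') < x \<bullet> e'}"
    using local g(3) by blast
  with \<rho>(1) g(1,2) show "\<exists>\<rho>>0. \<exists>e' L. \<exists>\<gamma> :: 'a \<Rightarrow> real.
        norm e' = 1 \<and> L-lipschitz_on {y. y \<bullet> e' = 0} \<gamma> \<and>
        cube_row e N r \<inter> ball p \<rho> = {x \<in> ball p \<rho>. \<gamma> (x - (x \<bullet> e') *\<^sub>R e') < x \<bullet> e'}"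
    by (intro exI[of _ \<rho>] conjI exI[of _ e'] exI[of _ L] exI[of _ \<gamma>])
qed

section \<open>Asymptotics\<close>

lemma filterlim_powr_at_top:
  fixes p :: real
  assumes "0 < p"
  shows "filterlim (\<lambda>x. x powr p) at_top at_top"
proof -
  have "filterlim (\<lambda>x. exp (p * ln x)) at_top at_top"
    by (intro filterlim_compose[OF exp_at_top] filterlim_tendsto_pos_mult_at_top[OF tendsto_const assms] ln_at_top)
  moreover have "\<forall>\<^sub>F x in at_top. exp (p * ln x) = x powr p"
    using eventually_gt_at_top[of 0] by eventually_elim (simp add: powr_def)
  ultimately show ?thesis by (rule filterlim_mono_eventually[OF _ order_refl order_refl])
qed

lemma filterlim_Suc_powr_at_top:
  fixes p :: real
  assumes "0 < p"
  shows "filterlim (\<lambda>n. real (Suc n) powr p) at_top sequentially"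
  by (rule filterlim_compose[OF filterlim_powr_at_top[OF assms] filterlim_compose[OF filterlim_real_sequentially filterlim_Suc]])

text \<open>If the sum were \<open>0\<close>, the unit cube would have a boundary of measure
  \<open>0\<close>, and the shadow estimate for the function \<open>1\<close> would force its volume
  to vanish.\<close>

lemma face_constant_sum_pos:
  fixes c :: "'a::euclidean_space \<Rightarrow> real"
  assumes c: "face_constant c"
  shows "0 < 2 * (\<Sum>i\<in>Basis. c i)"
proof -
  let ?e = "SOME i. i \<in> Basis :: 'a" and ?S = "2 * (\<Sum>i\<in>Basis. c i)"
  let ?\<Omega> = "cube_row ?e 1 1"
  obtain R where R: "0 \<le> R" "2 \<le> emeasure lborel (ball (0::'a) R)" using exists_ball_volume_ge_2 by blast
  have vol: "emeasure lborel ?\<Omega> = 1" using emeasure_cube_row[OF SOME_Basis, where 'a = 'a, of 1 1] by simp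
  have P: "emeasure (surface_measure ?\<Omega>) (space (surface_measure ?\<Omega>)) \<le> ennreal ?S"
    using surface_cube_row_le[OF c, of 1 ?e 1] by simp
  have "(\<integral>\<^sup>+x\<in>?\<Omega>. ennreal 1 \<partial>lborel)
    \<le> emeasure lborel (ball (0::'a) R) * (ennreal R * (\<integral>\<^sup>+x\<in>?\<Omega>. ennreal (norm (0::'a)) \<partial>lborel)
     + ennreal (shadow_const TYPE('a) R) * (\<integral>\<^sup>+y. ennreal 1 \<partial>surface_measure ?\<Omega>))"
    by (rule nn_integral_le_gradient_boundary[OF C1_gradient_const _ open_cube_row eq_refl[OF vol] R(2)]) simp
  then have "1 \<le> emeasure lborel (ball (0::'a) R) * (ennreal (shadow_const TYPE('a) R)
      * emeasure (surface_measure ?\<Omega>) (space (surface_measure ?\<Omega>)))"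
    using vol open_cube_row[of ?e 1 1] by simp
  then have "emeasure (surface_measure ?\<Omega>) (space (surface_measure ?\<Omega>)) \<noteq> 0" by (intro notI) simp
  then have "0 < ennreal ?S" using P by (metis le_zero_eq not_gr_zero)
  then show ?thesis by (simp add: ennreal_less_zero_iff)
qed

section \<open>Eigenvalue and torsion on rows of cubes\<close>

lemma cube_row_unit_volume_domain:
  fixes e :: "'a::euclidean_space"
  assumes e: "e \<in> Basis" and r: "0 < r" and N: "real N * r ^ DIM('a) = 1"
  shows "cube_row e N r \<in> unit_volume_domains" "emeasure lborel (cube_row e N r) = 1"
proof -
  show vol: "emeasure lborel (cube_row e N r) = 1" using emeasure_cube_row[OF e r, of N] N by simp
  then have "measure lebesgue (cube_row e N r) = 1"
    using open_cube_row[of e N r] by (simp add: measure_def)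
  then show "cube_row e N r \<in> unit_volume_domains"
    by (simp add: unit_volume_domains_def open_cube_row bounded_cube_row lipschitz_boundary_cube_row[OF e r])
qed

lemma cube_row_eigenvalue_torsion_ge:
  fixes e :: "'a::euclidean_space" and c :: "'a \<Rightarrow> real"
  assumes \<beta>: "0 < \<beta>" and c: "face_constant c" and e: "e \<in> Basis" and r: "0 < r" and N: "real N * r ^ DIM('a) = 1"
    and q: "0 \<le> q"
  defines "S \<equiv> 2 * (\<Sum>i\<in>Basis. c i)" and "\<Omega> \<equiv> cube_row e N r"
  assumes small: "r * (S * \<beta>) < 1"
  shows "(S * \<beta> / r) powr (1 - q) * (1 - r * (S * \<beta>)) \<le> robin_eigenvalue \<beta> \<Omega> * robin_torsion \<beta> \<Omega> powr q"
proof -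
  have S: "0 < S" unfolding S_def by (rule face_constant_sum_pos[OF c])
  have \<Omega>: "open \<Omega>" "bounded \<Omega>" "emeasure lborel \<Omega> = 1"
    unfolding \<Omega>_def using open_cube_row bounded_cube_row cube_row_unit_volume_domain(2)[OF e r N] by auto
  have "real N * r ^ (DIM('a) - 1) * r = 1"
    using N power_minus_mult[of "DIM('a)" r] by (simp only: mult.assoc DIM_positive)
  \<comment> \<open>With total volume \<open>N * r ^ DIM('a) = 1\<close> the perimeter bound becomes
    \<open>S / r\<close>.\<close>
  then have NS: "real N * S * r ^ (DIM('a) - 1) = S / r" using r by (simp add: field_simps)
  have P: "emeasure (surface_measure \<Omega>) (space (surface_measure \<Omega>)) \<le> ennreal (S / r)"
    using surface_cube_row_le[OF c r, of e N] unfolding \<Omega>_def S_def[symmetric] NS .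
  have T: "1 / (\<beta> * (S / r)) \<le> robin_torsion \<beta> \<Omega>"
    using S r by (intro robin_torsion_ge[OF \<beta> \<Omega> P]) simp
  \<comment> \<open>The absorbed trace estimate, multiplied by \<open>S * \<beta> / r\<close>, has
    the Robin energy on the right and this factor on the left.\<close>
  define \<mu> where "\<mu> = S * \<beta> / r * (1 - r * (S * \<beta>))"
  have \<mu>: "0 < \<mu>" using S \<beta> r small by (simp add: \<mu>_def)
  have "\<mu> \<le> robin_eigenvalue \<beta> \<Omega>"
  proof (rule robin_eigenvalue_ge[OF \<beta> \<Omega>])
    show "emeasure (surface_measure \<Omega>) (space (surface_measure \<Omega>)) < top"
      using P by (rule le_less_trans) simp
    fix u g t assume u: "H1_trace \<Omega> u g t"
    have "(LINT x|lebesgue_on \<Omega>. (u x)\<^sup>2)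
      \<le> (1 / \<mu>) * (LINT x|lebesgue_on \<Omega>. (norm (g x))\<^sup>2) + (\<beta> / \<mu>) * (LINT x|surface_measure \<Omega>. (t x)\<^sup>2)"
    proof (rule H1_trace_inequality[OF _ u])
      fix \<phi> :: "'a \<Rightarrow> real" assume \<phi>: "smooth \<phi>" "L2 (surface_measure \<Omega>) \<phi>"
      let ?U = "LINT x|lebesgue_on \<Omega>. (\<phi> x)\<^sup>2" and ?G = "LINT x|lebesgue_on \<Omega>. (norm (gradient \<phi> x))\<^sup>2"
        and ?B = "LINT y|surface_measure \<Omega>. (\<phi> y)\<^sup>2"
      \<comment> \<open>Here \<open>a = r\<close>, \<open>b = r / S\<close> and
        \<open>\<epsilon> = S * \<beta>\<close>. With this weight both coefficients on the right are
        \<open>r / (S * \<beta>)\<close> times those in the Robin energy.\<close>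
      have "(1 - r * (S * \<beta>)) * ?U \<le> r / (S * \<beta>) * ?G + r / S * ?B"
      proof (rule absorb_gradient[OF \<phi> \<Omega>(1,2)])
        let ?I = "\<integral>\<^sup>+x\<in>\<Omega>. ennreal ((\<phi> x)\<^sup>2) \<partial>lborel"
        let ?J = "\<integral>\<^sup>+x\<in>\<Omega>. ennreal (norm ((2 * \<phi> x) *\<^sub>R gradient \<phi> x)) \<partial>lborel"
        let ?K = "\<integral>\<^sup>+y. ennreal ((\<phi> y)\<^sup>2) \<partial>surface_measure \<Omega>"
        have tr: "ennreal S * ?I \<le> ennreal r * ?K + ennreal (r * S) * ?J"
          unfolding S_def \<Omega>_def by (rule cube_row_trace[OF c e r smooth_square_gradient[OF \<phi>(1)]]) simp
        have "?I = ennreal (1 / S) * (ennreal S * ?I)"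
          using S by (simp add: mult.assoc[symmetric] ennreal_mult[symmetric])
        also have "\<dots> \<le> ennreal (1 / S) * (ennreal r * ?K + ennreal (r * S) * ?J)"
          using tr by (rule mult_left_mono) simp
        also have "\<dots> = ennreal r * ?J + ennreal (r / S) * ?K"
          using S r by (simp add: distrib_left mult.assoc[symmetric] ennreal_mult[symmetric] add.commute)
        finally show "?I \<le> ennreal r * ?J + ennreal (r / S) * ?K" .
      qed (use S \<beta> r in auto)
      then have "S * \<beta> / r * ((1 - r * (S * \<beta>)) * ?U) \<le> S * \<beta> / r * (r / (S * \<beta>) * ?G + r / S * ?B)"
        using S \<beta> r by (intro mult_left_mono) auto
      also have "\<dots> = ?G + \<beta> * ?B" using S \<beta> r by (simp add: distrib_left)
      finally have "\<mu> * ?U \<le> ?G + \<beta> * ?B" by (simp add: \<mu>_def mult.assoc)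
      then show "?U \<le> (1 / \<mu>) * ?G + (\<beta> / \<mu>) * ?B"
        using \<mu> by (simp add: field_simps)
    qed
    then show "\<mu> * (LINT x|lebesgue_on \<Omega>. (u x)\<^sup>2)
       \<le> robin_energy \<beta> \<Omega> g t"
      using \<mu> by (simp add: field_simps)
  qed
  \<comment> \<open>As \<open>q\<close> is nonnegative, \<open>powr q\<close> is monotone and
    preserves the lower bound of the torsion.\<close>
  moreover have "(S * \<beta> / r) powr (- q) \<le> robin_torsion \<beta> \<Omega> powr q"
  proof -
    have "(S * \<beta> / r) powr (- q) = (1 / (\<beta> * (S / r))) powr q"
      using S \<beta> r by (simp add: powr_minus powr_divide mult.commute)
    also have "\<dots> \<le> robin_torsion \<beta> \<Omega> powr q"
      using T S \<beta> r q by (intro powr_mono2) auto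
    finally show ?thesis .
  qed
  ultimately have "\<mu> * (S * \<beta> / r) powr (- q) \<le> robin_eigenvalue \<beta> \<Omega> * robin_torsion \<beta> \<Omega> powr q"
    using \<mu> by (intro mult_mono) auto
  moreover have "(S * \<beta> / r) powr (1 - q) = S * \<beta> / r * (S * \<beta> / r) powr (- q)"
    using S \<beta> r powr_add[of "S * \<beta> / r" 1 "- q"] by simp
  ultimately show ?thesis by (simp add: \<mu>_def mult_ac)
qed

text \<open>\<open>Suc n\<close> cubes of side \<open>r n\<close> have total volume
  \<open>1\<close>. The bound holds only eventually because it requires
  \<open>r n * k < 1\<close>.\<close>

lemma robin_sup_ge:
  fixes c :: "'a::euclidean_space \<Rightarrow> real"
  assumes \<beta>: "0 < \<beta>" and c: "face_constant c" and q: "0 \<le> q"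
  defines "k \<equiv> 2 * (\<Sum>i\<in>Basis. c i) * \<beta>"
  shows "\<forall>\<^sub>F n in sequentially. ereal ((k * real (Suc n) powr (1 / DIM('a))) powr (1 - q) * (1 - k / real (Suc n) powr (1 / DIM('a))))
     \<le> robin_sup TYPE('a) \<beta> q"
proof -
  define r where "r n = 1 / real (Suc n) powr (1 / DIM('a))" for n
  have r: "0 < r n" "real (Suc n) * r n ^ DIM('a) = 1" for n
    by (simp_all add: r_def power_divide powr_power)
  have "filterlim (\<lambda>n. real (Suc n) powr (1 / DIM('a))) at_top sequentially"
    by (rule filterlim_Suc_powr_at_top) simp
  then have "\<forall>\<^sub>F n in sequentially. k < real (Suc n) powr (1 / DIM('a))"
    by (simp add: filterlim_at_top_dense)
  then show ?thesis
  proof eventually_elim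
    fix n assume "k < real (Suc n) powr (1 / DIM('a))"
    then have "r n * k < 1" by (simp add: r_def)
    then have small: "r n * (2 * (\<Sum>i\<in>Basis. c i) * \<beta>) < 1" by (simp add: k_def)
    let ?\<Omega> = "cube_row (SOME i. i \<in> Basis) (Suc n) (r n) :: 'a set"
    have "(k / r n) powr (1 - q) * (1 - r n * k) \<le> robin_eigenvalue \<beta> ?\<Omega> * robin_torsion \<beta> ?\<Omega> powr q"
      unfolding k_def by (rule cube_row_eigenvalue_torsion_ge[OF \<beta> c SOME_Basis r q small])
    then have "ereal ((k / r n) powr (1 - q) * (1 - r n * k)) \<le> robin_sup TYPE('a) \<beta> q"
      unfolding robin_sup_def
      by (intro SUP_upper2[OF cube_row_unit_volume_domain(1)[OF SOME_Basis r]]) simp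
    then show "ereal ((k * real (Suc n) powr (1 / DIM('a))) powr (1 - q) * (1 - k / real (Suc n) powr (1 / DIM('a)))) \<le> robin_sup TYPE('a) \<beta> q"
      by (simp add: r_def)
  qed
qed

section \<open>The three ranges of the exponent\<close>

lemma unit_volume_domainsD:
  assumes "\<Omega> \<in> unit_volume_domains"
  shows "open \<Omega>" "bounded \<Omega>" "emeasure lborel \<Omega> \<le> 1"
proof -
  show o: "open \<Omega>" and "bounded \<Omega>" using assms by (auto simp: unit_volume_domains_def)
  have "measure lborel \<Omega> = 1" using assms o by (simp add: unit_volume_domains_def measure_def)
  then show "emeasure lborel \<Omega> \<le> 1"
    using emeasure_bounded_finite[OF \<open>bounded \<Omega>\<close>] by (simp add: emeasure_eq_ennreal_measure less_top)
qed

theorem theorem4p3: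
  fixes \<beta> :: real
  assumes "0 < \<beta>"
  shows "(\<forall>q. 0 < q \<and> q < 1 \<longrightarrow> robin_sup TYPE('a::euclidean_space) \<beta> q = \<infinity>)
       \<and> robin_sup TYPE('a) \<beta> 1 = 1
       \<and> (\<forall>q. 1 < q \<longrightarrow> robin_sup TYPE('a) \<beta> q < \<infinity>)"
proof -
  obtain c where c: "face_constant (c :: 'a \<Rightarrow> real)" using face_constant_exists by blast
  define k where "k = 2 * (\<Sum>i\<in>Basis. c i) * \<beta>"
  have k: "0 < k" unfolding k_def using face_constant_sum_pos[OF c] assms by (rule mult_pos_pos)
  define \<rho> where "\<rho> n = real (Suc n) powr (1 / DIM('a))" for n
  have \<rho>: "filterlim \<rho> at_top sequentially" unfolding \<rho>_def
    by (rule filterlim_Suc_powr_at_top) simp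
  have lower: "\<forall>\<^sub>F n in sequentially. ereal ((k * \<rho> n) powr (1 - q) * (1 - k / \<rho> n)) \<le> robin_sup TYPE('a) \<beta> q" if "0 \<le> q" for q
    unfolding k_def \<rho>_def by (rule robin_sup_ge[OF assms c that])
  have lim: "(\<lambda>n. 1 - k / \<rho> n) \<longlonglongrightarrow> 1 - 0"
    by (intro tendsto_diff tendsto_const real_tendsto_divide_at_top[OF tendsto_const \<rho>])
  have "robin_sup TYPE('a) \<beta> q = \<infinity>" if q: "0 < q" "q < 1" for q
  proof (rule ereal_top)
    fix M :: real
    have "filterlim (\<lambda>n. (k * \<rho> n) powr (1 - q)) at_top sequentially"
      using q by (intro filterlim_compose[OF filterlim_powr_at_top] filterlim_tendsto_pos_mult_at_top[OF tendsto_const k \<rho>]) simp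
    \<comment> \<open>The correction factor tends to \<open>1\<close>, so the product inherits the
      divergence of the power with positive exponent \<open>1 - q\<close>.\<close>
    then have "filterlim (\<lambda>n. (1 - k / \<rho> n) * (k * \<rho> n) powr (1 - q)) at_top sequentially"
      by (rule filterlim_tendsto_pos_mult_at_top[OF lim, rotated]) simp
    then have "\<forall>\<^sub>F n in sequentially. M \<le> (1 - k / \<rho> n) * (k * \<rho> n) powr (1 - q)"
      by (simp add: filterlim_at_top)
    moreover have "\<forall>\<^sub>F n in sequentially. ereal ((k * \<rho> n) powr (1 - q) * (1 - k / \<rho> n)) \<le> robin_sup TYPE('a) \<beta> q"
      using q by (intro lower) simp
    ultimately have "\<forall>\<^sub>F n in sequentially. ereal M \<le> robin_sup TYPE('a) \<beta> q"
    proof eventually_elim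
      case (elim n)
      then have "ereal M \<le> ereal ((k * \<rho> n) powr (1 - q) * (1 - k / \<rho> n))" by (simp add: mult.commute)
      then show ?case using elim(2) by (rule order_trans)
    qed
    then show "ereal M \<le> robin_sup TYPE('a) \<beta> q" by simp
  qed
  moreover have "robin_sup TYPE('a) \<beta> 1 = 1"
  proof (rule antisym)
    show "robin_sup TYPE('a) \<beta> 1 \<le> 1"
      unfolding robin_sup_def
    proof (rule SUP_least)
      fix \<Omega> :: "'a set" assume "\<Omega> \<in> unit_volume_domains"
      note \<Omega> = unit_volume_domainsD[OF this]
      \<comment> \<open>\<open>powr 1\<close> returns its base only on nonnegative numbers.\<close>
      have "robin_torsion \<beta> \<Omega> powr 1 = robin_torsion \<beta> \<Omega>"
        using robin_torsion_nonneg[OF assms \<Omega>] by simp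
      then show "ereal (robin_eigenvalue \<beta> \<Omega> * robin_torsion \<beta> \<Omega> powr 1) \<le> 1"
        using robin_eigenvalue_mult_torsion_le[OF assms \<Omega>] by simp
    qed
    have "(\<lambda>n. ereal (1 - k / \<rho> n)) \<longlonglongrightarrow> ereal (1 - 0)" using lim by (rule tendsto_ereal)
    moreover have "\<forall>\<^sub>F n in sequentially. ereal (1 - k / \<rho> n) \<le> robin_sup TYPE('a) \<beta> 1"
    proof -
      \<comment> \<open>For \<open>q = 1\<close> the leading factor is \<open>powr 0\<close>, which
        equals \<open>1\<close> only at a nonzero base.\<close>
      have "k * \<rho> n \<noteq> 0" for n using k by (simp add: \<rho>_def)
      then show ?thesis using lower[of 1] by simp
    qed
    ultimately show "1 \<le> robin_sup TYPE('a) \<beta> 1"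
      using tendsto_upperbound[of "\<lambda>n. ereal (1 - k / \<rho> n)" "ereal (1 - 0)" sequentially] by (simp add: one_ereal_def)
  qed
  moreover have "robin_sup TYPE('a) \<beta> q < \<infinity>" if q: "1 < q" for q
  proof -
    obtain C where C: "0 < C" and TC: "\<And>\<Omega>::'a set. \<lbrakk>open \<Omega>; bounded \<Omega>; emeasure lborel \<Omega> \<le> 1\<rbrakk> \<Longrightarrow> robin_torsion \<beta> \<Omega> \<le> C"
      by (rule robin_torsion_bounded[OF assms, where 'a = 'a]) blast
    have "robin_sup TYPE('a) \<beta> q \<le> ereal (C powr (q - 1))"
      unfolding robin_sup_def
    proof (rule SUP_least)
      fix \<Omega> :: "'a set" assume "\<Omega> \<in> unit_volume_domains"
      note \<Omega> = unit_volume_domainsD[OF this]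
      let ?T = "robin_torsion \<beta> \<Omega>"
      have T: "0 \<le> ?T" by (rule robin_torsion_nonneg[OF assms \<Omega>])
      \<comment> \<open>At \<open>?T = 0\<close> both sides are \<open>0\<close>, since
        \<open>powr\<close> vanishes at base \<open>0\<close> for every exponent.\<close>
      have "?T powr q = ?T * ?T powr (q - 1)"
        using T powr_add[of ?T 1 "q - 1"] by (cases "?T = 0") simp_all
      then have "robin_eigenvalue \<beta> \<Omega> * ?T powr q = (robin_eigenvalue \<beta> \<Omega> * ?T) * ?T powr (q - 1)" by simp
      also have "\<dots> \<le> 1 * ?T powr (q - 1)"
        by (intro mult_right_mono robin_eigenvalue_mult_torsion_le[OF assms \<Omega>]) simp
      also have "\<dots> \<le> C powr (q - 1)" using T TC[OF \<Omega>] q by (simp add: powr_mono2)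
      finally show "ereal (robin_eigenvalue \<beta> \<Omega> * ?T powr q) \<le> ereal (C powr (q - 1))" by simp
    qed
    then show ?thesis by (rule le_less_trans) simp
  qed
  ultimately show ?thesis by blast
qed

end
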